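(* Let $\{\boldsymbol u_\eta\}$ be a curl free sequence, uniformly bounded in $L^2(\Omega;\mathbb{R}^3)$. Then there exist a subsequence $\{\boldsymbol u_{\eta_k}\}$ and a function $\boldsymbol u_0\in L^2(\Omega,\mathcal H_\sharp(\mathrm{curl}_{\mathbf R_0},Y^m))$ such that $\boldsymbol u_{\eta_k}$ two-scale converges weakly for the matrix $\mathbf R$ to $\boldsymbol u_0(\boldsymbol x,\boldsymbol y)$, and $\boldsymbol u_0$ satisfies $$\mathrm{curl}_{\mathbf R}\,\boldsymbol u_0(\boldsymbol x,\boldsymbol y)=\boldsymbol 0\ \text{ a.e. in }\Omega\times Y^m,\qquad \mathrm{curl}\int_{Y^m}\boldsymbol u_0(\boldsymbol x,\boldsymbol y)\,d\boldsymbol y=\boldsymbol 0\ \text{ a.e. in }\Omega.$$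
   Context: $\Omega\subset\mathbb{R}^3$ is a bounded open set with Lipschitz boundary; $\eta>0$ is a parameter tending to $0$. $\mathbf R$ is a real matrix with $m$ rows and $3$ columns, $m>3$, satisfying $\mathbf R^T\boldsymbol k\neq\boldsymbol 0$ for all $\boldsymbol k\in\mathbb{Z}^m\setminus\{\boldsymbol 0\}$. $Y^m=]0,1[^m$; the subscript $\sharp$ denotes $Y^m$-periodicity in $\boldsymbol y$. Weak two-scale convergence for $\mathbf R$: $(u_\eta)\subset L^2(\Omega)$ converges to $u_0\in L^2(\Omega\times Y^m)$ if $\lim_{\eta\to0}\int_\Omega u_\eta(\boldsymbol x)\varphi(\boldsymbol x,\mathbf R\boldsymbol x/\eta)\,d\boldsymbol x=\int\!\!\int_{\Omega\times Y^m}u_0\varphi\,d\boldsymbol x\,d\boldsymbol y$ for every $\varphi\in L^2(\Omega,C_\sharp(Y^m))$ (componentwise for vector fields). $\mathrm{curl}_{\mathbf R}\,\boldsymbol u=(\mathbf R^T\nabla_{\boldsymbol y})\times\boldsymbol u$, and $\mathcal H_\sharp(\mathrm{curl}_{\mathbf R_0},Y^m)=\{\boldsymbol u\in L^2_\sharp(Y^m;\mathbb{R}^3):\mathrm{curl}_{\mathbf R}\,\boldsymbol u=\boldsymbol 0\}$. *)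

theory Defs
  imports "HOL-Analysis.Analysis"
begin

section \<open>Domains, periods and Lebesgue spaces\<close>

text \<open>
  Near every boundary point, \<open>\<Omega>\<close> is the strict epigraph of a Lipschitz function of two
  variables in a suitable orthonormal frame: \<open>e\<close> is the last vector of that frame, the
  remaining coordinates range over the plane orthogonal to \<open>e\<close>.
\<close>

definition lipschitz_boundary :: "(real^3) set \<Rightarrow> bool" where
  "lipschitz_boundary \<Omega> \<longleftrightarrow>
     (\<forall>p \<in> frontier \<Omega>. \<exists>e r L (\<gamma> :: real^3 \<Rightarrow> real).
        norm e = 1 \<and> r > 0 \<and> L-lipschitz_on {z. z \<bullet> e = 0} \<gamma> \<and>
        \<Omega> \<inter> ball p r = {x \<in> ball p r. x \<bullet> e > \<gamma> (x - (x \<bullet> e) *\<^sub>R e)})"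

definition int_vec :: "int^'m \<Rightarrow> real^'m" where
  "int_vec k = (\<chi> i. of_int (k $ i))"

definition unit_cell :: "(real^'m) set" where
  "unit_cell = {y. \<forall>i. 0 < y $ i \<and> y $ i < 1}"

definition periodic :: "(real^'m \<Rightarrow> 'b) \<Rightarrow> bool" where
  "periodic f \<longleftrightarrow> (\<forall>k y. f (y + int_vec k) = f y)"

definition nonresonant :: "real^3^'m \<Rightarrow> bool" where
  "nonresonant R \<longleftrightarrow> (\<forall>k :: int^'m. k \<noteq> 0 \<longrightarrow> transpose R *v int_vec k \<noteq> 0)"

definition L2_on :: "'a::euclidean_space set \<Rightarrow> ('a \<Rightarrow> 'b::euclidean_space) set" where
  "L2_on S = {f. f \<in> borel_measurable (lebesgue_on S) \<and>
                 integrable (lebesgue_on S) (\<lambda>x. (norm (f x))\<^sup>2)}"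

definition L2_norm_on :: "'a::euclidean_space set \<Rightarrow> ('a \<Rightarrow> 'b::euclidean_space) \<Rightarrow> real" where
  "L2_norm_on S f = sqrt (LINT x|lebesgue_on S. (norm (f x))\<^sup>2)"

definition L2_periodic :: "(real^'m \<Rightarrow> 'b::euclidean_space) set" where
  "L2_periodic = {v. periodic v \<and> v \<in> L2_on unit_cell}"

text \<open>
  The Bochner space \<open>L\<^sup>2(\<Omega>, C\<^sub>#(Y))\<close>. Periodic continuous functions form a separable
  closed subspace of the bounded continuous functions with the supremum norm, so Borel
  measurability of \<open>\<phi>\<close> is strong measurability here.
\<close>

definition L2_C_periodic :: "(real^3) set \<Rightarrow> (real^3 \<Rightarrow> ((real^'m) \<Rightarrow>\<^sub>C real)) set" where
  "L2_C_periodic \<Omega> = {\<phi>. (\<forall>x \<in> \<Omega>. periodic (apply_bcontfun (\<phi> x))) \<and>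
                         \<phi> \<in> borel_measurable (lebesgue_on \<Omega>) \<and>
                         integrable (lebesgue_on \<Omega>) (\<lambda>x. (norm (\<phi> x))\<^sup>2)}"


section \<open>Weak two-scale convergence\<close>

definition two_scale_weak ::
  "real^3^'m \<Rightarrow> (real^3) set \<Rightarrow> (nat \<Rightarrow> real) \<Rightarrow>
   (nat \<Rightarrow> real^3 \<Rightarrow> real) \<Rightarrow> (real^3 \<Rightarrow> real^'m \<Rightarrow> real) \<Rightarrow> bool" where
  "two_scale_weak R \<Omega> \<eta> u u\<^sub>0 \<longleftrightarrow>
     (\<forall>n. u n \<in> L2_on \<Omega>) \<and>
     (\<lambda>(x, y). u\<^sub>0 x y) \<in> L2_on (\<Omega> \<times> unit_cell) \<and>
     (\<forall>\<phi> \<in> L2_C_periodic \<Omega>.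
        (\<lambda>n. LINT x|lebesgue_on \<Omega>. u n x * apply_bcontfun (\<phi> x) ((1 / \<eta> n) *\<^sub>R (R *v x)))
        \<longlonglongrightarrow> (LINT (x, y)|lebesgue_on (\<Omega> \<times> unit_cell). u\<^sub>0 x y * apply_bcontfun (\<phi> x) y))"

definition two_scale_weak_vec ::
  "real^3^'m \<Rightarrow> (real^3) set \<Rightarrow> (nat \<Rightarrow> real) \<Rightarrow>
   (nat \<Rightarrow> real^3 \<Rightarrow> real^3) \<Rightarrow> (real^3 \<Rightarrow> real^'m \<Rightarrow> real^3) \<Rightarrow> bool" where
  "two_scale_weak_vec R \<Omega> \<eta> u u\<^sub>0 \<longleftrightarrow>
     (\<forall>i. two_scale_weak R \<Omega> \<eta> (\<lambda>n x. u n x $ i) (\<lambda>x y. u\<^sub>0 x y $ i))"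


section \<open>Distributional curl\<close>

definition partial_deriv :: "'n::finite \<Rightarrow> (real^'n \<Rightarrow> real) \<Rightarrow> real^'n \<Rightarrow> real" where
  "partial_deriv j f x = frechet_derivative f (at x) (axis j 1)"

primrec C_k :: "nat \<Rightarrow> (real^'n::finite \<Rightarrow> real) \<Rightarrow> bool" where
  "C_k 0 f \<longleftrightarrow> continuous_on UNIV f"
| "C_k (Suc k) f \<longleftrightarrow> f differentiable_on UNIV \<and> (\<forall>j. C_k k (partial_deriv j f))"

definition test_fields :: "(real^'n::finite) set \<Rightarrow> (real^'n \<Rightarrow> real^3) set" where
  "test_fields S = {\<psi>. (\<forall>i k. C_k k (\<lambda>x. \<psi> x $ i)) \<and>
                        compact (closure {x. \<psi> x \<noteq> 0}) \<and> closure {x. \<psi> x \<noteq> 0} \<subseteq> S}"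

definition grad :: "(real^'n::finite \<Rightarrow> real) \<Rightarrow> real^'n \<Rightarrow> real^'n" where
  "grad f x = (\<chi> j. partial_deriv j f x)"

definition grad_R :: "real^3^'m \<Rightarrow> (real^'m \<Rightarrow> real) \<Rightarrow> real^'m \<Rightarrow> real^3" where
  "grad_R R f y = transpose R *v grad f y"

text \<open>
  The formal cross product \<open>D \<times> \<psi>\<close> for an operator \<open>D\<close> with three components:
  \<open>D = grad\<close> on \<open>real^3\<close> gives the usual curl, \<open>D = grad_R R\<close> the curl along \<open>R\<close>.
\<close>

definition curl_op ::
  "((real^'n::finite \<Rightarrow> real) \<Rightarrow> real^'n \<Rightarrow> real^3) \<Rightarrow> (real^'n \<Rightarrow> real^3) \<Rightarrow> real^'n \<Rightarrow> real^3" where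
  "curl_op D \<psi> x =
     vector [D (\<lambda>z. \<psi> z $ 3) x $ 2 - D (\<lambda>z. \<psi> z $ 2) x $ 3,
             D (\<lambda>z. \<psi> z $ 1) x $ 3 - D (\<lambda>z. \<psi> z $ 3) x $ 1,
             D (\<lambda>z. \<psi> z $ 2) x $ 1 - D (\<lambda>z. \<psi> z $ 1) x $ 2]"

definition locally_integrable_on ::
  "'a::euclidean_space set \<Rightarrow> ('a \<Rightarrow> 'b::euclidean_space) \<Rightarrow> bool" where
  "locally_integrable_on S f \<longleftrightarrow> (\<forall>K. compact K \<and> K \<subseteq> S \<longrightarrow> integrable (lebesgue_on K) f)"

text \<open>
  \<open>w\<close> is the curl of \<open>v\<close> in the sense of distributions on the open set \<open>S\<close>. The curl of a
  constant-coefficient first-order \<open>D\<close> is its own formal transpose (the sign from integrating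
  by parts cancels against the antisymmetry of the cross product), so no sign appears.
\<close>

definition has_weak_curl_on ::
  "((real^'n::finite \<Rightarrow> real) \<Rightarrow> real^'n \<Rightarrow> real^3) \<Rightarrow> (real^'n) set \<Rightarrow>
   (real^'n \<Rightarrow> real^3) \<Rightarrow> (real^'n \<Rightarrow> real^3) \<Rightarrow> bool" where
  "has_weak_curl_on D S v w \<longleftrightarrow>
     locally_integrable_on S v \<and> locally_integrable_on S w \<and>
     (\<forall>\<psi> \<in> test_fields S.
        (LINT x|lebesgue_on S. v x \<bullet> curl_op D \<psi> x) = (LINT x|lebesgue_on S. w x \<bullet> \<psi> x))"

text \<open>
  Elements are periodic functions on the whole space, and their curl is taken there: the
  identity also sees jumps across the faces of the unit cell.
\<close>

definition H_curl_R0 :: "real^3^'m \<Rightarrow> (real^'m \<Rightarrow> real^3) set" where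
  "H_curl_R0 R = {v \<in> L2_periodic. has_weak_curl_on (grad_R R) UNIV v (\<lambda>_. 0)}"

text \<open>
  \<open>L\<^sup>2(\<Omega>, H_curl_R0 R)\<close>, with a function into \<open>L\<^sup>2\<close> of the unit cell identified, as usual, with
  a jointly measurable function on the product.
\<close>

definition L2_H_curl_R0 :: "(real^3) set \<Rightarrow> real^3^'m \<Rightarrow> (real^3 \<Rightarrow> real^'m \<Rightarrow> real^3) set" where
  "L2_H_curl_R0 \<Omega> R = {u\<^sub>0. (\<lambda>(x, y). u\<^sub>0 x y) \<in> L2_on (\<Omega> \<times> unit_cell) \<and>
                           (AE x in lebesgue_on \<Omega>. u\<^sub>0 x \<in> H_curl_R0 R)}"

end

theory Submission
  imports Defs "HOL-Complex_Analysis.Great_Picard"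
begin

text \<open>
  The statement is a compactness result for fields that oscillate along the irrational plane
  \<open>x \<mapsto> R *v x / \<eta>\<close> of the torus. It has three ingredients.

  \<^bold>\<open>Equidistribution.\<close> Because \<open>R\<close> is nonresonant, each nonconstant character
  \<open>cos (2 \<pi> k \<bullet> R x / \<eta> + \<theta>)\<close> is a plane wave whose frequency tends to infinity, so its
  integral over an open set of finite measure tends to zero (\<open>Riemann_Lebesgue_open\<close>). Trigonometric polynomials
  are dense among the periodic continuous functions (\<open>trig_poly_dense\<close>), so the mean of
  \<open>p (R x / \<eta>)\<close> over such a set tends to the mean of \<open>p\<close> over the cell
  (\<open>equidistribution\<close>).

  \<^bold>\<open>Compactness.\<close> The test functions \<open>L\<^sup>2(\<Omega>, C\<^sub>#(Y))\<close> have a countable set of generators, namely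
  an indicator of an open set from a countable family times a rational trigonometric polynomial,
  whose span is dense (\<open>trig_tests_dense\<close>). A diagonal subsequence makes all the integrals against
  the generators converge. The limit is a linear functional of the test function \<open>f\<close>. By
  Cauchy-Schwarz it is bounded by a constant times the limit of the \<open>L\<^sup>2\<close> norms of
  \<open>f (x, R x / \<eta>)\<close>, and equidistribution applied to \<open>f\<^sup>2\<close> identifies that limit with the norm of
  \<open>f\<close> in \<open>L\<^sup>2(\<Omega> \<times> Y)\<close>. The Riesz representation theorem (\<open>Riesz_representation_L2\<close>)
  yields the two-scale limit, and density extends the convergence to all tests
  (\<open>two_scale_limit_exists\<close>).

  \<^bold>\<open>The two curl equations.\<close> A field that does not depend on \<open>y\<close> is a legitimate test, so the curl
  equation of \<open>u\<^sub>\<eta>\<close> passes directly to the mean of the limit (\<open>limit_field_mean_curl\<close>). For the curl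
  along \<open>R\<close>, a test field \<open>\<psi>\<close> on \<open>y\<close>-space is summed over lattice translates, multiplied by a
  bump \<open>\<theta>\<close> in \<open>\<Omega>\<close>, evaluated at \<open>R x / \<eta>\<close> and multiplied by \<open>\<eta>\<close>. In the curl of this field the
  factor \<open>\<eta>\<close> cancels where the derivative falls on the fast variable and survives elsewhere, so in
  the limit only \<open>\<theta>\<close> times the curl along \<open>R\<close> of the periodized \<open>\<psi>\<close> remains. Varying \<open>\<theta>\<close> gives the
  equation for almost every \<open>x\<close>, with an exceptional set that depends on \<open>\<psi>\<close>
  (\<open>fibre_curl_zero\<close>). The periodic continuous functions form a separable space, hence countably
  many \<open>\<psi>\<close> suffice and one exceptional set serves all of them (\<open>fibre_curl_zero_all\<close>).
\<close>

section \<open>Completeness and Riesz representation in \<open>L\<^sup>2\<close>\<close>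

lemma integrable_mult_L2:
  fixes f g :: "'a \<Rightarrow> real"
  assumes [measurable]: "f \<in> borel_measurable M" "g \<in> borel_measurable M"
    and f2: "integrable M (\<lambda>x. (f x)\<^sup>2)" and g2: "integrable M (\<lambda>x. (g x)\<^sup>2)"
  shows "integrable M (\<lambda>x. f x * g x)"
proof (rule Bochner_Integration.integrable_bound[OF Bochner_Integration.integrable_add[OF f2 g2]])
  show "AE x in M. norm (f x * g x) \<le> norm ((f x)\<^sup>2 + (g x)\<^sup>2)"
  proof (rule AE_I2)
    fix x
    have "2 * \<bar>f x\<bar> * \<bar>g x\<bar> \<le> \<bar>f x\<bar>\<^sup>2 + \<bar>g x\<bar>\<^sup>2" by (rule sum_squares_bound)
    moreover have "0 \<le> \<bar>f x\<bar> * \<bar>g x\<bar>" by simp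
    ultimately have "\<bar>f x\<bar> * \<bar>g x\<bar> \<le> (f x)\<^sup>2 + (g x)\<^sup>2"
      unfolding power2_abs by linarith
    then show "norm (f x * g x) \<le> norm ((f x)\<^sup>2 + (g x)\<^sup>2)"
      by (simp add: abs_mult)
  qed
qed simp

lemma integrable_add_L2:
  fixes f g :: "'a \<Rightarrow> real"
  assumes [measurable]: "f \<in> borel_measurable M" "g \<in> borel_measurable M"
    and f2: "integrable M (\<lambda>x. (f x)\<^sup>2)" and g2: "integrable M (\<lambda>x. (g x)\<^sup>2)"
  shows "integrable M (\<lambda>x. (f x + g x)\<^sup>2)"
proof -
  have "integrable M (\<lambda>x. (f x)\<^sup>2 + (g x)\<^sup>2 + 2 * (f x * g x))"
    using integrable_mult_L2[OF assms] f2 g2 by auto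
  then show ?thesis by (simp add: power2_sum algebra_simps)
qed

lemma integrable_diff_L2:
  fixes f g :: "'a \<Rightarrow> real"
  assumes [measurable]: "f \<in> borel_measurable M" "g \<in> borel_measurable M"
    and f2: "integrable M (\<lambda>x. (f x)\<^sup>2)" and g2: "integrable M (\<lambda>x. (g x)\<^sup>2)"
  shows "integrable M (\<lambda>x. (f x - g x)\<^sup>2)"
  using integrable_add_L2[of f M "\<lambda>x. - g x"] assms by simp

lemma Cauchy_Schwarz_integral:
  fixes f g :: "'a \<Rightarrow> real"
  assumes [measurable]: "f \<in> borel_measurable M" "g \<in> borel_measurable M"
    and f2: "integrable M (\<lambda>x. (f x)\<^sup>2)" and g2: "integrable M (\<lambda>x. (g x)\<^sup>2)"
  shows "\<bar>LINT x|M. f x * g x\<bar> \<le> sqrt (LINT x|M. (f x)\<^sup>2) * sqrt (LINT x|M. (g x)\<^sup>2)"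
proof -
  let ?F = "LINT x|M. (f x)\<^sup>2" and ?G = "LINT x|M. (g x)\<^sup>2" and ?H = "LINT x|M. f x * g x"
  have fg: "integrable M (\<lambda>x. f x * g x)" by (rule integrable_mult_L2[OF assms])
  have q: "0 \<le> s\<^sup>2 * ?F + 2 * s * t * ?H + t\<^sup>2 * ?G" for s t
  proof -
    have "0 \<le> (LINT x|M. (s * f x + t * g x)\<^sup>2)" by simp
    also have "\<dots> = (LINT x|M. s\<^sup>2 * (f x)\<^sup>2 + 2 * s * t * (f x * g x) + t\<^sup>2 * (g x)\<^sup>2)"
      by (rule Bochner_Integration.integral_cong) (auto simp: power2_eq_square algebra_simps)
    also have "\<dots> = s\<^sup>2 * ?F + 2 * s * t * ?H + t\<^sup>2 * ?G"
      using f2 g2 fg by simp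
    finally show ?thesis .
  qed
  have G0: "0 \<le> ?G" and F0: "0 \<le> ?F" by auto
  have "?H\<^sup>2 \<le> ?F * ?G"
  proof (cases "?G = 0")
    case True
    show ?thesis
    proof (rule ccontr)
      assume "\<not> ?thesis"
      then have H0: "?H \<noteq> 0" using True by auto
      have "0 \<le> 1\<^sup>2 * ?F + 2 * 1 * (- (?F + 1) / ?H) * ?H + (- (?F + 1) / ?H)\<^sup>2 * ?G" by (rule q)
      then show False using True H0 F0 by simp
    qed
  next
    case False
    then have "?G > 0" using G0 by linarith
    have "0 \<le> ?G\<^sup>2 * ?F + 2 * ?G * (- ?H) * ?H + (- ?H)\<^sup>2 * ?G" by (rule q)
    then have "0 \<le> ?G * (?F * ?G - ?H\<^sup>2)" by (simp add: power2_eq_square algebra_simps)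
    then show ?thesis using \<open>?G > 0\<close> by (simp add: zero_le_mult_iff)
  qed
  then show ?thesis by (metis real_sqrt_abs real_sqrt_le_iff real_sqrt_mult)
qed

text \<open>
  Fast Cauchy sequences in \<open>L\<^sup>2\<close>: the differences of consecutive terms, squared and weighted by
  \<open>2\<^sup>n\<close>, still have summable integrals, which gives pointwise convergence almost everywhere; Fatou's
  lemma turns the Cauchy bound into a bound for the distance to the limit.
\<close>
lemma L2_complete:
  fixes f :: "nat \<Rightarrow> 'a \<Rightarrow> real"
  assumes [measurable]: "\<And>n. f n \<in> borel_measurable M"
    and f2: "\<And>n. integrable M (\<lambda>x. (f n x)\<^sup>2)"
    and cauchy: "\<And>n k. n \<le> k \<Longrightarrow> (LINT x|M. (f k x - f n x)\<^sup>2) \<le> (1/4)^n"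
  obtains h where "h \<in> borel_measurable M" "integrable M (\<lambda>x. (h x)\<^sup>2)"
    "\<And>n. (LINT x|M. (h x - f n x)\<^sup>2) \<le> (1/4)^n"
proof -
  have df2: "integrable M (\<lambda>x. (f k x - f n x)\<^sup>2)" for k n
    by (rule integrable_diff_L2) (use f2 in auto)
  have nn: "(\<integral>\<^sup>+x. ennreal ((f k x - f n x)\<^sup>2) \<partial>M) \<le> ennreal ((1/4)^n)" if "n \<le> k" for n k
    using cauchy[OF that] nn_integral_eq_integral[OF df2[of k n]] by (simp add: ennreal_leI)
  define D where "D x = (\<Sum>n. ennreal (2^n * (f (Suc n) x - f n x)\<^sup>2))" for x
  have [measurable]: "D \<in> borel_measurable M" unfolding D_def by measurable
  have "(\<integral>\<^sup>+x. D x \<partial>M) = (\<Sum>n. \<integral>\<^sup>+x. ennreal (2^n * (f (Suc n) x - f n x)\<^sup>2) \<partial>M)"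
    unfolding D_def by (rule nn_integral_suminf) measurable
  also have "\<dots> \<le> (\<Sum>n. ennreal ((1/2)^n))"
  proof (intro suminf_le summableI)
    fix n
    have "(\<integral>\<^sup>+x. ennreal (2^n * (f (Suc n) x - f n x)\<^sup>2) \<partial>M)
        = ennreal (2^n) * (\<integral>\<^sup>+x. ennreal ((f (Suc n) x - f n x)\<^sup>2) \<partial>M)"
      by (subst nn_integral_cmult[symmetric]) (auto simp: ennreal_mult)
    also have "\<dots> \<le> ennreal (2^n) * ennreal ((1/4)^n)"
      by (intro mult_left_mono nn) auto
    also have "\<dots> = ennreal ((1/2)^n)"
    proof -
      have "(2::real)^n * (1/4)^n = (1/2)^n" by (simp add: power_mult_distrib[symmetric])
      then show ?thesis by (simp add: ennreal_mult[symmetric])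
    qed
    finally show "(\<integral>\<^sup>+x. ennreal (2^n * (f (Suc n) x - f n x)\<^sup>2) \<partial>M) \<le> ennreal ((1/2)^n)" .
  qed
  also have "\<dots> = ennreal (\<Sum>n. (1/2)^n)"
    by (rule suminf_ennreal2) (auto intro: summable_geometric)
  also have "\<dots> < \<infinity>" by simp
  finally have "AE x in M. D x \<noteq> \<infinity>"
    by (intro nn_integral_PInf_AE) auto
  then have conv: "AE x in M. convergent (\<lambda>n. f n x)"
  proof eventually_elim
    case (elim x)
    have "summable (\<lambda>n. 2^n * (f (Suc n) x - f n x)\<^sup>2)"
      by (rule summable_suminf_not_top) (use elim in \<open>auto simp: D_def\<close>)
    then have "summable (\<lambda>n. (1/2)^n + 2^n * (f (Suc n) x - f n x)\<^sup>2)"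
      by (intro summable_add summable_geometric) auto
    then have "summable (\<lambda>n. f (Suc n) x - f n x)"
    proof (rule summable_comparison_test[rotated], intro exI[of _ 0] allI impI)
      fix n
      define t where "t = \<bar>f (Suc n) x - f n x\<bar>"
      have "t \<le> (1/2)^n + 2^n * t\<^sup>2"
      proof (cases "t \<le> (1/2)^n")
        case False
        then have "1 \<le> 2^n * t" by (simp add: power_one_over field_simps)
        moreover have "t \<ge> 0" by (simp add: t_def)
        ultimately have "t * 1 \<le> t * (2^n * t)" by (intro mult_left_mono)
        then have "t \<le> 2^n * t\<^sup>2" by (simp add: power2_eq_square algebra_simps)
        then show ?thesis by (smt (verit) zero_le_power divide_nonneg_pos)
      qed (simp add: t_def add_increasing2)
      then show "norm (f (Suc n) x - f n x) \<le> (1/2)^n + 2^n * (f (Suc n) x - f n x)\<^sup>2"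
        by (simp add: t_def)
    qed
    then have "convergent (\<lambda>n. \<Sum>i<n. f (Suc i) x - f i x)"
      by (simp only: summable_iff_convergent)
    then have "convergent (\<lambda>n. f n x - f 0 x)" using sum_lessThan_telescope[of "\<lambda>i. f i x"] by simp
    then show ?case using convergent_diff_const_right_iff by blast
  qed
  define h where "h x = lim (\<lambda>n. f n x)" for x
  have hm[measurable]: "h \<in> borel_measurable M" unfolding h_def by measurable
  have fh: "AE x in M. (\<lambda>n. f n x) \<longlonglongrightarrow> h x"
    using conv by eventually_elim (simp add: h_def convergent_LIMSEQ_iff)
  have lim: "(\<integral>\<^sup>+x. ennreal ((h x - f n x)\<^sup>2) \<partial>M) \<le> ennreal ((1/4)^n)" for n
  proof -
    have "(\<integral>\<^sup>+x. ennreal ((h x - f n x)\<^sup>2) \<partial>M)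
        = (\<integral>\<^sup>+x. liminf (\<lambda>k. ennreal ((f k x - f n x)\<^sup>2)) \<partial>M)"
    proof (rule nn_integral_cong_AE, use fh in eventually_elim)
      case (elim x)
      have "(\<lambda>k. ennreal ((f k x - f n x)\<^sup>2)) \<longlonglongrightarrow> ennreal ((h x - f n x)\<^sup>2)"
        by (intro tendsto_intros elim)
      then show ?case by (rule lim_imp_Liminf[symmetric, rotated]) simp
    qed
    also have "\<dots> \<le> liminf (\<lambda>k. \<integral>\<^sup>+x. ennreal ((f k x - f n x)\<^sup>2) \<partial>M)"
      by (rule nn_integral_liminf) measurable
    also have "\<dots> \<le> ennreal ((1/4)^n)"
      by (rule order_trans[OF Liminf_le_Limsup Limsup_bounded])
        (auto intro!: eventually_sequentiallyI[of n] nn)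
    finally show ?thesis .
  qed
  have hf: "integrable M (\<lambda>x. (h x - f n x)\<^sup>2)" for n
    using lim[of n] by (intro integrableI_bounded) (auto simp: top_unique less_top[symmetric] intro: le_less_trans)
  have "integrable M (\<lambda>x. ((h x - f 0 x) + f 0 x)\<^sup>2)"
    by (rule integrable_add_L2) (use hf f2 in auto)
  then have "integrable M (\<lambda>x. (h x)\<^sup>2)" by simp
  moreover have "(LINT x|M. (h x - f n x)\<^sup>2) \<le> (1/4)^n" for n
    using lim[of n] nn_integral_eq_integral[OF hf[of n]] by simp
  ultimately show thesis using that hm by blast
qed

text \<open>
  Riesz representation on a linear subspace \<open>V\<close> that need not be closed: a minimising sequence of
  \<open>\<integral>f\<^sup>2 - 2 L f\<close> in \<open>V\<close> is Cauchy, and the variation of this functional in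
  the direction \<open>g\<close> shows that its \<open>L\<^sup>2\<close> limit represents \<open>L\<close> on \<open>V\<close>.
\<close>
lemma Riesz_representation_L2:
  fixes V :: "('a \<Rightarrow> real) set" and L :: "('a \<Rightarrow> real) \<Rightarrow> real"
  assumes meas: "\<And>f. f \<in> V \<Longrightarrow> f \<in> borel_measurable M"
    and sq: "\<And>f. f \<in> V \<Longrightarrow> integrable M (\<lambda>x. (f x)\<^sup>2)"
    and zero: "(\<lambda>x. 0) \<in> V"
    and lin: "\<And>f g c. f \<in> V \<Longrightarrow> g \<in> V \<Longrightarrow> (\<lambda>x. f x + c * g x) \<in> V"
    and L: "\<And>f g c. f \<in> V \<Longrightarrow> g \<in> V \<Longrightarrow> L (\<lambda>x. f x + c * g x) = L f + c * L g"
    and bnd: "\<And>f. f \<in> V \<Longrightarrow> \<bar>L f\<bar> \<le> C * sqrt (LINT x|M. (f x)\<^sup>2)"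
  obtains h where "h \<in> borel_measurable M" "integrable M (\<lambda>x. (h x)\<^sup>2)"
    "\<And>f. f \<in> V \<Longrightarrow> (LINT x|M. h x * f x) = L f"
proof -
  let ?N = "\<lambda>f. LINT x|M. (f x)\<^sup>2"
  let ?I = "\<lambda>f g. LINT x|M. f x * g x"
  define J where "J f = ?N f - 2 * L f" for f
  have I: "integrable M (\<lambda>x. f x * g x)" if "f \<in> V" "g \<in> V" for f g
    using that by (intro integrable_mult_L2 meas sq)
  have N_lin: "?N (\<lambda>x. f x + c * g x) = ?N f + 2 * c * ?I f g + c\<^sup>2 * ?N g"
    if "f \<in> V" "g \<in> V" for f g c
  proof -
    have "?N (\<lambda>x. f x + c * g x) = (LINT x|M. (f x)\<^sup>2 + 2 * c * (f x * g x) + c\<^sup>2 * (g x)\<^sup>2)"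
      by (rule Bochner_Integration.integral_cong) (auto simp: power2_eq_square algebra_simps)
    then show ?thesis using that I sq by simp
  qed
  have lower: "- C\<^sup>2 \<le> J f" if "f \<in> V" for f
  proof -
    define s where "s = sqrt (?N f)"
    have "?N f = s\<^sup>2" by (simp add: s_def)
    moreover have "L f \<le> C * s" using bnd[OF that] by (simp add: s_def)
    moreover have "0 \<le> (s - C)\<^sup>2" by simp
    ultimately show ?thesis by (simp add: J_def power2_eq_square algebra_simps)
  qed
  define m where "m = Inf (J ` V)"
  have bdd: "bdd_below (J ` V)" by (rule bdd_belowI2) (rule lower)
  have m_le: "m \<le> J f" if "f \<in> V" for f
    unfolding m_def using bdd that by (auto intro: cInf_lower)
  \<comment> \<open>This excess makes the minimising sequence a fast Cauchy sequence.\<close>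
  define \<epsilon> where "\<epsilon> n = (1/4 :: real) ^ n / 4" for n
  have \<epsilon>0: "0 < \<epsilon> n" for n by (simp add: \<epsilon>_def)
  have "\<exists>f\<in>V. J f < m + \<epsilon> n" for n
    using cInf_lessD[of "J ` V" "m + \<epsilon> n"] \<epsilon>0[of n] zero by (auto simp: m_def)
  then obtain f where fV: "\<And>n. f n \<in> V" and fJ: "\<And>n. J (f n) < m + \<epsilon> n" by metis
  \<comment> \<open>The midpoint of two near-minimisers lies in \<open>V\<close>, so the parallelogram law bounds their
    distance by their excess over the infimum.\<close>
  have par: "?N (\<lambda>x. f k x - f n x) \<le> 2 * \<epsilon> k + 2 * \<epsilon> n" for k n
  proof -
    have half: "(\<lambda>x. 0 + (1/2) * (f k x + 1 * f n x)) \<in> V"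
      by (intro lin zero fV)
    have quarter: "4 * m \<le> a + 2 * b + c - 4 * p - 4 * q"
      if "m \<le> 1/4 * (a + 2 * b + c) - 2 * (0 + 1/2 * (p + q))" for a b c p q
      using that by (simp add: field_simps)
    have "m \<le> J (\<lambda>x. 0 + (1/2) * (f k x + 1 * f n x))" by (rule m_le[OF half])
    also have "\<dots> = ?N (\<lambda>x. 0 + (1/2) * (f k x + 1 * f n x)) - 2 * (L (\<lambda>x. 0) + (1/2) * (L (f k) + L (f n)))"
      using L[OF zero lin[OF fV fV, of k 1 n], of "1/2"] L[OF fV fV, of k 1 n]
      by (simp add: J_def)
    also have "L (\<lambda>x. 0) = 0" using bnd[OF zero] by simp
    also have "?N (\<lambda>x. 0 + (1/2) * (f k x + 1 * f n x)) = (1/4) * ?N (\<lambda>x. f k x + 1 * f n x)"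
      by (subst integral_mult_right_zero[symmetric])
         (rule Bochner_Integration.integral_cong, auto simp: power2_eq_square algebra_simps)
    also have "?N (\<lambda>x. f k x + 1 * f n x) = ?N (f k) + 2 * ?I (f k) (f n) + ?N (f n)"
      using N_lin[OF fV fV, of k 1 n] by simp
    finally have "4 * m \<le> ?N (f k) + 2 * ?I (f k) (f n) + ?N (f n) - 4 * L (f k) - 4 * L (f n)"
      by (rule quarter)
    moreover have "?N (\<lambda>x. f k x + (-1) * f n x) = ?N (f k) - 2 * ?I (f k) (f n) + ?N (f n)"
      using N_lin[OF fV fV, of k "-1" n] by simp
    ultimately show ?thesis using fJ[of k] fJ[of n] by (simp add: J_def)
  qed
  have cau: "?N (\<lambda>x. f k x - f n x) \<le> (1/4)^n" if "n \<le> k" for n k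
  proof -
    have "\<epsilon> k \<le> \<epsilon> n" unfolding \<epsilon>_def using that by (intro divide_right_mono power_decreasing) auto
    then have "?N (\<lambda>x. f k x - f n x) \<le> 4 * \<epsilon> n" using par[of k n] \<epsilon>0[of n] by linarith
    then show ?thesis by (simp add: \<epsilon>_def)
  qed
  obtain h where hm: "h \<in> borel_measurable M" and h2: "integrable M (\<lambda>x. (h x)\<^sup>2)"
    and hf: "\<And>n. ?N (\<lambda>x. h x - f n x) \<le> (1/4)^n"
    using L2_complete[OF meas[OF fV] sq[OF fV] cau] by blast
  have "?I h g = L g" if g: "g \<in> V" for g
  proof -
    define G where "G = ?N g"
    have G0: "0 \<le> G" by (simp add: G_def)
    have var: "\<bar>?I (f n) g - L g\<bar> \<le> sqrt (\<epsilon> n) * (G + 1)" for n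
    proof -
      define b where "b = ?I (f n) g - L g"
      have *: "- \<epsilon> n \<le> 2 * t * b + t\<^sup>2 * G" for t
      proof -
        have "m \<le> J (\<lambda>x. f n x + t * g x)" by (intro m_le lin fV g)
        also have "\<dots> = J (f n) + 2 * t * b + t\<^sup>2 * G"
          using N_lin[OF fV g, of n t] L[OF fV g, of n t]
          by (simp add: J_def b_def G_def algebra_simps)
        finally show ?thesis using fJ[of n] by simp
      qed
      define s where "s = sqrt (\<epsilon> n)"
      have s: "s > 0" "\<epsilon> n = s\<^sup>2" using \<epsilon>0[of n] by (auto simp: s_def)
      have "s * (2 * \<bar>b\<bar>) \<le> s * (s * (1 + G))"
        using *[of s] *[of "-s"] s by (auto simp: power2_eq_square algebra_simps abs_if)
      then have "2 * \<bar>b\<bar> \<le> s * (1 + G)" using s by simp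
      moreover have "0 \<le> s * (1 + G)" using s G0 by simp
      ultimately have "\<bar>b\<bar> \<le> s * (G + 1)" by (simp add: algebra_simps)
      then show ?thesis by (simp add: b_def s_def)
    qed
    have "\<bar>?I h g - L g\<bar> \<le> sqrt ((1/4)^n) * sqrt G + sqrt (\<epsilon> n) * (G + 1)" for n
    proof -
      have [measurable]: "h \<in> borel_measurable M" "g \<in> borel_measurable M" "f n \<in> borel_measurable M"
        using hm meas[OF g] meas[OF fV] by auto
      have "?I h g - ?I (f n) g = ?I (\<lambda>x. h x - f n x) g"
        using integrable_mult_L2[of h M g] h2 sq[OF g] I[OF fV g]
        by (simp add: left_diff_distrib)
      also have "\<bar>\<dots>\<bar> \<le> sqrt (?N (\<lambda>x. h x - f n x)) * sqrt G"
        unfolding G_def by (rule Cauchy_Schwarz_integral)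
          (auto intro!: integrable_diff_L2 h2 sq[OF fV] sq[OF g])
      also have "\<dots> \<le> sqrt ((1/4)^n) * sqrt G"
        by (intro mult_right_mono real_sqrt_le_mono hf) (use G0 in auto)
      finally show ?thesis using var[of n] by simp
    qed
    moreover have "(\<lambda>n. sqrt ((1/4)^n) * sqrt G + sqrt (\<epsilon> n) * (G + 1)) \<longlonglongrightarrow>
        sqrt 0 * sqrt G + sqrt (0 / 4) * (G + 1)"
      unfolding \<epsilon>_def by (intro tendsto_intros LIMSEQ_power_zero) auto
    ultimately have "\<bar>?I h g - L g\<bar> \<le> 0"
      by (intro LIMSEQ_le_const) auto
    then show ?thesis by simp
  qed
  then show thesis using that hm h2 by blast
qed

section \<open>The lattice and the unit cell\<close>

lemma lborel_shift:
  fixes f :: "'a::euclidean_space \<Rightarrow> 'b::{banach, second_countable_topology}"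
  assumes [measurable]: "f \<in> borel_measurable borel"
  shows "integrable lborel (\<lambda>y. f (y + c)) \<longleftrightarrow> integrable lborel f"
    and "(LINT y|lborel. f (y + c)) = (LINT y|lborel. f y)"
proof -
  have d: "distr lborel borel (\<lambda>y. y + c) = lborel"
  proof -
    have "(\<lambda>y. y + c) = (+) c" by (simp add: fun_eq_iff add.commute)
    then show ?thesis using lborel_distr_plus[of c] by simp
  qed
  show "integrable lborel (\<lambda>y. f (y + c)) \<longleftrightarrow> integrable lborel f"
    using integrable_distr_eq[of "\<lambda>y. y + c" lborel borel f] by (simp add: d)
  show "(LINT y|lborel. f (y + c)) = (LINT y|lborel. f y)"
    using integral_distr[of "\<lambda>y. y + c" lborel borel f] by (simp add: d)
qed

text \<open>
  Unlike \<^const>\<open>unit_cell\<close>, the half-open cell tiles space exactly; the two differ by a null set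
  (\<open>AE_cell_iff\<close>).
\<close>
definition half_open_cell :: "(real^'m) set" where
  "half_open_cell = {y. \<forall>i. 0 \<le> y $ i \<and> y $ i < 1}"

definition int_part :: "real^'m \<Rightarrow> int^'m" where
  "int_part y = (\<chi> i. \<lfloor>y $ i\<rfloor>)"

definition frac_part :: "real^'m \<Rightarrow> real^'m" where
  "frac_part y = y - int_vec (int_part y)"

lemma int_vec_nth [simp]: "int_vec k $ i = of_int (k $ i)"
  by (simp add: int_vec_def)

lemma int_vec_add: "int_vec (j + k) = int_vec j + int_vec k"
  and int_vec_uminus: "int_vec (- k) = - int_vec k"
  and int_vec_0 [simp]: "int_vec 0 = 0"
  and int_vec_diff: "int_vec (j - k) = int_vec j - int_vec k"
  by (simp_all add: vec_eq_iff)

lemma frac_part_in_cell: "frac_part y \<in> half_open_cell"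
  by (simp add: half_open_cell_def frac_part_def int_part_def) linarith

lemma diff_int_vec_in_cell_iff: "y - int_vec k \<in> half_open_cell \<longleftrightarrow> k = int_part y"
proof -
  have "0 \<le> y $ i - of_int (k $ i) \<and> y $ i - of_int (k $ i) < 1 \<longleftrightarrow> k $ i = \<lfloor>y $ i\<rfloor>" for i
    by (smt (verit) floor_eq_iff floor_correct)
  then show ?thesis by (simp add: half_open_cell_def int_part_def vec_eq_iff)
qed

lemma int_part_cell: "y \<in> half_open_cell \<Longrightarrow> int_part y = 0"
  using diff_int_vec_in_cell_iff[of y 0] by simp

lemma int_part_add_int_vec: "int_part (y + int_vec k) = int_part y + k"
  by (simp add: int_part_def vec_eq_iff)

lemma frac_part_eq: "y \<in> half_open_cell \<Longrightarrow> frac_part y = y"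
  by (simp add: frac_part_def int_part_cell)

lemma frac_part_add_int_vec [simp]: "frac_part (y + int_vec k) = frac_part y"
  by (simp add: frac_part_def int_part_add_int_vec int_vec_add)

lemma periodicD: "periodic f \<Longrightarrow> f (y + int_vec k) = f y"
  by (simp add: periodic_def)

lemma periodic_minus: "periodic f \<Longrightarrow> f (y - int_vec k) = f y"
  using periodicD[of f y "- k"] by (simp add: int_vec_uminus)

lemma periodic_frac_part: "periodic f \<Longrightarrow> f (frac_part y) = f y"
  by (simp add: frac_part_def periodic_minus)

lemma half_open_cell_borel [measurable]: "half_open_cell \<in> sets borel"
  unfolding half_open_cell_def by measurable

lemma unit_cell_borel [measurable]: "unit_cell \<in> sets borel"
  unfolding unit_cell_def by measurable

lemma frac_part_measurable [measurable]: "frac_part \<in> borel_measurable borel"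
proof -
  have "(\<lambda>y. frac_part y $ i) \<in> borel_measurable borel" for i
    by (simp add: frac_part_def int_part_def)
  then show ?thesis
    by (subst borel_measurable_euclidean_space) (auto simp: Basis_vec_def inner_axis)
qed

lemma unit_cell_eq_box: "unit_cell = box 0 (1 :: real^'m)"
  by (auto simp: unit_cell_def mem_box_cart)

lemma cell_sandwich: "unit_cell \<subseteq> half_open_cell" "half_open_cell \<subseteq> cbox 0 (1 :: real^'m)"
  by (auto simp: unit_cell_def half_open_cell_def mem_box_cart less_imp_le)

lemma bounded_half_open_cell: "bounded (half_open_cell :: (real^'m) set)"
  using cell_sandwich(2) bounded_cbox bounded_subset by blast

lemma emeasure_unit_cell [simp]: "emeasure lborel (unit_cell :: (real^'m) set) = 1"
proof -
  have "emeasure lborel (box 0 (1 :: real^'m)) = (\<Prod>b\<in>(Basis :: (real^'m) set). ((1 :: real^'m) - 0) \<bullet> b)"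
    by (rule emeasure_lborel_box) (auto simp: Basis_vec_def inner_axis)
  also have "(\<Prod>b\<in>(Basis :: (real^'m) set). ((1 :: real^'m) - 0) \<bullet> b) = 1"
    by (rule prod.neutral) (auto simp: Basis_vec_def inner_axis)
  finally show ?thesis by (simp add: unit_cell_eq_box)
qed

lemma emeasure_half_open_cell [simp]: "emeasure lborel (half_open_cell :: (real^'m) set) = 1"
proof (rule antisym)
  have "emeasure lborel (half_open_cell :: (real^'m) set) \<le> emeasure lborel (cbox 0 (1 :: real^'m))"
    by (intro emeasure_mono cell_sandwich) auto
  also have "\<dots> = emeasure lborel (unit_cell :: (real^'m) set)"
    unfolding unit_cell_eq_box
    by (simp add: emeasure_lborel_box_eq emeasure_lborel_cbox_eq)
  finally show "emeasure lborel (half_open_cell :: (real^'m) set) \<le> 1" by simp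
  show "1 \<le> emeasure lborel (half_open_cell :: (real^'m) set)"
    using emeasure_mono[OF cell_sandwich(1), of lborel] by simp
qed

lemma AE_cell_iff: "AE y in lborel. y \<in> half_open_cell \<longleftrightarrow> y \<in> (unit_cell :: (real^'m) set)"
proof -
  have "emeasure lborel (half_open_cell - unit_cell :: (real^'m) set) = 0"
    by (subst emeasure_Diff) (auto simp: cell_sandwich)
  then have "half_open_cell - unit_cell \<in> null_sets (lborel :: (real^'m) measure)"
    by (intro null_setsI) auto
  then have "AE y in lborel. y \<notin> half_open_cell - (unit_cell :: (real^'m) set)"
    by (rule AE_not_in)
  then show ?thesis by eventually_elim (use cell_sandwich in auto)
qed

lemma finite_int_vec_bounded:
  assumes "bounded S" shows "finite {k :: int^'m. int_vec k \<in> S}"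
proof -
  obtain b where b: "\<And>x. x \<in> S \<Longrightarrow> norm x \<le> b" using assms by (auto simp: bounded_iff)
  have "{k :: int^'m. int_vec k \<in> S} \<subseteq> {k. \<forall>i. k $ i \<in> {- \<lceil>b\<rceil>..\<lceil>b\<rceil>}}"
  proof safe
    fix k :: "int^'m" and i assume "int_vec k \<in> S"
    then have "\<bar>int_vec k $ i\<bar> \<le> b" using b component_le_norm_cart order_trans by blast
    then show "k $ i \<in> {- \<lceil>b\<rceil>..\<lceil>b\<rceil>}" by simp linarith
  qed
  moreover have "finite {k :: int^'m. \<forall>i. k $ i \<in> {- \<lceil>b\<rceil>..\<lceil>b\<rceil>}}"
  proof (rule finite_subset)
    show "{k :: int^'m. \<forall>i. k $ i \<in> {- \<lceil>b\<rceil>..\<lceil>b\<rceil>}} \<subseteq> vec_lambda ` (UNIV \<rightarrow>\<^sub>E {- \<lceil>b\<rceil>..\<lceil>b\<rceil>})"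
      by (auto simp: image_iff vec_eq_iff intro!: bexI[of _ "vec_nth _"])
    show "finite (vec_lambda ` ((UNIV :: 'm set) \<rightarrow>\<^sub>E {- \<lceil>b\<rceil>..\<lceil>b\<rceil>}))"
      by (intro finite_imageI finite_PiE) auto
  qed
  ultimately show ?thesis by (rule finite_subset)
qed

text \<open>
  Sums over the lattice are always restricted to the finitely many translates that carry one
  bounded set into another.
\<close>
lemma finite_int_shifts:
  assumes "bounded B" "bounded C"
  shows "finite {k :: int^'m. \<exists>y\<in>C. y + int_vec k \<in> B}"
proof (rule finite_subset)
  show "{k :: int^'m. \<exists>y\<in>C. y + int_vec k \<in> B} \<subseteq> {k. int_vec k \<in> (\<lambda>(x, y). x - y) ` (B \<times> C)}"
    by force
  show "finite {k :: int^'m. int_vec k \<in> (\<lambda>(x, y). x - y) ` (B \<times> C)}"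
    by (intro finite_int_vec_bounded bounded_minus_comp[unfolded split_def] bounded_minus_comp
        assms bounded_subset[OF bounded_minus[OF assms]]) auto
qed

lemma sum_cell_translates:
  fixes g :: "real^'m \<Rightarrow> 'b::real_vector"
  assumes "finite K" "\<And>y. g y \<noteq> 0 \<Longrightarrow> int_part y \<in> K"
  shows "(\<Sum>k\<in>K. indicator half_open_cell (y - int_vec k) *\<^sub>R g y) = g y"
proof (cases "int_part y \<in> K")
  case True
  have "(\<Sum>k\<in>K. indicator half_open_cell (y - int_vec k) *\<^sub>R g y)
      = (\<Sum>k\<in>K. if k = int_part y then g y else 0)"
    by (rule sum.cong) (auto simp: indicator_def diff_int_vec_in_cell_iff)
  then show ?thesis using True assms(1) by simp
next
  case False
  then have "g y = 0" using assms(2) by blast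
  then show ?thesis by simp
qed

text \<open>
  The support of \<open>f\<close> is cut along the lattice, and each piece is translated back into the cell; this
  does not affect \<open>v\<close>, which is periodic. Taking for \<open>f\<close> the indicator of a compact set gives
  the local integrability of \<open>v\<close>.
\<close>
lemma unfold_periodic:
  fixes v :: "real^'m \<Rightarrow> 'b::euclidean_space" and f :: "real^'m \<Rightarrow> real"
  assumes per: "periodic v" and [measurable]: "v \<in> borel_measurable borel" "f \<in> borel_measurable borel"
    and vint: "integrable lborel (\<lambda>y. indicator half_open_cell y *\<^sub>R v y)"
    and fb: "\<And>y. \<bar>f y\<bar> \<le> b" and B: "bounded B" "\<And>y. f y \<noteq> 0 \<Longrightarrow> y \<in> B"
    and K: "finite K" "\<And>y k. y \<in> half_open_cell \<Longrightarrow> y + int_vec k \<in> B \<Longrightarrow> k \<in> K"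
  shows "integrable lborel (\<lambda>y. f y *\<^sub>R v y)"
    and "(LINT y|lborel. f y *\<^sub>R v y)
         = (LINT y|lborel. indicator half_open_cell y *\<^sub>R ((\<Sum>k\<in>K. f (y + int_vec k)) *\<^sub>R v y))"
proof -
  have K': "int_part y \<in> K" if "f y \<noteq> 0" for y
    using K(2)[OF frac_part_in_cell[of y], of "int_part y"] B(2)[OF that] by (simp add: frac_part_def)
  have split: "f y *\<^sub>R v y = (\<Sum>k\<in>K. indicator half_open_cell (y - int_vec k) *\<^sub>R (f y *\<^sub>R v y))" for y
    by (rule sum_cell_translates[symmetric]) (use K(1) K' in auto)
  define h where "h k y = indicator half_open_cell y *\<^sub>R (f (y + int_vec k) *\<^sub>R v y)" for k y
  have hm[measurable]: "h k \<in> borel_measurable borel" for k unfolding h_def by measurable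
  have hint: "integrable lborel (h k)" for k
  proof (rule Bochner_Integration.integrable_bound[OF integrable_mult_right[OF integrable_norm[OF vint], of b]])
    show "AE y in lborel. norm (h k y) \<le> norm (b * norm (indicator half_open_cell y *\<^sub>R v y))"
    proof (rule AE_I2)
      fix y
      have "norm (h k y) = \<bar>f (y + int_vec k)\<bar> * norm (indicator half_open_cell y *\<^sub>R v y)"
        by (simp add: h_def abs_mult mult_ac)
      also have "\<dots> \<le> b * norm (indicator half_open_cell y *\<^sub>R v y)"
        by (intro mult_right_mono fb) auto
      finally show "norm (h k y) \<le> norm (b * norm (indicator half_open_cell y *\<^sub>R v y))" by simp
    qed
  qed simp
  have hs: "indicator half_open_cell (y - int_vec k) *\<^sub>R (f y *\<^sub>R v y) = h k (y + int_vec (- k))" for k y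
    by (simp add: h_def int_vec_uminus periodic_minus[OF per])
  have int: "integrable lborel (\<lambda>y. h k (y + int_vec (- k)))" for k
    by (subst lborel_shift(1)) (auto intro: hint)
  show "integrable lborel (\<lambda>y. f y *\<^sub>R v y)"
    by (subst split, subst hs) (intro Bochner_Integration.integrable_sum int)
  have "(LINT y|lborel. f y *\<^sub>R v y) = (LINT y|lborel. (\<Sum>k\<in>K. h k (y + int_vec (- k))))"
    by (subst split, subst hs) simp
  also have "\<dots> = (\<Sum>k\<in>K. LINT y|lborel. h k (y + int_vec (- k)))"
    by (intro Bochner_Integration.integral_sum int)
  also have "\<dots> = (\<Sum>k\<in>K. LINT y|lborel. h k y)"
    by (intro sum.cong refl lborel_shift(2)) simp
  also have "\<dots> = (LINT y|lborel. (\<Sum>k\<in>K. h k y))"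
    by (intro Bochner_Integration.integral_sum[symmetric] hint)
  also have "(\<lambda>y. \<Sum>k\<in>K. h k y)
      = (\<lambda>y. indicator half_open_cell y *\<^sub>R ((\<Sum>k\<in>K. f (y + int_vec k)) *\<^sub>R v y))"
    by (simp add: h_def fun_eq_iff scaleR_sum_left scaleR_sum_right)
  finally show "(LINT y|lborel. f y *\<^sub>R v y)
         = (LINT y|lborel. indicator half_open_cell y *\<^sub>R ((\<Sum>k\<in>K. f (y + int_vec k)) *\<^sub>R v y))" .
qed

text \<open>
  The shifted cell is another fundamental domain: unfolding its indicator over the original cell
  counts each point exactly once.
\<close>
lemma cell_integral_shift:
  fixes p :: "real^'m \<Rightarrow> real"
  assumes per: "periodic p" and [measurable]: "p \<in> borel_measurable borel" and b: "\<And>y. \<bar>p y\<bar> \<le> b"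
  shows "(LINT y|lborel. indicator half_open_cell y * p (y + h)) = (LINT y|lborel. indicator half_open_cell y * p y)"
proof -
  define f where "f y = (indicator half_open_cell (y - h) :: real)" for y
  define B where "B = (+) h ` (half_open_cell :: (real^'m) set)"
  have Bb: "bounded B" unfolding B_def by (intro bounded_translation bounded_half_open_cell)
  have [measurable]: "f \<in> borel_measurable borel" unfolding f_def by measurable
  have fB: "f y \<noteq> 0 \<Longrightarrow> y \<in> B" for y
    by (auto simp: f_def B_def indicator_def image_iff intro!: bexI[of _ "y - h"] split: if_splits)
  define K where "K = {k :: int^'m. \<exists>y\<in>half_open_cell. y + int_vec k \<in> B}"
  have K: "finite K" unfolding K_def by (intro finite_int_shifts Bb bounded_half_open_cell)
  have vint: "integrable lborel (\<lambda>y. indicator half_open_cell y *\<^sub>R p y)"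
  proof (rule Bochner_Integration.integrable_bound[of lborel "\<lambda>y. b * indicator half_open_cell y"])
    show "AE y in lborel. norm (indicator half_open_cell y *\<^sub>R p y) \<le> norm (b * indicator half_open_cell y :: real)"
      using b by (intro AE_I2) (auto simp: indicator_def intro: order_trans[OF _ abs_ge_self])
  qed auto
  have one: "(\<Sum>k\<in>K. f (y + int_vec k)) = 1" if y: "y \<in> half_open_cell" for y
  proof -
    have fi: "f (y + int_vec k) = (if k = - int_part (y - h) then 1 else 0)" for k
      using diff_int_vec_in_cell_iff[of "y - h" "- k"]
        neg_equal_iff_equal[of k "- int_part (y - h)"]
      by (auto simp: f_def indicator_def int_vec_uminus algebra_simps simp del: neg_equal_iff_equal)
    have "- int_part (y - h) \<in> K"
      unfolding K_def using fB[of "y + int_vec (- int_part (y - h))"] fi y by auto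
    then show ?thesis using K by (simp add: fi)
  qed
  have "(LINT y|lborel. indicator half_open_cell y * p (y + h)) = (LINT y|lborel. f (y + h) * p (y + h))"
    by (simp add: f_def)
  also have "\<dots> = (LINT y|lborel. f y * p y)"
    by (rule lborel_shift(2)[of "\<lambda>y. f y * p y"]) simp
  also have "\<dots> = (LINT y|lborel. indicator half_open_cell y *\<^sub>R ((\<Sum>k\<in>K. f (y + int_vec k)) *\<^sub>R p y))"
    using unfold_periodic(2)[OF per _ _ vint, of f 1 B K] fB Bb K
    by (force simp: f_def indicator_def K_def)
  also have "\<dots> = (LINT y|lborel. indicator half_open_cell y * p y)"
    by (rule Bochner_Integration.integral_cong) (auto simp: indicator_def one)
  finally show ?thesis .
qed

lemma periodic_cos:
  fixes k :: "int^'m"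
  shows "periodic (\<lambda>y. cos (2 * pi * (int_vec k \<bullet> y) + \<theta>))"
  unfolding periodic_def
proof safe
  fix j :: "int^'m" and y
  have "int_vec k \<bullet> int_vec j = (\<Sum>i\<in>UNIV. of_int (k $ i * j $ i) :: real)"
    by (simp add: inner_vec_def)
  then have "int_vec k \<bullet> int_vec j = of_int (\<Sum>i\<in>UNIV. k $ i * j $ i)" by simp
  then obtain z :: int where z: "int_vec k \<bullet> int_vec j = of_int z" by blast
  have "2 * pi * (int_vec k \<bullet> (y + int_vec j)) + \<theta> = (2 * pi * (int_vec k \<bullet> y) + \<theta>) + 2 * pi * of_int z"
    by (simp add: inner_add_right z algebra_simps)
  then show "cos (2 * pi * (int_vec k \<bullet> (y + int_vec j)) + \<theta>) = cos (2 * pi * (int_vec k \<bullet> y) + \<theta>)"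
    by (simp only: cos_add[of _ "2 * pi * of_int z"]) simp
qed

lemma cell_integral_cos:
  fixes k :: "int^'m"
  assumes "k \<noteq> 0"
  shows "(LINT y|lborel. indicator half_open_cell y * cos (2 * pi * (int_vec k \<bullet> y) + \<theta>)) = 0"
proof -
  obtain i where i: "k $ i \<noteq> 0" using assms by (auto simp: vec_eq_iff)
  \<comment> \<open>A shift with \<open>k \<bullet> h = 1 / 2\<close> reverses the sign of the cosine.\<close>
  define h :: "real^'m" where "h = axis i (1 / (2 * of_int (k $ i)))"
  have "int_vec k \<bullet> h = 1 / 2" using i by (simp add: h_def inner_axis)
  then have "cos (2 * pi * (int_vec k \<bullet> (y + h)) + \<theta>) = - cos (2 * pi * (int_vec k \<bullet> y) + \<theta>)" for y
  proof -
    have "2 * pi * (int_vec k \<bullet> (y + h)) + \<theta> = (2 * pi * (int_vec k \<bullet> y) + \<theta>) + pi"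
      using \<open>int_vec k \<bullet> h = 1 / 2\<close> by (simp add: inner_add_right algebra_simps)
    then show ?thesis by (simp only: cos_periodic_pi)
  qed
  then show ?thesis
    using cell_integral_shift[OF periodic_cos[of k \<theta>], of 1 h] by simp
qed

section \<open>Periodization\<close>

text \<open>
  The sum of all lattice translates. Only the nonzero terms are summed, which makes it finite at
  each point when \<open>f\<close> has bounded support.
\<close>
definition periodize :: "(real^'m \<Rightarrow> real) \<Rightarrow> real^'m \<Rightarrow> real" where
  "periodize f y = (\<Sum>k | f (y + int_vec k) \<noteq> 0. f (y + int_vec k))"

lemma periodize_eq_sum:
  assumes "finite K" "\<And>k. f (y + int_vec k) \<noteq> 0 \<Longrightarrow> k \<in> K"
  shows "periodize f y = (\<Sum>k\<in>K. f (y + int_vec k))"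
  unfolding periodize_def by (rule sum.mono_neutral_left) (use assms in auto)

lemma periodize_periodic: "periodic (periodize f)"
  unfolding periodic_def
proof safe
  fix j :: "int^'a" and y
  have "bij_betw (\<lambda>k. k + j) {k. f (y + int_vec j + int_vec k) \<noteq> 0} {k. f (y + int_vec k) \<noteq> 0}"
    by (rule bij_betwI[of _ _ _ "\<lambda>k. k - j"]) (auto simp: int_vec_add int_vec_diff algebra_simps)
  then show "periodize f (y + int_vec j) = periodize f y"
    unfolding periodize_def
    by (subst sum.reindex_bij_betw[symmetric]) (auto simp: int_vec_add algebra_simps)
qed

lemma continuous_periodize:
  fixes f :: "real^'m \<Rightarrow> real"
  assumes f: "continuous_on UNIV f" and B: "bounded B" "\<And>y. f y \<noteq> 0 \<Longrightarrow> y \<in> B"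
  shows "continuous_on UNIV (periodize f)"
proof (rule continuous_at_imp_continuous_on, rule ballI)
  fix y :: "real^'m"
  define K where "K = {k :: int^'m. \<exists>z\<in>ball y 1. z + int_vec k \<in> B}"
  have K: "finite K" unfolding K_def by (intro finite_int_shifts B bounded_ball)
  have "continuous_on (ball y 1) (\<lambda>z. \<Sum>k\<in>K. f (z + int_vec k))"
    by (intro continuous_intros continuous_on_compose2[OF f]) auto
  moreover have "periodize f z = (\<Sum>k\<in>K. f (z + int_vec k))" if "z \<in> ball y 1" for z
    by (rule periodize_eq_sum[OF K]) (use B(2) that in \<open>unfold K_def, blast\<close>)
  ultimately have "continuous_on (ball y 1) (periodize f)"
    by (subst continuous_on_cong) auto
  then show "isCont (periodize f) y"
    by (simp add: continuous_on_eq_continuous_at)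
qed

lemma integral_periodize:
  fixes v :: "real^'m \<Rightarrow> real"
  assumes per: "periodic v" and [measurable]: "v \<in> borel_measurable borel"
    and vint: "integrable lborel (\<lambda>y. indicator half_open_cell y * v y)"
    and f: "continuous_on UNIV f" and B: "bounded B" "\<And>y. f y \<noteq> 0 \<Longrightarrow> y \<in> B"
  shows "integrable lborel (\<lambda>y. v y * f y)"
    and "(LINT y|lborel. v y * f y) = (LINT y|lborel. indicator half_open_cell y * (v y * periodize f y))"
proof -
  have [measurable]: "f \<in> borel_measurable borel" by (rule borel_measurable_continuous_onI[OF f])
  have "compact (f ` closure B)"
    by (intro compact_continuous_image continuous_on_subset[OF f]) (auto simp: compact_closure B)
  then obtain b where b: "\<And>y. y \<in> closure B \<Longrightarrow> \<bar>f y\<bar> \<le> b"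
    using compact_imp_bounded bounded_iff by (metis imageI real_norm_def)
  have "\<bar>f y\<bar> \<le> \<bar>b\<bar>" for y
    using b[of y] B(2)[of y] closure_subset[of B] by (cases "f y = 0") (auto intro: order_trans)
  note fb = this
  define K where "K = {k :: int^'m. \<exists>y\<in>half_open_cell. y + int_vec k \<in> B}"
  have K: "finite K" unfolding K_def by (intro finite_int_shifts B bounded_half_open_cell)
  note U = unfold_periodic[OF per _ _ _ fb B K]
  show "integrable lborel (\<lambda>y. v y * f y)"
    using U(1) vint by (force simp: K_def mult.commute)
  have "(LINT y|lborel. v y * f y)
      = (LINT y|lborel. indicator half_open_cell y *\<^sub>R ((\<Sum>k\<in>K. f (y + int_vec k)) *\<^sub>R v y))"
    using U(2) vint by (force simp: K_def mult.commute)
  also have "\<dots> = (LINT y|lborel. indicator half_open_cell y * (v y * periodize f y))"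
  proof (rule Bochner_Integration.integral_cong[OF refl])
    fix y :: "real^'m"
    show "indicator half_open_cell y *\<^sub>R ((\<Sum>k\<in>K. f (y + int_vec k)) *\<^sub>R v y)
        = indicator half_open_cell y * (v y * periodize f y)"
    proof (cases "y \<in> half_open_cell")
      case True
      then have "periodize f y = (\<Sum>k\<in>K. f (y + int_vec k))"
        by (intro periodize_eq_sum) (use K B(2) in \<open>auto simp: K_def\<close>)
      then show ?thesis by simp
    qed simp
  qed
  finally show "(LINT y|lborel. v y * f y) = (LINT y|lborel. indicator half_open_cell y * (v y * periodize f y))" .
qed

section \<open>Trigonometric polynomials\<close>

text \<open>
  Real trigonometric polynomials, as lists of amplitudes, frequencies and phases. The list form makes
  those with rational amplitudes and phases a countable family, and the phases absorb the sines.
\<close>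
definition trig_poly :: "(real \<times> (int^'m) \<times> real) list \<Rightarrow> real^'m \<Rightarrow> real" where
  "trig_poly l y = (\<Sum>(a, k, \<theta>)\<leftarrow>l. a * cos (2 * pi * (int_vec k \<bullet> y) + \<theta>))"

lemma trig_poly_Nil [simp]: "trig_poly [] y = 0"
  and trig_poly_Cons [simp]: "trig_poly ((a, k, \<theta>) # l) y = a * cos (2 * pi * (int_vec k \<bullet> y) + \<theta>) + trig_poly l y"
  and trig_poly_append [simp]: "trig_poly (l @ l') y = trig_poly l y + trig_poly l' y"
  by (simp_all add: trig_poly_def)

lemma periodic_trig_poly: "periodic (trig_poly l)"
proof (induction l)
  case Nil then show ?case by (simp add: periodic_def)
next
  case (Cons t l)
  obtain a k \<theta> where t: "t = (a, k, \<theta>)" by (cases t)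
  show ?case using Cons periodic_cos[of k \<theta>] by (simp add: periodic_def t)
qed

lemma continuous_trig_poly: "continuous_on S (trig_poly l)"
proof (induction l)
  case Nil then show ?case by simp
next
  case (Cons t l)
  obtain a k \<theta> where t: "t = (a, k, \<theta>)" by (cases t)
  show ?case using Cons by (auto simp: t intro!: continuous_intros)
qed

lemma trig_poly_scale: "trig_poly (map (\<lambda>(a, k, \<theta>). (c * a, k, \<theta>)) l) y = c * trig_poly l y"
  by (induction l) (auto simp: algebra_simps)

text \<open>
  Products are again trigonometric polynomials because a product of two cosines is half the sum of
  the cosines of sum and difference.
\<close>
lemma trig_poly_mult_cos:
  "\<exists>l'. \<forall>y. trig_poly l' y = trig_poly l y * cos (2 * pi * (int_vec j \<bullet> y) + \<omega>)"
proof (induction l)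
  case Nil then show ?case by (intro exI[of _ "[]"]) simp
next
  case (Cons t l)
  obtain a k \<theta> where t: "t = (a, k, \<theta>)" by (cases t)
  obtain l' where l': "\<And>y. trig_poly l' y = trig_poly l y * cos (2 * pi * (int_vec j \<bullet> y) + \<omega>)"
    using Cons by blast
  have "a / 2 * cos (2 * pi * (int_vec (k - j) \<bullet> y) + (\<theta> - \<omega>))
      + a / 2 * cos (2 * pi * (int_vec (k + j) \<bullet> y) + (\<theta> + \<omega>))
      = a * cos (2 * pi * (int_vec k \<bullet> y) + \<theta>) * cos (2 * pi * (int_vec j \<bullet> y) + \<omega>)" for y
  proof -
    have "2 * pi * (int_vec (k - j) \<bullet> y) + (\<theta> - \<omega>) = (2 * pi * (int_vec k \<bullet> y) + \<theta>) - (2 * pi * (int_vec j \<bullet> y) + \<omega>)"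
      and "2 * pi * (int_vec (k + j) \<bullet> y) + (\<theta> + \<omega>) = (2 * pi * (int_vec k \<bullet> y) + \<theta>) + (2 * pi * (int_vec j \<bullet> y) + \<omega>)"
      by (simp_all add: int_vec_add int_vec_diff inner_add_left inner_diff_left algebra_simps)
    then show ?thesis by (simp only: cos_add cos_diff) (simp add: algebra_simps)
  qed
  then have "trig_poly ((a/2, k - j, \<theta> - \<omega>) # (a/2, k + j, \<theta> + \<omega>) # l') y
      = trig_poly (t # l) y * cos (2 * pi * (int_vec j \<bullet> y) + \<omega>)" for y
    by (simp add: t l' distrib_right add.assoc[symmetric])
  then show ?case by blast
qed

lemma trig_poly_mult: "\<exists>l''. \<forall>y. trig_poly l'' y = trig_poly l y * trig_poly l' y"
proof (induction l')
  case Nil then show ?case by (intro exI[of _ "[]"]) simp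
next
  case (Cons t l')
  obtain a k \<theta> where t: "t = (a, k, \<theta>)" by (cases t)
  obtain l1 where l1: "\<And>y. trig_poly l1 y = trig_poly l y * trig_poly l' y"
    using Cons by blast
  obtain l2 where l2: "\<And>y. trig_poly l2 y = trig_poly l y * cos (2 * pi * (int_vec k \<bullet> y) + \<theta>)"
    using trig_poly_mult_cos[of l k \<theta>] by blast
  have "trig_poly (map (\<lambda>(b, k, \<theta>). (a * b, k, \<theta>)) l2 @ l1) y = trig_poly l y * trig_poly (t # l') y" for y
    unfolding t trig_poly_append trig_poly_scale trig_poly_Cons l1 l2 by (simp only: algebra_simps)
  then show ?case by blast
qed

lemma trig_poly_sum:
  assumes "finite I" "\<And>i. i \<in> I \<Longrightarrow> \<exists>l. \<forall>y. trig_poly l y = f i y"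
  shows "\<exists>l. \<forall>y. trig_poly l y = (\<Sum>i\<in>I. f i y)"
  using assms
proof (induction I rule: finite_induct)
  case empty then show ?case by (intro exI[of _ "[]"]) simp
next
  case (insert i I)
  obtain l where "\<And>y. trig_poly l y = (\<Sum>i\<in>I. f i y)" using insert by blast
  moreover obtain l' where "\<And>y. trig_poly l' y = f i y" using insert by blast
  ultimately have "trig_poly (l' @ l) y = (\<Sum>i\<in>insert i I. f i y)" for y using insert by simp
  then show ?case by blast
qed

definition torus_map :: "real^'m \<Rightarrow> complex^'m" where
  "torus_map y = (\<chi> i. cis (2 * pi * y $ i))"

lemma torus_map_eq_iff: "torus_map y = torus_map z \<longleftrightarrow> (\<exists>k. y = z + int_vec k)"
proof
  assume eq: "torus_map y = torus_map z"
  have "\<exists>n::int. y $ i = z $ i + of_int n" for i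
  proof -
    have "cis (2 * pi * y $ i) = cis (2 * pi * z $ i)"
      using eq by (simp add: torus_map_def vec_eq_iff)
    then have "sin (2 * pi * y $ i) = sin (2 * pi * z $ i) \<and> cos (2 * pi * y $ i) = cos (2 * pi * z $ i)"
      by (simp add: complex_eq_iff)
    then obtain n :: int where "2 * pi * y $ i = 2 * pi * z $ i + 2 * pi * of_int n"
      using sin_cos_eq_iff by (metis mult.commute mult.left_commute)
    then have "2 * pi * (y $ i) = 2 * pi * (z $ i + of_int n)" by (simp add: algebra_simps)
    then show ?thesis by (auto simp del: mult_cancel_left simp: mult_left_cancel)
  qed
  then obtain n where "\<And>i. y $ i = z $ i + of_int (n i)" by metis
  then have "y = z + int_vec (\<chi> i. n i)" by (simp add: vec_eq_iff)
  then show "\<exists>k. y = z + int_vec k" by blast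
next
  assume "\<exists>k. y = z + int_vec k"
  then obtain k where k: "y = z + int_vec k" by blast
  have "cis (2 * pi * z $ i + 2 * pi * of_int (k $ i)) = cis (2 * pi * z $ i)" for i
    by (simp add: cis_mult[symmetric] cis_multiple_2pi)
  then show "torus_map y = torus_map z"
    by (simp add: k torus_map_def vec_eq_iff distrib_left)
qed

lemma real_polynomial_torus:
  assumes "real_polynomial_function g"
  shows "\<exists>l. \<forall>y. trig_poly l y = g (torus_map (y :: real^'m))"
  using assms
proof (induction g)
  case (linear f)
  interpret f: bounded_linear f by fact
  have "f (torus_map y) = (\<Sum>i\<in>UNIV. f (axis i 1) * cos (2 * pi * (int_vec (axis i 1) \<bullet> y) + 0)
        + f (axis i \<i>) * cos (2 * pi * (int_vec (axis i 1) \<bullet> y) + (- (pi / 2))))" for y :: "real^'m"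
  proof -
    have ia: "int_vec (axis i 1) \<bullet> y = y $ i" for i
    proof -
      have "int_vec (axis i 1) = axis i (1::real)" by (simp add: vec_eq_iff axis_def)
      then show ?thesis by (simp add: inner_axis')
    qed
    have "torus_map y = (\<Sum>i\<in>UNIV. cos (2 * pi * y $ i) *\<^sub>R axis i 1 + sin (2 * pi * y $ i) *\<^sub>R axis i \<i>)"
      by (simp add: torus_map_def vec_eq_iff axis_def cis_conv_exp[symmetric] if_distrib[of "\<lambda>x. _ *\<^sub>R x"]
          sum.distrib complex_eq_iff cong: if_cong)
    then have "f (torus_map y) = (\<Sum>i\<in>UNIV. cos (2 * pi * y $ i) * f (axis i 1) + sin (2 * pi * y $ i) * f (axis i \<i>))"
      by (simp add: f.sum f.add f.scaleR)
    then show ?thesis by (simp add: ia cos_diff mult.commute)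
  qed
  moreover have "\<exists>l. \<forall>y. trig_poly l y = (\<Sum>i\<in>UNIV. f (axis i 1) * cos (2 * pi * (int_vec (axis i 1) \<bullet> y) + 0)
        + f (axis i \<i>) * cos (2 * pi * (int_vec (axis i 1) \<bullet> y) + (- (pi / 2))))"
  proof (rule trig_poly_sum)
    fix i
    show "\<exists>l. \<forall>y. trig_poly l y = f (axis i 1) * cos (2 * pi * (int_vec (axis i 1) \<bullet> y) + 0)
        + f (axis i \<i>) * cos (2 * pi * (int_vec (axis i 1) \<bullet> y) + (- (pi / 2)))"
      by (rule exI[of _ "[(f (axis i 1), axis i 1, 0), (f (axis i \<i>), axis i 1, - (pi / 2))]"]) simp
  qed simp
  ultimately show ?case by simp
next
  case (const c)
  show ?case by (rule exI[of _ "[(c, 0, 0)]"]) simp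
next
  case (add f g)
  then obtain l l' where "\<And>y. trig_poly l y = f (torus_map y)" "\<And>y. trig_poly l' y = g (torus_map y)" by blast
  then have "trig_poly (l @ l') y = f (torus_map y) + g (torus_map y)" for y by simp
  then show ?case by blast
next
  case (mult f g)
  then obtain l l' where "\<And>y. trig_poly l y = f (torus_map y)" "\<And>y. trig_poly l' y = g (torus_map y)" by blast
  then show ?case using trig_poly_mult[of l l'] by simp
qed

text \<open>
  Weierstrass approximation on the torus: \<^const>\<open>torus_map\<close> realises it as a compact set on
  which real polynomials pull back to trigonometric polynomials. A periodic function descends to a
  continuous function there, because the restriction of \<^const>\<open>torus_map\<close> to a closed cube is a
  closed map.
\<close>
lemma trig_poly_dense:
  fixes p :: "real^'m \<Rightarrow> real"
  assumes per: "periodic p" and cont: "continuous_on UNIV p" and "e > 0"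
  obtains l where "\<And>y. \<bar>p y - trig_poly l y\<bar> < e"
proof -
  let ?Q = "cbox 0 1 :: (real^'m) set"
  define S where "S = range (torus_map :: real^'m \<Rightarrow> complex^'m)"
  have tc: "continuous_on X (torus_map :: real^'m \<Rightarrow> complex^'m)" for X
    unfolding torus_map_def by (intro continuous_intros)
  have rep: "\<exists>z\<in>?Q. torus_map z = torus_map y" for y :: "real^'m"
  proof (intro bexI)
    show "frac_part y \<in> ?Q" using frac_part_in_cell cell_sandwich by blast
    show "torus_map (frac_part y) = torus_map y"
      by (subst torus_map_eq_iff) (auto simp: frac_part_def intro!: exI[of _ "- int_part y"] simp: int_vec_uminus)
  qed
  have SQ: "S = torus_map ` ?Q"
  proof
    show "S \<subseteq> torus_map ` ?Q" unfolding S_def using rep by (metis image_eqI image_subsetI)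
  qed (auto simp: S_def)
  have S: "compact S" unfolding SQ by (intro compact_continuous_image tc compact_cbox)
  define F where "F z = p (SOME y. torus_map y = z)" for z
  have F: "F (torus_map y) = p y" for y
  proof -
    have "torus_map (SOME y'. torus_map y' = torus_map y) = torus_map y" by (rule someI) simp
    then obtain k where "(SOME y'. torus_map y' = torus_map y) = y + int_vec k"
      by (auto simp: torus_map_eq_iff)
    then show ?thesis by (simp add: F_def periodicD[OF per])
  qed
  have "continuous_on S F"
  proof (subst continuous_on_closed_vimage[OF compact_imp_closed[OF S]], intro allI impI)
    fix C :: "real set" assume "closed C"
    have "F -` C \<inter> S = torus_map ` (?Q \<inter> p -` C)"
      unfolding SQ by (auto simp: F)
    moreover have "closed (p -` C)" by (rule closed_vimage[OF \<open>closed C\<close> cont])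
    ultimately show "closed (F -` C \<inter> S)"
      by (auto intro!: compact_imp_closed compact_continuous_image tc compact_Int_closed)
  qed
  then obtain g where g: "real_polynomial_function g" "\<And>z. z \<in> S \<Longrightarrow> \<bar>F z - g z\<bar> < e"
    using Stone_Weierstrass_real_polynomial_function[OF S _ \<open>e > 0\<close>] by blast
  obtain l where "\<And>y. trig_poly l y = g (torus_map y)" using real_polynomial_torus[OF g(1)] by blast
  then have "\<bar>p y - trig_poly l y\<bar> < e" for y
    using g(2)[of "torus_map y"] F[of y] by (simp add: S_def)
  then show thesis using that by blast
qed

lemma abs_diff_less_trans: "\<bar>a - b\<bar> < d \<Longrightarrow> \<bar>b - c\<bar> < e \<Longrightarrow> \<bar>a - c\<bar> < d + e"
  for a b c d e :: real
  by linarith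

lemma abs_add_less: "\<bar>a\<bar> < d \<Longrightarrow> \<bar>b\<bar> < e \<Longrightarrow> \<bar>a + b\<bar> < d + e"
  for a b d e :: real
  by linarith

lemma abs_cos_diff_le: "\<bar>cos x - cos y\<bar> \<le> \<bar>x - y :: real\<bar>"
proof -
  have "\<bar>cos x - cos y\<bar> = 2 * \<bar>sin ((x + y) / 2)\<bar> * \<bar>sin ((y - x) / 2)\<bar>"
    by (simp add: cos_diff_cos abs_mult)
  also have "\<dots> \<le> 2 * 1 * \<bar>(y - x) / 2\<bar>"
    by (intro mult_mono abs_sin_x_le_abs_x) auto
  finally show ?thesis by (simp add: abs_minus_commute)
qed

definition of_rat_terms :: "(rat \<times> (int^'m) \<times> rat) list \<Rightarrow> (real \<times> (int^'m) \<times> real) list" where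
  "of_rat_terms = map (\<lambda>(a, k, \<theta>). (of_rat a, k, of_rat \<theta>))"

lemma trig_poly_rational_approx:
  assumes "e > 0"
  shows "\<exists>l'. \<forall>y. \<bar>trig_poly l y - trig_poly (of_rat_terms l') y\<bar> < e"
  using assms
proof (induction l arbitrary: e)
  case Nil then show ?case by (intro exI[of _ "[]"]) (simp add: of_rat_terms_def)
next
  case (Cons t l)
  obtain a k \<theta> where t: "t = (a, k, \<theta>)" by (cases t)
  obtain l' where l': "\<And>y. \<bar>trig_poly l y - trig_poly (of_rat_terms l') y\<bar> < e / 2"
    using Cons.IH[of "e / 2"] Cons.prems by auto
  obtain a' :: rat where "a - e / 4 < of_rat a'" "of_rat a' < a + e / 4"
    using of_rat_dense[of "a - e / 4" "a + e / 4"] Cons.prems by auto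
  then have a': "\<bar>a - of_rat a'\<bar> < e / 4" by linarith
  define d where "d = e / (4 * (\<bar>a\<bar> + 1))"
  have d0: "d > 0" using Cons.prems by (simp add: d_def add_nonneg_pos)
  obtain \<theta>' :: rat where "\<theta> - d < of_rat \<theta>'" "of_rat \<theta>' < \<theta> + d"
    using of_rat_dense[of "\<theta> - d" "\<theta> + d"] d0 by auto
  then have \<theta>': "\<bar>\<theta> - of_rat \<theta>'\<bar> < d" by linarith
  have "\<bar>a\<bar> * \<bar>\<theta> - of_rat \<theta>'\<bar> \<le> (\<bar>a\<bar> + 1) * d" using \<theta>' by (intro mult_mono) auto
  also have "\<dots> = e / 4" by (simp add: d_def add_nonneg_pos field_simps)
  finally have \<theta>2: "\<bar>a\<bar> * \<bar>\<theta> - of_rat \<theta>'\<bar> \<le> e / 4" .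
  have "\<bar>trig_poly (t # l) y - trig_poly (of_rat_terms ((a', k, \<theta>') # l')) y\<bar> < e" for y
  proof -
    define s where "s = 2 * pi * (int_vec k \<bullet> y)"
    have "a * cos (s + \<theta>) - of_rat a' * cos (s + of_rat \<theta>')
        = a * (cos (s + \<theta>) - cos (s + of_rat \<theta>')) + (a - of_rat a') * cos (s + of_rat \<theta>')"
      by (simp add: algebra_simps)
    also have "\<bar>\<dots>\<bar> \<le> \<bar>a\<bar> * \<bar>cos (s + \<theta>) - cos (s + of_rat \<theta>')\<bar> + \<bar>a - of_rat a'\<bar> * \<bar>cos (s + of_rat \<theta>')\<bar>"
      unfolding abs_mult[symmetric] by (rule abs_triangle_ineq)
    also have "\<dots> \<le> \<bar>a\<bar> * \<bar>\<theta> - of_rat \<theta>'\<bar> + \<bar>a - of_rat a'\<bar> * 1"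
      using abs_cos_diff_le[of "s + \<theta>" "s + of_rat \<theta>'"] by (intro add_mono mult_left_mono) auto
    also have "\<dots> < e / 2" using \<theta>2 a' by simp
    finally have "\<bar>a * cos (s + \<theta>) - of_rat a' * cos (s + of_rat \<theta>')\<bar> < e / 2" .
    from abs_add_less[OF this l'[of y]] show ?thesis
      by (simp add: t of_rat_terms_def s_def add_diff_add)
  qed
  then show ?case by blast
qed

section \<open>Periodic continuous functions\<close>

lemma periodic_continuous_bcontfun:
  fixes p :: "real^'m \<Rightarrow> real"
  assumes per: "periodic p" and cont: "continuous_on UNIV p"
  shows "p \<in> bcontfun"
proof -
  have "compact (p ` cbox 0 1)"
    by (intro compact_continuous_image continuous_on_subset[OF cont]) auto
  then obtain b where "\<And>y. y \<in> cbox 0 1 \<Longrightarrow> norm (p y) \<le> b"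
    using compact_imp_bounded by (metis bounded_iff imageI)
  then have "norm (p y) \<le> b" for y
    using periodic_frac_part[OF per, of y] frac_part_in_cell[of y] cell_sandwich(2) by (metis subsetD)
  then show ?thesis using cont by (intro bcontfun_normI)
qed

definition trig_seq :: "nat \<Rightarrow> (real^'m) \<Rightarrow>\<^sub>C real" where
  "trig_seq j = Bcontfun (trig_poly (of_rat_terms (from_nat j)))"

lemma apply_trig_seq: "apply_bcontfun (trig_seq j) = trig_poly (of_rat_terms (from_nat j))"
  unfolding trig_seq_def
  by (rule Bcontfun_inverse) (intro periodic_continuous_bcontfun periodic_trig_poly continuous_trig_poly)

lemma periodic_trig_seq: "periodic (apply_bcontfun (trig_seq j))"
  by (simp add: apply_trig_seq periodic_trig_poly)

lemma trig_seq_dense: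
  fixes p :: "(real^'m) \<Rightarrow>\<^sub>C real"
  assumes "periodic (apply_bcontfun p)" "e > 0"
  obtains j where "norm (p - trig_seq j) < e"
proof -
  obtain l where l: "\<And>y. \<bar>apply_bcontfun p y - trig_poly l y\<bar> < e / 4"
    by (rule trig_poly_dense[OF assms(1), of "e / 4"]) (use assms in auto)
  obtain l' where l': "\<And>y. \<bar>trig_poly l y - trig_poly (of_rat_terms l') y\<bar> < e / 4"
    using trig_poly_rational_approx[of "e / 4" l] assms by auto
  have "norm (p - trig_seq (to_nat l')) \<le> e / 2"
  proof (rule norm_bound)
    fix y
    show "norm (apply_bcontfun (p - trig_seq (to_nat l')) y) \<le> e / 2"
      using abs_diff_less_trans[OF l[of y] l'[of y]] by (simp add: apply_trig_seq)
  qed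
  then show thesis using that[of "to_nat l'"] assms by simp
qed

section \<open>Equidistribution along a nonresonant plane\<close>

lemma integral_norm_le_integral:
  fixes f :: "'a \<Rightarrow> 'b::{banach, second_countable_topology}"
  assumes "integrable M f" "integrable M g" "\<And>x. norm (f x) \<le> g x"
  shows "norm (LINT x|M. f x) \<le> (LINT x|M. g x)"
  by (rule order_trans[OF integral_norm_bound Bochner_Integration.integral_mono])
    (use assms in auto)

lemma integrable_indicator_bounded:
  fixes g :: "'a::euclidean_space \<Rightarrow> real"
  assumes [measurable]: "A \<in> sets borel" and fin: "emeasure lborel A < \<infinity>"
    and [measurable]: "g \<in> borel_measurable borel" and b: "\<And>x. \<bar>g x\<bar> \<le> b"
  shows "integrable lborel (\<lambda>x. indicator A x * g x)"
    and "\<bar>LINT x|lborel. indicator A x * g x\<bar> \<le> b * measure lborel A"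
proof -
  have iA: "integrable lborel (\<lambda>x. b * indicator A x)"
    using fin by (intro integrable_mult_right integrable_real_indicator) auto
  have le: "norm (indicator A x * g x) \<le> b * indicator A x" for x
    using b[of x] by (auto simp: indicator_def)
  show int: "integrable lborel (\<lambda>x. indicator A x * g x)"
  proof (rule Bochner_Integration.integrable_bound[OF iA])
    show "AE x in lborel. norm (indicator A x * g x) \<le> norm (b * indicator A x :: real)"
      unfolding real_norm_def[of "b * _"] by (intro AE_I2 order_trans[OF le] abs_ge_self)
  qed simp
  have "norm (LINT x|lborel. indicator A x * g x) \<le> (LINT x|lborel. b * indicator A x)"
    by (rule integral_norm_le_integral[OF int iA le])
  then show "\<bar>LINT x|lborel. indicator A x * g x\<bar> \<le> b * measure lborel A"
    by (simp add: mult.commute)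
qed

text \<open>
  A translation by half a wavelength reverses the sign of the wave, so the integral is controlled by
  the measure of the difference between \<open>A\<close> and its translate. The translation tends to zero, and
  for open \<open>A\<close> the indicators of the translates converge on \<open>A\<close>.
\<close>
lemma Riemann_Lebesgue_open:
  fixes A :: "'a::euclidean_space set"
  assumes A: "open A" "emeasure lborel A < \<infinity>" and "\<xi> \<noteq> 0" and s: "filterlim s at_top sequentially"
  shows "(\<lambda>n. LINT x|lborel. indicator A x * cos (s n * (\<xi> \<bullet> x) + \<theta>)) \<longlonglongrightarrow> 0"
proof -
  have [measurable]: "A \<in> sets borel" using A by simp
  define c where "c n x = cos (s n * (\<xi> \<bullet> x) + \<theta>)" for n x
  have [measurable]: "c n \<in> borel_measurable borel" for n unfolding c_def by measurable
  \<comment> \<open>Half a wavelength in the direction of \<open>\<xi>\<close>.\<close>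
  define h where "h n = (pi / (s n * (\<xi> \<bullet> \<xi>))) *\<^sub>R \<xi>" for n
  have i1: "integrable lborel (indicator A :: 'a \<Rightarrow> real)"
    using A by (intro integrable_real_indicator) auto
  have i2: "integrable lborel (\<lambda>x. indicator A (x + h n) :: real)" for n
    by (subst lborel_shift(1)) (auto intro: i1)
  have i3: "integrable lborel (\<lambda>x. indicator A x * indicator A (x + h n) :: real)" for n
    by (rule integrable_indicator_bounded(1)[of _ _ 1]) (use A in auto)
  have flip: "c n (x + h n) = - c n x" if "s n > 0" for n x
  proof -
    have "s n * (\<xi> \<bullet> (x + h n)) + \<theta> = (s n * (\<xi> \<bullet> x) + \<theta>) + pi"
      using that \<open>\<xi> \<noteq> 0\<close> by (simp add: h_def inner_add_right field_simps)
    then show ?thesis unfolding c_def by (simp only: cos_periodic_pi)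
  qed
  have "h \<longlonglongrightarrow> 0"
  proof -
    have "(\<lambda>n. (pi / (\<xi> \<bullet> \<xi>)) * inverse (s n)) \<longlonglongrightarrow> (pi / (\<xi> \<bullet> \<xi>)) * 0"
      by (intro tendsto_intros tendsto_inverse_0_at_top s)
    then have "(\<lambda>n. ((pi / (\<xi> \<bullet> \<xi>)) * inverse (s n)) *\<^sub>R \<xi>) \<longlonglongrightarrow> 0 *\<^sub>R \<xi>"
      by (intro tendsto_intros) simp
    then show ?thesis by (simp add: h_def[abs_def] divide_simps mult.commute)
  qed
  have dct: "(\<lambda>n. LINT x|lborel. indicator A x * indicator A (x + h n) :: real) \<longlonglongrightarrow> (LINT x|lborel. indicator A x)"
  proof (rule integral_dominated_convergence[where w = "indicator A"])
    show "AE x in lborel. (\<lambda>n. indicator A x * indicator A (x + h n) :: real) \<longlonglongrightarrow> indicator A x"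
    proof (rule AE_I2)
      fix x
      show "(\<lambda>n. indicator A x * indicator A (x + h n) :: real) \<longlonglongrightarrow> indicator A x"
      proof (cases "x \<in> A")
        case True
        have "(\<lambda>n. x + h n) \<longlonglongrightarrow> x + 0" by (intro tendsto_intros \<open>h \<longlonglongrightarrow> 0\<close>)
        then have "eventually (\<lambda>n. x + h n \<in> A) sequentially"
          using topological_tendstoD[OF _ A(1)] True by simp
        then show ?thesis
          by (intro tendsto_eventually) (auto elim!: eventually_mono simp: True)
      qed simp
    qed
  qed (auto intro: i1 simp: indicator_def)
  have bound: "\<bar>LINT x|lborel. indicator A x * c n x\<bar>
      \<le> (LINT x|lborel. indicator A x) - (LINT x|lborel. indicator A x * indicator A (x + h n))"
    if "s n > 0" for n
  proof -
    let ?I = "LINT x|lborel. indicator A x * c n x"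
    have a: "integrable lborel (\<lambda>x. indicator A x * c n x)"
      by (rule integrable_indicator_bounded(1)[of _ _ 1]) (use A in \<open>auto simp: c_def\<close>)
    have b: "integrable lborel (\<lambda>x. indicator A (x + h n) * c n (x + h n))"
      by (subst lborel_shift(1)[of "\<lambda>x. indicator A x * c n x"]) (auto intro: a)
    then have b': "integrable lborel (\<lambda>x. indicator A (x + h n) * c n x)"
      using integrable_minus by (fastforce simp: flip[OF that])
    have "?I = (LINT x|lborel. indicator A (x + h n) * c n (x + h n))"
      by (rule lborel_shift(2)[symmetric, of "\<lambda>x. indicator A x * c n x"]) simp
    also have "\<dots> = - (LINT x|lborel. indicator A (x + h n) * c n x)"
      by (simp add: flip[OF that])
    finally have "2 * ?I = (LINT x|lborel. indicator A x * c n x - indicator A (x + h n) * c n x)"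
      using a b' by simp
    also have "\<bar>\<dots>\<bar> \<le> (LINT x|lborel. indicator A x + indicator A (x + h n) - 2 * (indicator A x * indicator A (x + h n)))"
      unfolding real_norm_def[symmetric]
    proof (rule integral_norm_le_integral)
      show "norm (indicator A x * c n x - indicator A (x + h n) * c n x)
          \<le> indicator A x + indicator A (x + h n) - 2 * (indicator A x * indicator A (x + h n))" for x
        by (auto simp: indicator_def c_def)
    qed (use a b' i1 i2 i3 in auto)
    also have "\<dots> = 2 * (LINT x|lborel. indicator A x) - 2 * (LINT x|lborel. indicator A x * indicator A (x + h n))"
      using i1 i2 i3 lborel_shift(2)[of "indicator A :: 'a \<Rightarrow> real" "h n"] by simp
    finally show ?thesis by simp
  qed
  have "(\<lambda>n. (LINT x|lborel. indicator A x) - (LINT x|lborel. indicator A x * indicator A (x + h n)))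
      \<longlonglongrightarrow> (LINT x|lborel. indicator A x) - (LINT x|lborel. indicator A x :: real)"
    by (intro tendsto_intros dct)
  then have "(\<lambda>n. (LINT x|lborel. indicator A x) - (LINT x|lborel. indicator A x * indicator A (x + h n) :: real)) \<longlonglongrightarrow> 0"
    by simp
  then have "(\<lambda>n. LINT x|lborel. indicator A x * c n x) \<longlonglongrightarrow> 0"
  proof (rule Lim_null_comparison[rotated])
    have "eventually (\<lambda>n. s n > 0) sequentially" using s by (simp add: filterlim_at_top_dense)
    then show "eventually (\<lambda>n. norm (LINT x|lborel. indicator A x * c n x)
        \<le> (LINT x|lborel. indicator A x) - (LINT x|lborel. indicator A x * indicator A (x + h n))) sequentially"
      by eventually_elim (use bound in simp)
  qed
  then show ?thesis by (simp add: c_def)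
qed

definition cell_mean :: "(real^'m \<Rightarrow> real) \<Rightarrow> real" where
  "cell_mean p = (LINT y|lborel. indicator half_open_cell y * p y)"

lemma cell_mean_trig_poly_Cons:
  "cell_mean (trig_poly ((a, k, \<theta>) # l)) = a * cell_mean (\<lambda>y. cos (2 * pi * (int_vec k \<bullet> y) + \<theta>)) + cell_mean (trig_poly l)"
proof -
  have i: "integrable lborel (\<lambda>y. indicator half_open_cell y * p y)"
    if "periodic p" "continuous_on UNIV p" for p :: "real^'a \<Rightarrow> real"
  proof -
    have "p \<in> bcontfun" by (rule periodic_continuous_bcontfun[OF that])
    then obtain b where "\<And>y. \<bar>p y\<bar> \<le> b" by (auto simp: bcontfun_def bounded_iff)
    then show ?thesis
      by (intro integrable_indicator_bounded(1)[of _ _ b]) (auto intro: borel_measurable_continuous_onI that)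
  qed
  have "cell_mean (trig_poly ((a, k, \<theta>) # l))
      = (LINT y|lborel. a * (indicator half_open_cell y * cos (2 * pi * (int_vec k \<bullet> y) + \<theta>)) + indicator half_open_cell y * trig_poly l y)"
    by (simp add: cell_mean_def distrib_left mult_ac)
  also have "\<dots> = a * cell_mean (\<lambda>y. cos (2 * pi * (int_vec k \<bullet> y) + \<theta>)) + cell_mean (trig_poly l)"
    unfolding cell_mean_def using i[OF periodic_trig_poly continuous_trig_poly, of l]
      i[OF periodic_cos[of k \<theta>] continuous_on_cos[OF continuous_on_add[OF
        continuous_on_mult[OF continuous_on_const continuous_on_inner[OF continuous_on_const continuous_on_id]]
        continuous_on_const]]]
    by (subst Bochner_Integration.integral_add) auto
  finally show ?thesis .
qed

text \<open>
  Nonresonance says that the frequency \<open>transpose R *v k\<close> of the restricted character vanishes only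
  for \<open>k = 0\<close>.
\<close>
lemma equidistribution_cos:
  fixes R :: "real^3^'m"
  assumes R: "nonresonant R" and \<eta>: "\<And>n. \<eta> n > 0" "\<eta> \<longlonglongrightarrow> 0"
    and A: "open A" "emeasure lborel A < \<infinity>"
  shows "(\<lambda>n. LINT x|lborel. indicator A x * cos (2 * pi * (int_vec k \<bullet> ((1 / \<eta> n) *\<^sub>R (R *v x))) + \<theta>))
    \<longlonglongrightarrow> measure lborel A * cell_mean (\<lambda>y. cos (2 * pi * (int_vec k \<bullet> y) + \<theta>))"
proof (cases "k = 0")
  case True
  have "measure lborel (half_open_cell :: (real^'m) set) = 1"
    by (simp add: measure_def)
  then show ?thesis using True by (simp add: cell_mean_def)
next
  case False
  define \<xi> where "\<xi> = (2 * pi) *\<^sub>R (transpose R *v int_vec k)"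
  have "\<xi> \<noteq> 0" using R False by (simp add: \<xi>_def nonresonant_def)
  moreover have "filterlim (\<lambda>n. 1 / \<eta> n) at_top sequentially"
    using \<eta> filterlim_inverse_at_top[of \<eta> sequentially] by (simp add: divide_inverse)
  moreover have eq: "2 * pi * (int_vec k \<bullet> ((1 / \<eta> n) *\<^sub>R (R *v x))) = (1 / \<eta> n) * (\<xi> \<bullet> x)" for n x
    by (simp add: \<xi>_def transpose_matrix_vector dot_lmul_matrix)
  ultimately show ?thesis
    unfolding eq
    using Riemann_Lebesgue_open[OF A, of \<xi> "\<lambda>n. 1 / \<eta> n" \<theta>] cell_integral_cos[OF False, of \<theta>]
    by (simp add: cell_mean_def)
qed

lemma equidistribution:
  fixes R :: "real^3^'m"
  assumes R: "nonresonant R" and \<eta>: "\<And>n. \<eta> n > 0" "\<eta> \<longlonglongrightarrow> 0"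
    and A: "open A" "emeasure lborel A < \<infinity>"
    and p: "periodic p" "continuous_on UNIV p"
  shows "(\<lambda>n. LINT x|lborel. indicator A x * p ((1 / \<eta> n) *\<^sub>R (R *v x)))
    \<longlonglongrightarrow> measure lborel A * cell_mean p"
proof -
  have [measurable]: "A \<in> sets borel" using A by simp
  define q where "q n x = (1 / \<eta> n) *\<^sub>R (R *v x)" for n and x :: "real^3"
  have qc: "continuous_on UNIV (q n)" for n
    unfolding q_def by (intro continuous_intros matrix_vector_mult_linear_continuous_on)
  have cm: "(\<lambda>x. f (q n x)) \<in> borel_measurable borel" if "continuous_on UNIV f" for f :: "real^'m \<Rightarrow> real" and n
    by (intro borel_measurable_continuous_onI continuous_on_compose2[OF that qc]) auto
  have bd: "\<exists>b. \<forall>y. \<bar>f y\<bar> \<le> b" if "periodic f" "continuous_on UNIV f" for f :: "real^'m \<Rightarrow> real"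
    using periodic_continuous_bcontfun[OF that] by (auto simp: bcontfun_def bounded_iff)
  have int: "integrable lborel (\<lambda>x. indicator A x * f (q n x))"
    if f: "periodic f" "continuous_on UNIV f" for f :: "real^'m \<Rightarrow> real" and n
    using bd[OF f] integrable_indicator_bounded(1)[OF _ A(2) cm[OF f(2)]] by auto
  have int2: "integrable lborel (\<lambda>y. indicator half_open_cell y * f y)"
    if f: "periodic f" "continuous_on UNIV f" for f :: "real^'m \<Rightarrow> real"
    using bd[OF f] integrable_indicator_bounded(1)[of half_open_cell f] borel_measurable_continuous_onI[OF f(2)] by auto
  have trig: "(\<lambda>n. LINT x|lborel. indicator A x * trig_poly l (q n x)) \<longlonglongrightarrow> measure lborel A * cell_mean (trig_poly l)"
    for l :: "(real \<times> (int^'m) \<times> real) list"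
  proof (induction l)
    case Nil then show ?case by (simp add: cell_mean_def)
  next
    case (Cons t l)
    obtain a k \<theta> where t: "t = (a, k, \<theta>)" by (cases t)
    have ic: "integrable lborel (\<lambda>x. indicator A x * cos (2 * pi * (int_vec k \<bullet> q n x) + \<theta>))" for n
      by (rule int[OF periodic_cos]) (intro continuous_intros)
    have "(\<lambda>n. a * (LINT x|lborel. indicator A x * cos (2 * pi * (int_vec k \<bullet> q n x) + \<theta>))
        + (LINT x|lborel. indicator A x * trig_poly l (q n x)))
        \<longlonglongrightarrow> a * (measure lborel A * cell_mean (\<lambda>y. cos (2 * pi * (int_vec k \<bullet> y) + \<theta>)))
        + measure lborel A * cell_mean (trig_poly l)"
      unfolding q_def by (intro tendsto_intros Cons[unfolded q_def] equidistribution_cos assms)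
    moreover have "(LINT x|lborel. indicator A x * trig_poly (t # l) (q n x))
        = a * (LINT x|lborel. indicator A x * cos (2 * pi * (int_vec k \<bullet> q n x) + \<theta>))
        + (LINT x|lborel. indicator A x * trig_poly l (q n x))" for n
    proof -
      have "(LINT x|lborel. indicator A x * trig_poly (t # l) (q n x))
        = (LINT x|lborel. a * (indicator A x * cos (2 * pi * (int_vec k \<bullet> q n x) + \<theta>)) + indicator A x * trig_poly l (q n x))"
        by (rule Bochner_Integration.integral_cong) (simp_all add: t algebra_simps)
      then show ?thesis
        using ic int[OF periodic_trig_poly continuous_trig_poly] by simp
    qed
    ultimately show ?case unfolding t cell_mean_trig_poly_Cons by (simp only: t algebra_simps)
  qed
  have "(\<lambda>n. LINT x|lborel. indicator A x * p (q n x)) \<longlonglongrightarrow> measure lborel A * cell_mean p"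
  proof (rule LIMSEQ_I)
    fix e :: real assume "e > 0"
    define d where "d = e / (3 * (measure lborel A + 1))"
    have d: "d > 0" using \<open>e > 0\<close> by (simp add: d_def add_nonneg_pos)
    have dA: "d * measure lborel A < e / 3"
    proof -
      have "d * measure lborel A < d * (measure lborel A + 1)" using d by simp
      also have "\<dots> = e / 3"
      proof -
        have "measure lborel A + 1 \<noteq> 0" using measure_nonneg[of lborel A] by linarith
        then show ?thesis by (simp add: d_def divide_simps)
      qed
      finally show ?thesis .
    qed
    obtain l where l: "\<And>y. \<bar>p y - trig_poly l y\<bar> < d" using trig_poly_dense[OF p d] by blast
    have 1: "\<bar>(LINT x|lborel. indicator A x * p (q n x)) - (LINT x|lborel. indicator A x * trig_poly l (q n x))\<bar> < e / 3" for n
    proof -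
      have "(LINT x|lborel. indicator A x * p (q n x)) - (LINT x|lborel. indicator A x * trig_poly l (q n x))
          = (LINT x|lborel. indicator A x * (p (q n x) - trig_poly l (q n x)))"
        using int[OF p] int[OF periodic_trig_poly continuous_trig_poly] by (simp add: right_diff_distrib)
      also have "\<bar>\<dots>\<bar> \<le> d * measure lborel A"
        by (rule integrable_indicator_bounded(2)) (use A l cm[OF p(2)] cm[OF continuous_trig_poly] in \<open>auto intro: less_imp_le\<close>)
      finally show ?thesis using dA by simp
    qed
    have 2: "\<bar>measure lborel A * cell_mean (trig_poly l) - measure lborel A * cell_mean p\<bar> < e / 3"
    proof -
      have "cell_mean (trig_poly l) - cell_mean p = (LINT y|lborel. indicator half_open_cell y * (trig_poly l y - p y))"
        unfolding cell_mean_def using int2[OF p] int2[OF periodic_trig_poly continuous_trig_poly] by (simp add: right_diff_distrib)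
      also have "\<bar>\<dots>\<bar> \<le> d * measure lborel (half_open_cell :: (real^'m) set)"
        by (rule integrable_indicator_bounded(2))
          (use l borel_measurable_continuous_onI[OF p(2)] borel_measurable_continuous_onI[OF continuous_trig_poly]
            in \<open>auto intro!: less_imp_le borel_measurable_diff simp: abs_minus_commute\<close>)
      also have "\<dots> = d" by (simp add: measure_def)
      finally have "measure lborel A * \<bar>cell_mean (trig_poly l) - cell_mean p\<bar> \<le> measure lborel A * d"
        by (intro mult_left_mono) auto
      moreover have "\<bar>measure lborel A * a - measure lborel A * b\<bar> = measure lborel A * \<bar>a - b\<bar>" for a b
        by (simp only: right_diff_distrib[symmetric] abs_mult) simp
      ultimately have "\<bar>measure lborel A * cell_mean (trig_poly l) - measure lborel A * cell_mean p\<bar> \<le> measure lborel A * d"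
        by (simp only:)
      then show ?thesis using dA mult.commute[of d "measure lborel A"] by linarith
    qed
    obtain N where N: "\<And>n. n \<ge> N \<Longrightarrow> \<bar>(LINT x|lborel. indicator A x * trig_poly l (q n x)) - measure lborel A * cell_mean (trig_poly l)\<bar> < e / 3"
      using LIMSEQ_D[OF trig[of l], of "e / 3"] \<open>e > 0\<close> by auto
    have "norm ((LINT x|lborel. indicator A x * p (q n x)) - measure lborel A * cell_mean p) < e" if "n \<ge> N" for n
      using abs_diff_less_trans[OF abs_diff_less_trans[OF 1[of n] N[OF that]] 2] by simp
    then show "\<exists>N. \<forall>n\<ge>N. norm ((LINT x|lborel. indicator A x * p (q n x)) - measure lborel A * cell_mean p) < e"
      by blast
  qed
  then show ?thesis by (simp add: q_def)
qed

section \<open>Smooth functions\<close>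

definition smooth :: "(real^'n::finite \<Rightarrow> real) \<Rightarrow> bool" where
  "smooth f \<longleftrightarrow> (\<forall>k. C_k k f)"

lemma C_k_SucD: "C_k (Suc k) f \<Longrightarrow> C_k k f"
proof (induction k arbitrary: f)
  case 0 then show ?case by (simp add: differentiable_imp_continuous_on)
next
  case (Suc k) then show ?case by simp
qed

lemma C_k_differentiable: "C_k (Suc k) f \<Longrightarrow> f differentiable (at x)"
  by (simp add: differentiable_on_def)

lemma partial_deriv_eq: "(f has_derivative f') (at x) \<Longrightarrow> partial_deriv j f x = f' (axis j 1)"
  unfolding partial_deriv_def by (simp add: frechet_derivative_at[symmetric])

lemma has_derivative_frechet:
  "f differentiable (at x) \<Longrightarrow> (f has_derivative frechet_derivative f (at x)) (at x)"
  by (simp add: frechet_derivative_works)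

lemma frechet_derivative_partial:
  fixes f :: "real^'n::finite \<Rightarrow> real"
  assumes "f differentiable (at x)"
  shows "frechet_derivative f (at x) v = (\<Sum>i\<in>UNIV. v $ i * partial_deriv i f x)"
proof -
  interpret l: linear "frechet_derivative f (at x)"
    using has_derivative_frechet[OF assms] by (rule has_derivative_linear)
  have "frechet_derivative f (at x) v = frechet_derivative f (at x) (\<Sum>i\<in>UNIV. v $ i *\<^sub>R axis i 1)"
    by (simp add: basis_expansion scalar_mult_eq_scaleR[symmetric])
  then show ?thesis by (simp add: l.sum l.scaleR partial_deriv_def)
qed

lemma partial_deriv_add:
  assumes "f differentiable (at x)" "g differentiable (at x)"
  shows "partial_deriv j (\<lambda>x. f x + g x) x = partial_deriv j f x + partial_deriv j g x"
  using partial_deriv_eq[OF has_derivative_add[OF assms[THEN has_derivative_frechet]]]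
  by (simp add: partial_deriv_def)

lemma partial_deriv_mult:
  assumes "f differentiable (at x)" "g differentiable (at x)"
  shows "partial_deriv j (\<lambda>x. f x * g x) x = f x * partial_deriv j g x + partial_deriv j f x * g x"
  using partial_deriv_eq[OF has_derivative_mult[OF assms[THEN has_derivative_frechet]]]
  by (simp add: partial_deriv_def)

lemma partial_deriv_const: "partial_deriv j (\<lambda>x. c) x = 0"
  using partial_deriv_eq[OF has_derivative_const[of c], of j x] by simp

lemma partial_deriv_affine:
  fixes f :: "real^'m::finite \<Rightarrow> real" and A :: "real^'n::finite^'m"
  assumes "f differentiable (at (A *v x + b))"
  shows "partial_deriv j (\<lambda>x. f (A *v x + b)) x = (\<Sum>i\<in>UNIV. A $ i $ j * partial_deriv i f (A *v x + b))"
    and "(\<lambda>x. f (A *v x + b)) differentiable (at x)"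
proof -
  have 1: "((\<lambda>x. A *v x + b) has_derivative (\<lambda>h. A *v h)) (at x)"
    by (auto intro!: derivative_eq_intros bounded_linear.has_derivative[OF matrix_vector_mul_bounded_linear])
  have d: "((\<lambda>x. f (A *v x + b)) has_derivative (\<lambda>h. frechet_derivative f (at (A *v x + b)) (A *v h))) (at x)"
    using has_derivative_compose[OF 1 has_derivative_frechet[OF assms]] by simp
  then show "(\<lambda>x. f (A *v x + b)) differentiable (at x)" by (auto simp: differentiable_def)
  have "(A *v axis j 1) $ i = A $ i $ j" for i
    by (simp add: matrix_vector_mul_component inner_axis)
  then show "partial_deriv j (\<lambda>x. f (A *v x + b)) x = (\<Sum>i\<in>UNIV. A $ i $ j * partial_deriv i f (A *v x + b))"
    by (simp add: partial_deriv_eq[OF d] frechet_derivative_partial[OF assms])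
qed

lemma C_k_const: "C_k k (\<lambda>x. c)"
proof (induction k arbitrary: c)
  case (Suc k) then show ?case by (simp add: partial_deriv_const[abs_def])
qed simp

lemma C_k_add: "C_k k f \<Longrightarrow> C_k k g \<Longrightarrow> C_k k (\<lambda>x. f x + g x)"
proof (induction k arbitrary: f g)
  case 0 then show ?case by (auto intro: continuous_intros)
next
  case (Suc k)
  have "partial_deriv j (\<lambda>x. f x + g x) = (\<lambda>x. partial_deriv j f x + partial_deriv j g x)" for j
    by (rule ext) (intro partial_deriv_add C_k_differentiable[OF Suc.prems(1)] C_k_differentiable[OF Suc.prems(2)])
  then show ?case using Suc by (auto intro!: derivative_intros)
qed

lemma C_k_mult: "C_k k f \<Longrightarrow> C_k k g \<Longrightarrow> C_k k (\<lambda>x. f x * g x)"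
proof (induction k arbitrary: f g)
  case 0 then show ?case by (auto intro: continuous_intros)
next
  case (Suc k)
  have "partial_deriv j (\<lambda>x. f x * g x) = (\<lambda>x. f x * partial_deriv j g x + partial_deriv j f x * g x)" for j
    by (rule ext) (intro partial_deriv_mult C_k_differentiable[OF Suc.prems(1)] C_k_differentiable[OF Suc.prems(2)])
  moreover have "C_k k (\<lambda>x. f x * partial_deriv j g x + partial_deriv j f x * g x)" for j
    using Suc.prems by (intro C_k_add Suc.IH C_k_SucD[OF Suc.prems(1)] C_k_SucD[OF Suc.prems(2)]) auto
  moreover have "(\<lambda>x. f x * g x) differentiable_on UNIV"
    using Suc.prems by (auto simp: differentiable_on_def intro!: differentiable_mult)
  ultimately show ?case by simp
qed

lemma C_k_sum: "finite I \<Longrightarrow> (\<And>i. i \<in> I \<Longrightarrow> C_k k (f i)) \<Longrightarrow> C_k k (\<lambda>x. \<Sum>i\<in>I. f i x)"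
  by (induction I rule: finite_induct) (auto intro: C_k_const C_k_add)

lemma C_k_prod: "finite I \<Longrightarrow> (\<And>i. i \<in> I \<Longrightarrow> C_k k (f i)) \<Longrightarrow> C_k k (\<lambda>x. \<Prod>i\<in>I. f i x)"
  by (induction I rule: finite_induct) (auto intro: C_k_const C_k_mult)

lemma C_k_affine:
  fixes f :: "real^'m::finite \<Rightarrow> real" and A :: "real^'n::finite^'m"
  shows "C_k k f \<Longrightarrow> C_k k (\<lambda>x. f (A *v x + b))"
proof (induction k arbitrary: f)
  case 0
  then have "continuous_on UNIV f" by simp
  then show ?case
    by (auto intro!: continuous_intros continuous_on_compose2[of UNIV f] matrix_vector_mult_linear_continuous_on)
next
  case (Suc k)
  note d = C_k_differentiable[OF Suc.prems]
  have "partial_deriv j (\<lambda>x. f (A *v x + b)) = (\<lambda>x. \<Sum>i\<in>UNIV. A $ i $ j * partial_deriv i f (A *v x + b))" for j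
    by (rule ext) (rule partial_deriv_affine[OF d])
  moreover have "C_k k (\<lambda>x. \<Sum>i\<in>UNIV. A $ i $ j * partial_deriv i f (A *v x + b))" for j
    using Suc.prems by (intro C_k_sum C_k_mult C_k_const Suc.IH) auto
  ultimately show ?case
    using partial_deriv_affine(2)[OF d, of A b] by (simp add: differentiable_on_def)
qed

lemma smooth_const: "smooth (\<lambda>x. c)"
  and smooth_mult: "smooth f \<Longrightarrow> smooth g \<Longrightarrow> smooth (\<lambda>x. f x * g x)"
  and smooth_sum: "finite I \<Longrightarrow> (\<And>i. i \<in> I \<Longrightarrow> smooth (F i)) \<Longrightarrow> smooth (\<lambda>x. \<Sum>i\<in>I. F i x)"
  and smooth_prod: "finite I \<Longrightarrow> (\<And>i. i \<in> I \<Longrightarrow> smooth (F i)) \<Longrightarrow> smooth (\<lambda>x. \<Prod>i\<in>I. F i x)"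
  by (auto simp: smooth_def intro: C_k_const C_k_mult C_k_sum C_k_prod)

lemma smooth_affine:
  fixes f :: "real^'m::finite \<Rightarrow> real" and A :: "real^'n::finite^'m"
  shows "smooth f \<Longrightarrow> smooth (\<lambda>x. f (A *v x + b))"
  by (simp add: smooth_def C_k_affine)

lemma smooth_differentiable: "smooth f \<Longrightarrow> f differentiable (at x)"
  unfolding smooth_def using C_k_differentiable by blast

lemma smooth_continuous: "smooth f \<Longrightarrow> continuous_on S f"
  unfolding smooth_def using C_k.simps(1) continuous_on_subset by blast

lemma smooth_partial_deriv: "smooth f \<Longrightarrow> smooth (partial_deriv j f)"
  unfolding smooth_def using C_k.simps(2) by blast

section \<open>Smooth bumps\<close>

text \<open>
  The functions \<open>t\<^sup>-\<^sup>i exp (- 1 / t)\<close>, extended by zero. The derivative of each one is a linear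
  combination of two others, so all of them are smooth.
\<close>
definition flat_exp :: "nat \<Rightarrow> real \<Rightarrow> real" where
  "flat_exp i t = (if t > 0 then (1 / t) ^ i * exp (- (1 / t)) else 0)"

lemma flat_exp_tendsto_0: "(flat_exp i \<longlongrightarrow> 0) (at 0)"
proof -
  have "((\<lambda>t. inverse t ^ i / exp (inverse t)) \<longlongrightarrow> 0) (at_right (0::real))"
    by (rule filterlim_compose[OF tendsto_power_div_exp_0 filterlim_inverse_at_top_right])
  then have "(flat_exp i \<longlongrightarrow> 0) (at_right 0)"
    by (rule Lim_transform_eventually)
      (auto simp: flat_exp_def exp_minus divide_simps eventually_at_right_less intro!: eventually_at_rightI[of 0 1])
  moreover have "(flat_exp i \<longlongrightarrow> 0) (at_left 0)"
    by (rule tendsto_eventually) (auto simp: flat_exp_def intro!: eventually_at_leftI[of "-1" 0])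
  ultimately show ?thesis by (simp add: filterlim_split_at)
qed

lemma flat_exp_deriv:
  "(flat_exp i has_real_derivative (- real i * flat_exp (Suc i) t + flat_exp (Suc (Suc i)) t)) (at t)"
proof -
  consider "t > 0" | "t < 0" | "t = 0" by linarith
  then show ?thesis
  proof cases
    case 1
    define s where "s = inverse t"
    have inv: "(inverse has_real_derivative - (s * s)) (at t)"
      using 1 DERIV_inverse[of t UNIV] by (simp add: s_def power2_eq_square)
    have "((\<lambda>s. s ^ i * exp (- s)) has_real_derivative (real i * s ^ (i - 1) * exp (- s) - s ^ i * exp (- s))) (at (inverse t))"
      unfolding s_def by (auto intro!: derivative_eq_intros)
    from DERIV_chain2[OF this inv]
    have "((\<lambda>t. inverse t ^ i * exp (- inverse t)) has_real_derivative
        (real i * s ^ (i - 1) * exp (- s) - s ^ i * exp (- s)) * - (s * s)) (at t)" .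
    moreover have "(real i * s ^ (i - 1) * exp (- s) - s ^ i * exp (- s)) * - (s * s)
        = - real i * flat_exp (Suc i) t + flat_exp (Suc (Suc i)) t"
    proof -
      have "real i * s ^ (i - 1) * (s * s) = real i * s ^ Suc i" by (cases i) simp_all
      moreover have "(real i * s ^ (i - 1) * E - s ^ i * E) * - (s * s) = - (real i * s ^ (i - 1) * (s * s)) * E + s ^ i * (s * s) * E" for E
        by (simp add: algebra_simps)
      moreover have "flat_exp j t = s ^ j * exp (- s)" for j
        using 1 by (simp add: flat_exp_def s_def divide_inverse)
      ultimately show ?thesis by (simp add: mult.assoc)
    qed
    ultimately have "((\<lambda>t. inverse t ^ i * exp (- inverse t)) has_real_derivative
        (- real i * flat_exp (Suc i) t + flat_exp (Suc (Suc i)) t)) (at t)" by simp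
    then show ?thesis
    proof (rule has_field_derivative_transform_within_open[where S = "{0<..}"])
      show "\<And>x. x \<in> {0<..} \<Longrightarrow> inverse x ^ i * exp (- inverse x) = flat_exp i x"
        by (simp add: flat_exp_def divide_inverse)
    qed (use 1 in auto)
  next
    case 2
    have "((\<lambda>t. 0) has_real_derivative 0) (at t)" by simp
    then have "(flat_exp i has_real_derivative 0) (at t)"
      by (rule has_field_derivative_transform_within_open[where S = "{..<0}"])
        (use 2 in \<open>auto simp: flat_exp_def\<close>)
    then show ?thesis using 2 by (simp add: flat_exp_def)
  next
    case 3
    have "((\<lambda>h. (flat_exp i (0 + h) - flat_exp i 0) / h) \<longlongrightarrow> 0) (at 0)"
    proof (rule Lim_transform_eventually[OF flat_exp_tendsto_0[of "Suc i"]])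
      show "eventually (\<lambda>h. flat_exp (Suc i) h = (flat_exp i (0 + h) - flat_exp i 0) / h) (at 0)"
        by (rule always_eventually) (simp add: flat_exp_def)
    qed
    then show ?thesis unfolding 3 DERIV_def by (simp add: flat_exp_def)
  qed
qed

lemma C_k_flat_exp:
  fixes a :: "real^'n::finite"
  shows "C_k k (\<lambda>x. flat_exp i (a \<bullet> x + b))"
proof (induction k arbitrary: i)
  case 0
  have "continuous_on UNIV (flat_exp i)"
    using flat_exp_deriv DERIV_isCont by (blast intro: continuous_at_imp_continuous_on)
  then show ?case by (auto intro!: continuous_intros continuous_on_compose2[of UNIV "flat_exp i"])
next
  case (Suc k)
  define D where "D t = - real i * flat_exp (Suc i) t + flat_exp (Suc (Suc i)) t" for t
  have d: "((\<lambda>x. flat_exp i (a \<bullet> x + b)) has_derivative (\<lambda>h. D (a \<bullet> x + b) * (a \<bullet> h))) (at x)" for x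
  proof -
    have 1: "((\<lambda>x. a \<bullet> x + b) has_derivative (\<lambda>h. a \<bullet> h)) (at x)"
      by (auto intro!: derivative_eq_intros)
    show ?thesis
      using has_derivative_compose[OF 1, of "flat_exp i"] flat_exp_deriv[of i "a \<bullet> x + b"]
      by (simp add: has_field_derivative_def D_def)
  qed
  have "partial_deriv j (\<lambda>x. flat_exp i (a \<bullet> x + b)) = (\<lambda>x. a $ j * (- real i * flat_exp (Suc i) (a \<bullet> x + b) + flat_exp (Suc (Suc i)) (a \<bullet> x + b)))" for j
    by (rule ext) (simp add: partial_deriv_eq[OF d] inner_axis D_def)
  moreover have "C_k k (\<lambda>x. a $ j * (- real i * flat_exp (Suc i) (a \<bullet> x + b) + flat_exp (Suc (Suc i)) (a \<bullet> x + b)))" for j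
    by (intro C_k_mult C_k_add C_k_const Suc.IH)
  moreover have "(\<lambda>x. flat_exp i (a \<bullet> x + b)) differentiable_on UNIV"
    using d by (auto simp: differentiable_on_def differentiable_def)
  ultimately show ?case by simp
qed

text \<open>
  The open box is exactly where a bump is nonzero, and as \<open>n\<close> grows the bumps tend to its
  indicator, because \<open>exp (- 1 / (n t))\<close> tends to \<open>1\<close> for \<open>t > 0\<close>.
\<close>
definition bump :: "real^'n \<Rightarrow> real^'n \<Rightarrow> nat \<Rightarrow> real^'n::finite \<Rightarrow> real" where
  "bump a b n x = (\<Prod>i\<in>UNIV. flat_exp 0 (real (Suc n) * (x $ i - a $ i)) * flat_exp 0 (real (Suc n) * (b $ i - x $ i)))"

lemma smooth_bump: "smooth (bump a b n)"
proof -
  have "smooth (\<lambda>x. flat_exp 0 (real (Suc n) * (x $ i - a $ i)))" for i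
    using C_k_flat_exp[of _ 0 "axis i (real (Suc n))" "- real (Suc n) * a $ i"]
    by (simp add: smooth_def inner_axis' algebra_simps)
  moreover have "smooth (\<lambda>x. flat_exp 0 (real (Suc n) * (b $ i - x $ i)))" for i
    using C_k_flat_exp[of _ 0 "axis i (- real (Suc n))" "real (Suc n) * b $ i"]
    by (simp add: smooth_def inner_axis' algebra_simps)
  ultimately show ?thesis
    unfolding bump_def[abs_def] by (intro smooth_prod smooth_mult) auto
qed

lemma flat_exp_0_bounds: "0 \<le> flat_exp 0 t" "flat_exp 0 t \<le> 1"
  by (auto simp: flat_exp_def)

lemma bump_bounds: "0 \<le> bump a b n x" "bump a b n x \<le> 1"
  unfolding bump_def
  by (auto intro!: prod_nonneg prod_le_1 mult_nonneg_nonneg mult_le_one flat_exp_0_bounds)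

lemma bump_nonzero_iff: "bump a b n x \<noteq> 0 \<longleftrightarrow> x \<in> box a b"
proof -
  have "flat_exp 0 (real (Suc n) * t) \<noteq> 0 \<longleftrightarrow> t > 0" for t
    by (simp add: flat_exp_def zero_less_mult_iff)
  then show ?thesis unfolding bump_def by (auto simp: mem_box_cart)
qed

lemma bump_tendsto: "(\<lambda>n. bump a b n x) \<longlonglongrightarrow> indicator (box a b) x"
proof (cases "x \<in> box a b")
  case True
  have lim: "(\<lambda>n. flat_exp 0 (real (Suc n) * t)) \<longlonglongrightarrow> 1" if "t > 0" for t
  proof -
    have "(\<lambda>n. exp (- (inverse (real (Suc n)) * inverse t))) \<longlonglongrightarrow> exp (- (0 * inverse t))"
      by (intro tendsto_intros LIMSEQ_inverse_real_of_nat)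
    moreover have "flat_exp 0 (real (Suc n) * t) = exp (- (inverse (real (Suc n)) * inverse t))" for n
      using that by (simp add: flat_exp_def divide_inverse)
    ultimately show ?thesis by simp
  qed
  have "(\<lambda>n. bump a b n x) \<longlonglongrightarrow> (\<Prod>i\<in>(UNIV::'a set). 1 * 1)"
    unfolding bump_def using True by (intro tendsto_prod tendsto_mult lim) (auto simp: mem_box_cart)
  then show ?thesis using True by simp
next
  case False
  then have "bump a b n x = 0" for n using bump_nonzero_iff by blast
  then show ?thesis using False by simp
qed

text \<open>
  The sets over which \<open>g\<close> has integral zero form a Dynkin system that contains the boxes, hence all
  Borel sets, in particular the sets where \<open>g\<close> is positive or negative.
\<close>
lemma AE_zero_if_box_integrals_zero:
  fixes g :: "'a::euclidean_space \<Rightarrow> real"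
  assumes int: "integrable lborel g" and zero: "\<And>a b. (LINT x|lborel. indicator (box a b) x * g x) = 0"
  shows "AE x in lborel. g x = 0"
proof -
  have gm[measurable]: "g \<in> borel_measurable borel" using int by auto
  have iE: "integrable lborel (\<lambda>x. indicator E x * g x)" if "E \<in> sets borel" for E
    using integrable_mult_indicator[OF _ int, of E] that by simp
  let ?G = "range (\<lambda>(a, b). box a b :: 'a set)"
  have all: "(LINT x|lborel. indicator E x * g x) = 0" if "E \<in> sets borel" for E
  proof -
    have sb: "sets (borel :: 'a measure) = sigma_sets UNIV ?G"
      by (subst borel_eq_box) simp
    have IS: "Int_stable ?G"
    proof (rule Int_stableI)
      fix X Y assume "X \<in> ?G" "Y \<in> ?G"
      then obtain a b c d where "X = box a b" "Y = box c d" by auto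
      then show "X \<inter> Y \<in> ?G" by (simp only: box_Int_box) (rule range_eqI[of _ _ "(_, _)"], simp)
    qed
    have tot: "(LINT x|lborel. g x) = 0"
    proof -
      have "(\<lambda>n. LINT x|lborel. indicator (box (- (real n *\<^sub>R One)) (real n *\<^sub>R One)) x * g x) \<longlonglongrightarrow> (LINT x|lborel. g x)"
      proof (rule integral_dominated_convergence[where w = "\<lambda>x. norm (g x)"])
        show "AE x in lborel. (\<lambda>n. indicator (box (- (real n *\<^sub>R One)) (real n *\<^sub>R One)) x * g x) \<longlonglongrightarrow> g x"
        proof (rule AE_I2)
          fix x :: 'a
          obtain N where N: "x \<in> box (- (real N *\<^sub>R One)) (real N *\<^sub>R One)"
          proof -
            have "x \<in> (\<Union>i::nat. box (- (real i *\<^sub>R One)) (real i *\<^sub>R One))"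
              unfolding UN_box_eq_UNIV by simp
            then show thesis by (elim UN_E) (rule that)
          qed
          have "x \<in> box (- (real n *\<^sub>R One)) (real n *\<^sub>R One)" if "n \<ge> N" for n
            using N that by (force simp: mem_box)
          then have "eventually (\<lambda>n. indicator (box (- (real n *\<^sub>R One)) (real n *\<^sub>R One)) x * g x = g x) sequentially"
            by (intro eventually_sequentiallyI[of N]) simp
          then show "(\<lambda>n. indicator (box (- (real n *\<^sub>R One)) (real n *\<^sub>R One)) x * g x) \<longlonglongrightarrow> g x"
            by (rule tendsto_eventually)
        qed
      qed (use int in \<open>auto simp: indicator_def\<close>)
      then show ?thesis by (simp only: zero) (simp add: LIMSEQ_const_iff)
    qed
    have P: "?G \<subseteq> Pow UNIV" by simp
    show ?thesis using IS P that[unfolded sb]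
    proof (induction rule: sigma_sets_induct_disjoint)
      case (basic E) then show ?case using zero by auto
    next
      case empty then show ?case by simp
    next
      case (compl E)
      then have E: "E \<in> sets borel" by (simp add: sb)
      have "(LINT x|lborel. indicator (UNIV - E) x * g x) = (LINT x|lborel. g x - indicator E x * g x)"
        by (rule Bochner_Integration.integral_cong) (auto simp: indicator_def)
      also have "\<dots> = 0" using int iE[OF E] tot compl by simp
      finally show ?case .
    next
      case (union E)
      then have E: "E i \<in> sets borel" for i by (auto simp: sb)
      have "(LINT x:(\<Union>i. E i)|lborel. g x) = (\<Sum>i. LINT x:E i|lborel. g x)"
      proof (rule lebesgue_integral_countable_add)
        show "set_integrable lborel (\<Union>i. E i) g"
          unfolding set_integrable_def using iE[of "\<Union>i. E i"] E by auto
      qed (use union(1) E in \<open>auto simp: disjoint_family_on_def\<close>)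
      then show ?case using union by (simp add: set_lebesgue_integral_def)
    qed
  qed
  have pos: "AE x in lborel. indicator {x. s * g x > 0} x * (s * g x) = 0" for s :: real
  proof (subst integral_nonneg_eq_0_iff_AE[symmetric])
    have [measurable]: "{x. s * g x > 0} \<in> sets borel" by measurable
    show "integrable lborel (\<lambda>x. indicator {x. s * g x > 0} x * (s * g x))"
      using integrable_mult_right[OF iE[of "{x. s * g x > 0}"], of s] by (simp add: mult_ac)
    have "(LINT x|lborel. indicator {x. s * g x > 0} x * (s * g x)) = s * (LINT x|lborel. indicator {x. s * g x > 0} x * g x)"
      by (subst integral_mult_right_zero[symmetric]) (simp add: mult_ac)
    then show "(LINT x|lborel. indicator {x. s * g x > 0} x * (s * g x)) = 0"
      using all[of "{x. s * g x > 0}"] by simp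
  qed (auto simp: indicator_def)
  show ?thesis
    using pos[of 1] pos[of "-1"]
    by eventually_elim (auto simp: indicator_def split: if_splits)
qed

text \<open>
  The fundamental lemma of the calculus of variations. Bumps tend to indicators of boxes, so \<open>h\<close>
  has integral zero over each open box whose closure lies in \<open>\<Omega>\<close>. The closures of countably many
  such boxes cover \<open>\<Omega>\<close>, and their boundaries are null sets.
\<close>
lemma fundamental_lemma:
  fixes h :: "real^'n::finite \<Rightarrow> real"
  assumes \<Omega>: "open \<Omega>" and int: "integrable lborel (\<lambda>x. indicator \<Omega> x * h x)"
    and hm[measurable]: "h \<in> borel_measurable borel"
    and zero: "\<And>a b n. cbox a b \<subseteq> \<Omega> \<Longrightarrow> (LINT x|lborel. bump a b n x * h x) = 0"
  shows "AE x in lborel. x \<in> \<Omega> \<longrightarrow> h x = 0"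
proof -
  have bm[measurable]: "bump a b n \<in> borel_measurable borel" for a b :: "real^'n" and n
    by (intro borel_measurable_continuous_onI smooth_continuous smooth_bump)
  have box0: "(LINT x|lborel. indicator (box a b) x * h x) = 0" if ab: "cbox a b \<subseteq> \<Omega>" for a b
  proof -
    have "(\<lambda>n. LINT x|lborel. bump a b n x * h x) \<longlonglongrightarrow> (LINT x|lborel. indicator (box a b) x * h x)"
    proof (rule integral_dominated_convergence[where w = "\<lambda>x. norm (indicator \<Omega> x * h x)"])
      show "AE x in lborel. (\<lambda>n. bump a b n x * h x) \<longlonglongrightarrow> indicator (box a b) x * h x"
        by (intro AE_I2 tendsto_intros bump_tendsto)
      show "AE x in lborel. norm (bump a b n x * h x) \<le> norm (indicator \<Omega> x * h x)" for n
      proof (rule AE_I2)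
        fix x
        show "norm (bump a b n x * h x) \<le> norm (indicator \<Omega> x * h x)"
        proof (cases "bump a b n x = 0")
          case False
          then have "x \<in> \<Omega>" using ab bump_nonzero_iff box_subset_cbox by blast
          then show ?thesis using bump_bounds[of a b n x] by (simp add: abs_mult mult_left_le_one_le)
        qed simp
      qed
    qed (use int in auto)
    then show ?thesis using zero[OF ab] by (simp add: LIMSEQ_const_iff)
  qed
  have loc: "AE x in lborel. x \<in> cbox c d \<longrightarrow> h x = 0" if cd: "cbox c d \<subseteq> \<Omega>" for c d
  proof -
    have "AE x in lborel. indicator (box c d) x * h x = 0"
    proof (rule AE_zero_if_box_integrals_zero)
      have "integrable lborel (\<lambda>x. indicator (box c d) x *\<^sub>R (indicator \<Omega> x * h x))"
        by (intro integrable_mult_indicator int) auto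
      moreover have "(\<lambda>x. indicator (box c d) x *\<^sub>R (indicator \<Omega> x * h x)) = (\<lambda>x. indicator (box c d) x * h x)"
        using cd box_subset_cbox by (auto simp: indicator_def fun_eq_iff)
      ultimately show "integrable lborel (\<lambda>x. indicator (box c d) x * h x)" by (simp only:)
      fix a b
      obtain a' b' where ab: "box a b \<inter> box c d = box a' b'" by (auto simp: box_Int_box)
      have "(LINT x|lborel. indicator (box a' b') x * h x) = 0"
      proof (cases "box a' b' = {}")
        case False
        then have "cbox a' b' = closure (box a' b')" by (simp add: closure_box)
        also have "\<dots> \<subseteq> cbox c d"
          using ab box_subset_cbox by (intro closure_minimal) auto
        finally show ?thesis using box0 cd by blast
      qed simp
      then show "(LINT x|lborel. indicator (box a b) x * (indicator (box c d) x * h x)) = 0"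
        unfolding ab[symmetric] by (simp add: indicator_inter_arith mult.assoc)
    qed
    moreover have "AE x in lborel. x \<notin> cbox c d - box c d"
    proof (rule AE_not_in, rule null_setsI)
      show "emeasure lborel (cbox c d - box c d) = 0"
        by (subst emeasure_Diff) (auto simp: box_subset_cbox emeasure_lborel_box_eq emeasure_lborel_cbox_eq)
    qed simp
    ultimately show ?thesis by eventually_elim (auto simp: indicator_def)
  qed
  obtain \<D> where D: "countable \<D>" "\<D> \<subseteq> Pow \<Omega>" "\<And>X. X \<in> \<D> \<Longrightarrow> \<exists>a b. X = cbox a b" "\<Union>\<D> = \<Omega>"
    by (rule open_countable_Union_open_cbox[OF \<Omega>]) blast
  have "AE x in lborel. \<forall>X\<in>\<D>. x \<in> X \<longrightarrow> h x = 0"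
  proof (subst AE_ball_countable[OF D(1)], rule ballI)
    fix X assume X: "X \<in> \<D>"
    then obtain a b where "X = cbox a b" using D(3) by blast
    then show "AE x in lborel. x \<in> X \<longrightarrow> h x = 0" using loc[of a b] X D(2) by auto
  qed
  then show ?thesis by eventually_elim (use D(4) in blast)
qed

section \<open>Lebesgue measure on products with the cell\<close>

text \<open>
  For Borel functions on Borel sets everything can be computed with \<^const>\<open>lborel\<close>, where Fubini's
  theorem and translation invariance are at hand.
\<close>
lemma lebesgue_on_borel:
  fixes f :: "'a::euclidean_space \<Rightarrow> 'b::{banach, second_countable_topology}"
  assumes [measurable]: "f \<in> borel_measurable borel" "S \<in> sets borel"
  shows "f \<in> borel_measurable (lebesgue_on S)"
    and "integrable (lebesgue_on S) f \<longleftrightarrow> integrable lborel (\<lambda>x. indicator S x *\<^sub>R f x)"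
    and "(LINT x|lebesgue_on S. f x) = (LINT x|lborel. indicator S x *\<^sub>R f x)"
proof -
  have S: "S \<inter> space lebesgue \<in> sets lebesgue" using assms(2) by simp
  have m: "(\<lambda>x. indicator S x *\<^sub>R f x) \<in> borel_measurable lborel" by measurable
  show "f \<in> borel_measurable (lebesgue_on S)"
    by (intro measurable_restrict_space1 measurable_completion) simp
  show "integrable (lebesgue_on S) f \<longleftrightarrow> integrable lborel (\<lambda>x. indicator S x *\<^sub>R f x)"
    unfolding integrable_restrict_space[OF S] by (rule integrable_completion[OF m])
  show "(LINT x|lebesgue_on S. f x) = (LINT x|lborel. indicator S x *\<^sub>R f x)"
    unfolding integral_restrict_space[OF S] by (rule integral_completion[OF m])
qed

lemma emeasure_lborel_Times:
  assumes "A \<in> sets borel" "B \<in> sets borel"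
  shows "emeasure lborel (A \<times> B) = emeasure lborel A * emeasure lborel B"
  using lborel.emeasure_pair_measure_Times[of A lborel B] assms by (simp add: lborel_prod)

lemma lebesgue_Times_unit_cell:
  fixes E :: "'a::euclidean_space set"
  assumes "E \<in> sets lebesgue"
  shows "E \<times> (unit_cell :: (real^'m) set) \<in> sets lebesgue"
    and "emeasure lebesgue (E \<times> (unit_cell :: (real^'m) set)) = emeasure lebesgue E"
proof -
  let ?Y = "unit_cell :: (real^'m) set"
  obtain B N N' where E: "E = B \<union> N" "N \<subseteq> N'" "N' \<in> null_sets lborel" "B \<in> sets lborel"
    using assms by (elim sets_completionE) auto
  have N': "N' \<in> sets borel" "emeasure lborel N' = 0" using E(3) by auto
  have BY: "B \<times> ?Y \<in> sets borel" "N' \<times> ?Y \<in> sets borel"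
    using E(4) N'(1) by (auto intro: borel_Times)
  have "N' \<times> ?Y \<in> null_sets lborel"
    using emeasure_lborel_Times[OF N'(1) unit_cell_borel] N'(2) BY(2) by (intro null_setsI) auto
  then have NY: "N \<times> ?Y \<in> null_sets lebesgue"
    using E(2) by (intro null_sets_completion_subset[OF _ null_sets_completionI]) auto
  have N0: "N \<in> null_sets lebesgue"
    by (rule null_sets_completion_subset[OF E(2) null_sets_completionI[OF E(3)]])
  have eq: "E \<times> ?Y = B \<times> ?Y \<union> N \<times> ?Y" using E(1) by auto
  show "E \<times> ?Y \<in> sets lebesgue" unfolding eq using BY NY by (intro sets.Un) auto
  have "emeasure lebesgue (E \<times> ?Y) = emeasure lebesgue (B \<times> ?Y)"
    unfolding eq using BY NY by (intro emeasure_Un_null_set) auto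
  also have "\<dots> = emeasure lborel B"
    using BY E(4) by (simp add: emeasure_lborel_Times)
  also have "\<dots> = emeasure lebesgue E"
    unfolding E(1) using E(4) N0 by (subst emeasure_Un_null_set) auto
  finally show "emeasure lebesgue (E \<times> ?Y) = emeasure lebesgue E" .
qed

text \<open>
  Since the cell has measure \<open>1\<close>, the projection preserves Lebesgue measure. Test functions are only
  Lebesgue measurable in \<open>x\<close>, and this transports their measurability and their norms to the
  product.
\<close>
lemma fst_measure_preserving:
  fixes \<Omega> :: "'a::euclidean_space set"
  assumes \<Omega>: "\<Omega> \<in> sets lebesgue"
  shows "fst \<in> lebesgue_on (\<Omega> \<times> (unit_cell :: (real^'m) set)) \<rightarrow>\<^sub>M lebesgue_on \<Omega>"
    and "distr (lebesgue_on (\<Omega> \<times> (unit_cell :: (real^'m) set))) (lebesgue_on \<Omega>) fst = lebesgue_on \<Omega>"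
proof -
  let ?Y = "unit_cell :: (real^'m) set"
  let ?P = "lebesgue_on (\<Omega> \<times> ?Y)"
  note sp = lebesgue_Times_unit_cell[where 'm = 'm]
  have vim: "fst -` E \<inter> space ?P = E \<times> ?Y" if "E \<subseteq> \<Omega>" for E
    using that by auto
  have E: "E \<subseteq> \<Omega>" "E \<in> sets lebesgue" if "E \<in> sets (lebesgue_on \<Omega>)" for E
    using that \<Omega> by (auto simp: sets_restrict_space_iff)
  show meas: "fst \<in> ?P \<rightarrow>\<^sub>M lebesgue_on \<Omega>"
  proof (rule measurableI)
    fix F assume "F \<in> sets (lebesgue_on \<Omega>)"
    note F = E[OF this]
    show "fst -` F \<inter> space ?P \<in> sets ?P"
      unfolding vim[OF F(1)] using F sp(1)[OF F(2)] sp(1)[OF \<Omega>]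
      by (subst sets_restrict_space_iff) auto
  qed auto
  show "distr ?P (lebesgue_on \<Omega>) fst = lebesgue_on \<Omega>"
  proof (rule measure_eqI)
    fix F assume "F \<in> sets (distr ?P (lebesgue_on \<Omega>) fst)"
    then have Fs: "F \<in> sets (lebesgue_on \<Omega>)" by simp
    note F = E[OF Fs]
    have "emeasure (distr ?P (lebesgue_on \<Omega>) fst) F = emeasure ?P (F \<times> ?Y)"
      unfolding emeasure_distr[OF meas Fs] vim[OF F(1)] ..
    also have "\<dots> = emeasure lebesgue (F \<times> ?Y)"
      by (rule emeasure_restrict_space) (use F sp(1)[OF \<Omega>] in auto)
    also have "\<dots> = emeasure (lebesgue_on \<Omega>) F"
      using F \<Omega> by (simp add: sp(2) emeasure_restrict_space)
    finally show "emeasure (distr ?P (lebesgue_on \<Omega>) fst) F = emeasure (lebesgue_on \<Omega>) F" .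
  qed simp
qed

lemma snd_measurable_lebesgue_on:
  "snd \<in> borel_measurable (lebesgue_on (\<Omega> \<times> (unit_cell :: (real^'m) set)))"
proof -
  have "snd \<in> borel_measurable (borel :: ('a::euclidean_space \<times> (real^'m)) measure)"
    by (intro borel_measurable_continuous_onI continuous_intros)
  then show ?thesis by (intro measurable_restrict_space1 measurable_completion) simp
qed

section \<open>Approximating test functions\<close>

lemma L2_C_periodicD:
  assumes "\<phi> \<in> L2_C_periodic \<Omega>"
  shows "x \<in> \<Omega> \<Longrightarrow> periodic (apply_bcontfun (\<phi> x))"
    and "\<phi> \<in> borel_measurable (lebesgue_on \<Omega>)"
    and "integrable (lebesgue_on \<Omega>) (\<lambda>x. (norm (\<phi> x))\<^sup>2)"
  using assms by (auto simp: L2_C_periodic_def)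

text \<open>
  The first trigonometric polynomial within \<open>\<delta>\<close>. It replaces a Borel function with values in the
  periodic continuous functions by a countably valued one.
\<close>
definition trig_index :: "real \<Rightarrow> ((real^'m) \<Rightarrow>\<^sub>C real) \<Rightarrow> nat" where
  "trig_index \<delta> p = (LEAST j. norm (p - trig_seq j) < \<delta>)"

lemma norm_trig_index:
  assumes "periodic (apply_bcontfun p)" "\<delta> > 0"
  shows "norm (p - trig_seq (trig_index \<delta> p)) < \<delta>"
  unfolding trig_index_def using trig_seq_dense[OF assms] by (metis LeastI)

lemma trig_index_measurable:
  fixes \<phi> :: "'a \<Rightarrow> (real^'m) \<Rightarrow>\<^sub>C real"
  assumes "\<phi> \<in> borel_measurable M"
  shows "(\<lambda>x. trig_index \<delta> (\<phi> x)) \<in> M \<rightarrow>\<^sub>M count_space UNIV"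
proof -
  have "Measurable.pred M (\<lambda>x. norm (\<phi> x - trig_seq j) < \<delta>)" for j
  proof -
    have "{x \<in> space M. norm (\<phi> x - trig_seq j) < \<delta>} = \<phi> -` ball (trig_seq j) \<delta> \<inter> space M"
      by (auto simp: dist_norm norm_minus_commute)
    also have "\<dots> \<in> sets M" by (rule measurable_sets[OF assms]) simp
    finally show ?thesis by (simp add: pred_def)
  qed
  then show ?thesis unfolding trig_index_def by (rule measurable_Least)
qed

text \<open>
  Joint measurability of a test function, evaluated at a varying point: it is a pointwise limit of
  countably valued functions, for which the claim is clear.
\<close>
lemma measurable_eval_periodic:
  fixes \<phi> :: "'a \<Rightarrow> (real^'m) \<Rightarrow>\<^sub>C real"
  assumes \<phi>: "\<phi> \<in> borel_measurable M" and per: "\<And>x. x \<in> space M \<Longrightarrow> periodic (apply_bcontfun (\<phi> x))"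
    and q: "q \<in> borel_measurable M"
  shows "(\<lambda>x. apply_bcontfun (\<phi> x) (q x)) \<in> borel_measurable M"
proof (rule borel_measurable_LIMSEQ_metric)
  fix n :: nat
  have "(\<lambda>x. apply_bcontfun (trig_seq j) (q x)) \<in> borel_measurable M" for j :: nat
    by (rule measurable_compose[OF q]) (intro borel_measurable_continuous_onI continuous_on_apply_bcontfun)
  then show "(\<lambda>x. apply_bcontfun (trig_seq (trig_index (inverse (Suc n)) (\<phi> x))) (q x)) \<in> borel_measurable M"
    by (rule measurable_compose_countable[OF _ trig_index_measurable[OF \<phi>]])
next
  fix x assume x: "x \<in> space M"
  have "(\<lambda>n. apply_bcontfun (trig_seq (trig_index (inverse (Suc n)) (\<phi> x))) (q x) - apply_bcontfun (\<phi> x) (q x)) \<longlonglongrightarrow> 0"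
  proof (rule Lim_null_comparison[OF _ LIMSEQ_inverse_real_of_nat], intro always_eventually allI)
    fix n
    let ?d = "\<phi> x - trig_seq (trig_index (inverse (Suc n)) (\<phi> x))"
    have "norm (apply_bcontfun ?d (q x)) \<le> norm ?d" by (rule norm_bounded)
    also have "\<dots> \<le> inverse (Suc n)" by (intro less_imp_le norm_trig_index per x) simp
    finally show "norm (apply_bcontfun (trig_seq (trig_index (inverse (Suc n)) (\<phi> x))) (q x) - apply_bcontfun (\<phi> x) (q x)) \<le> inverse (Suc n)"
      by (simp add: norm_minus_commute)
  qed
  then show "(\<lambda>n. apply_bcontfun (trig_seq (trig_index (inverse (Suc n)) (\<phi> x))) (q x)) \<longlonglongrightarrow> apply_bcontfun (\<phi> x) (q x)"
    by (simp add: LIM_zero_iff)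
qed

text \<open>
  A countable family that, for open \<open>\<Omega>\<close> of finite measure, approximates every measurable subset
  of \<open>\<Omega>\<close> in measure (\<open>basic_opens_approx\<close>).
\<close>
definition basic_opens :: "'a::second_countable_topology set \<Rightarrow> 'a set set" where
  "basic_opens \<Omega> = (\<lambda>F. \<Omega> \<inter> \<Union>F) ` {F. finite F \<and> F \<subseteq> (SOME B. countable B \<and> topological_basis B)}"

lemma some_basis:
  "countable (SOME B :: 'a::second_countable_topology set set. countable B \<and> topological_basis B)"
  "topological_basis (SOME B :: 'a set set. countable B \<and> topological_basis B)"
proof -
  have "\<exists>B :: 'a set set. countable B \<and> topological_basis B"
    using ex_countable_basis by blast
  from someI_ex[OF this]
  show "countable (SOME B :: 'a::second_countable_topology set set. countable B \<and> topological_basis B)"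
    "topological_basis (SOME B :: 'a set set. countable B \<and> topological_basis B)" by auto
qed

lemma countable_basic_opens: "countable (basic_opens \<Omega>)"
  unfolding basic_opens_def by (intro countable_image countable_Collect_finite_subset some_basis)

lemma basic_opensD: "open \<Omega> \<Longrightarrow> A \<in> basic_opens \<Omega> \<Longrightarrow> open A \<and> A \<subseteq> \<Omega>"
  unfolding basic_opens_def using topological_basis_open[OF some_basis(2)]
  by (fastforce intro!: open_Int open_Union)

lemma basic_opens_approx:
  fixes \<Omega> :: "'a::euclidean_space set"
  assumes \<Omega>: "open \<Omega>" "emeasure lborel \<Omega> < \<infinity>" and E: "E \<in> sets lebesgue" "E \<subseteq> \<Omega>" and e: "e > 0"
  obtains A where "A \<in> basic_opens \<Omega>" "measure lebesgue (sym_diff E A) < e"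
proof -
  let ?\<B> = "SOME B :: 'a set set. countable B \<and> topological_basis B"
  have fin: "emeasure lebesgue X \<noteq> \<infinity>" if "X \<subseteq> \<Omega>" "X \<in> sets lebesgue" for X
  proof -
    have "emeasure lebesgue X \<le> emeasure lebesgue \<Omega>" using that \<Omega> by (intro emeasure_mono) auto
    also have "\<dots> < \<infinity>" using \<Omega> by simp
    finally show ?thesis by simp
  qed
  obtain T where T: "open T" "E \<subseteq> T" "T - E \<in> lmeasurable" "emeasure lebesgue (T - E) < ennreal (e / 2)"
    using sets_lebesgue_outer_open[OF E(1), of "e / 2"] e by auto
  define W where "W = T \<inter> \<Omega>"
  have W: "open W" "W \<subseteq> \<Omega>" "E \<subseteq> W" using T E \<Omega> by (auto simp: W_def)
  have "\<exists>B'\<subseteq>?\<B>. \<Union>B' = W"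
    using some_basis(2)[where 'a = 'a] W(1) unfolding topological_basis_def by blast
  then obtain B' where B': "B' \<subseteq> ?\<B>" "\<Union>B' = W" by blast
  have cB': "countable B'" using B'(1) some_basis(1) countable_subset by blast
  define b where "b i = (if B' = {} then {} else from_nat_into B' i)" for i
  have bW: "(\<Union>i. b i) = W"
    using B'(2) range_from_nat_into[OF _ cB'] by (cases "B' = {}") (auto simp: b_def)
  have bo: "open (b i)" for i
    using B'(1) from_nat_into[of B' i] topological_basis_open[OF some_basis(2)]
    by (auto simp: b_def)
  define c where "c n = (\<Union>i<n. b i)" for n
  have co: "open (c n)" and cW: "c n \<subseteq> W" for n using bo bW by (auto simp: c_def)
  have "(\<lambda>n. measure lebesgue (c n)) \<longlonglongrightarrow> measure lebesgue (\<Union>n. c n)"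
  proof (rule Lim_measure_incseq)
    show "incseq c" unfolding incseq_def c_def by (intro allI impI UN_mono) auto
    have "(\<Union>n. c n) \<subseteq> W" using cW by blast
    then show "emeasure lebesgue (\<Union>n. c n) \<noteq> \<infinity>" using W(2) co by (intro fin) auto
  qed (use co in auto)
  moreover have "(\<Union>n. c n) = W" using bW by (auto simp: c_def)
  ultimately have "(\<lambda>n. measure lebesgue (c n)) \<longlonglongrightarrow> measure lebesgue W" by simp
  then obtain n where n: "\<bar>measure lebesgue (c n) - measure lebesgue W\<bar> < e / 2"
    using LIMSEQ_D[of _ _ "e / 2"] e by fastforce
  have A: "c n \<in> basic_opens \<Omega>"
  proof -
    have "finite (b ` {..<n} - {{}})" by simp
    moreover have "b ` {..<n} - {{}} \<subseteq> ?\<B>"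
      using B'(1) from_nat_into[of B'] by (auto simp: b_def split: if_splits)
    moreover have "c n = \<Omega> \<inter> \<Union>(b ` {..<n} - {{}})" using cW[of n] W(2) by (auto simp: c_def)
    ultimately show ?thesis unfolding basic_opens_def by blast
  qed
  have ml: "W \<in> sets lebesgue" "c n \<in> sets lebesgue" using W(1) co[of n] by auto
  have "measure lebesgue (sym_diff E (c n)) \<le> measure lebesgue ((W - c n) \<union> (W - E))"
  proof (rule measure_mono_fmeasurable)
    show "sym_diff E (c n) \<subseteq> (W - c n) \<union> (W - E)" using W(3) cW[of n] by blast
    show "sym_diff E (c n) \<in> sets lebesgue" using ml E(1) by (intro sets.Un sets.Diff)
    have "(W - c n) \<union> (W - E) \<in> sets lebesgue" using ml E(1) by (intro sets.Un sets.Diff)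
    then show "(W - c n) \<union> (W - E) \<in> lmeasurable"
      using fin[of "(W - c n) \<union> (W - E)"] W(2) unfolding fmeasurable_def by (auto simp only: top.not_eq_extremum infinity_ennreal_def)
  qed
  also have "\<dots> \<le> measure lebesgue (W - c n) + measure lebesgue (W - E)"
    by (rule measure_Un_le) (use W co E in auto)
  also have "measure lebesgue (W - c n) = measure lebesgue W - measure lebesgue (c n)"
    by (rule measure_Diff[OF fin[OF W(2) ml(1)] ml cW])
  also have "measure lebesgue (W - E) \<le> measure lebesgue (T - E)"
    by (rule measure_mono_fmeasurable) (use W E T in \<open>auto simp: W_def\<close>)
  also have "measure lebesgue (T - E) < e / 2"
    using T(4) unfolding emeasure_eq_measure2[OF T(3)] by (simp add: ennreal_less_iff)
  finally have "measure lebesgue (sym_diff E (c n)) < e" using n by linarith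
  then show thesis using that A by blast
qed

section \<open>Step functions in the slow variable\<close>

text \<open>
  The linear span of the products of an indicator from \<open>\<A>\<close> with a function from \<open>\<D>\<close>. Two
  instances matter: \<open>open_tests\<close> is closed under products, as needed for squares, and
  \<open>trig_tests\<close> has countably many generators, as needed for subsequences.
\<close>
inductive_set step_tests :: "(real^3) set set \<Rightarrow> (real^'m \<Rightarrow> real) set \<Rightarrow> (real^3 \<Rightarrow> real^'m \<Rightarrow> real) set"
  for \<A> \<D> where
  zero: "(\<lambda>x y. 0) \<in> step_tests \<A> \<D>"
| step: "f \<in> step_tests \<A> \<D> \<Longrightarrow> A \<in> \<A> \<Longrightarrow> p \<in> \<D> \<Longrightarrow>
    (\<lambda>x y. f x y + c * (indicator A x * p y)) \<in> step_tests \<A> \<D>"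

lemma step_tests_mono:
  assumes "\<A> \<subseteq> \<A>'" "\<D> \<subseteq> \<D>'"
  shows "step_tests \<A> \<D> \<subseteq> step_tests \<A>' \<D>'"
proof
  fix f assume "f \<in> step_tests \<A> \<D>"
  then show "f \<in> step_tests \<A>' \<D>'"
    by induction (use assms in \<open>auto intro: step_tests.intros\<close>)
qed

lemma step_tests_lin:
  assumes "f \<in> step_tests \<A> \<D>" "g \<in> step_tests \<A> \<D>"
  shows "(\<lambda>x y. f x y + c * g x y) \<in> step_tests \<A> \<D>"
  using assms(2)
proof induction
  case zero then show ?case using assms(1) by simp
next
  case (step g A p d)
  have "(\<lambda>x y. (f x y + c * g x y) + (c * d) * (indicator A x * p y)) \<in> step_tests \<A> \<D>"
    using step by (intro step_tests.step) auto
  then show ?case by (simp add: algebra_simps)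
qed

lemma step_tests_mult:
  assumes \<A>: "\<And>A B. A \<in> \<A> \<Longrightarrow> B \<in> \<A> \<Longrightarrow> A \<inter> B \<in> \<A>"
    and \<D>: "\<And>p q. p \<in> \<D> \<Longrightarrow> q \<in> \<D> \<Longrightarrow> (\<lambda>y. p y * q y) \<in> \<D>"
    and f: "f \<in> step_tests \<A> \<D>" and g: "g \<in> step_tests \<A> \<D>"
  shows "(\<lambda>x y. f x y * g x y) \<in> step_tests \<A> \<D>"
proof -
  have one: "(\<lambda>x y. f x y * (indicator A x * p y)) \<in> step_tests \<A> \<D>" if "A \<in> \<A>" "p \<in> \<D>" for A p
    using f
  proof induction
    case zero then show ?case using step_tests.zero by simp
  next
    case (step f B q d)
    have "(\<lambda>x y. f x y * (indicator A x * p y) + d * (indicator (B \<inter> A) x * (q y * p y))) \<in> step_tests \<A> \<D>"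
      using step that by (intro step_tests.step \<A> \<D>) auto
    then show ?case by (simp add: indicator_inter_arith algebra_simps)
  qed
  show ?thesis using g
  proof induction
    case zero then show ?case using step_tests.zero by simp
  next
    case (step g A p c)
    have "(\<lambda>x y. f x y * g x y + c * (f x y * (indicator A x * p y))) \<in> step_tests \<A> \<D>"
      using step one by (intro step_tests_lin) auto
    then show ?case by (simp add: algebra_simps)
  qed
qed

definition open_tests :: "(real^3) set \<Rightarrow> (real^3 \<Rightarrow> real^'m \<Rightarrow> real) set" where
  "open_tests \<Omega> = step_tests {A. open A \<and> A \<subseteq> \<Omega>} {p. periodic p \<and> continuous_on UNIV p}"

definition trig_tests :: "(real^3) set \<Rightarrow> (real^3 \<Rightarrow> real^'m \<Rightarrow> real) set" where
  "trig_tests \<Omega> = step_tests (basic_opens \<Omega>) (range (\<lambda>j. apply_bcontfun (trig_seq j)))"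

lemma trig_tests_open_tests: "open \<Omega> \<Longrightarrow> trig_tests \<Omega> \<subseteq> open_tests \<Omega>"
  unfolding trig_tests_def open_tests_def
  by (intro step_tests_mono) (auto simp: periodic_trig_seq dest: basic_opensD)

lemma open_tests_mult:
  "f \<in> open_tests \<Omega> \<Longrightarrow> g \<in> open_tests \<Omega> \<Longrightarrow> (\<lambda>x y. f x y * g x y) \<in> open_tests \<Omega>"
  unfolding open_tests_def
  by (rule step_tests_mult) (auto intro!: continuous_intros simp: periodic_def)

lemma open_tests_measurable:
  assumes "f \<in> open_tests \<Omega>"
  shows "(\<lambda>z. f (fst z) (snd z)) \<in> borel_measurable borel"
  using assms unfolding open_tests_def
proof induction
  case zero then show ?case by simp
next
  case (step f A p c)
  have [measurable]: "A \<in> sets borel" "p \<in> borel_measurable borel"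
    using step by (auto intro: borel_measurable_continuous_onI)
  have [measurable]: "fst \<in> (borel :: ((real^3) \<times> (real^'a)) measure) \<rightarrow>\<^sub>M borel" "snd \<in> (borel :: ((real^3) \<times> (real^'a)) measure) \<rightarrow>\<^sub>M borel"
    by (auto intro!: borel_measurable_continuous_onI continuous_intros)
  note step.IH[measurable]
  show ?case by measurable
qed

lemma open_tests_bounded:
  assumes "f \<in> open_tests \<Omega>"
  shows "\<exists>b. \<forall>x y. \<bar>f x y\<bar> \<le> b"
  using assms unfolding open_tests_def
proof induction
  case zero then show ?case by (intro exI[of _ 0]) simp
next
  case (step f A p c)
  obtain b where b: "\<And>x y. \<bar>f x y\<bar> \<le> b" using step by blast
  obtain d where d: "\<And>y. \<bar>p y\<bar> \<le> d"
    using step periodic_continuous_bcontfun[of p] by (auto simp: bcontfun_def bounded_iff)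
  have "\<bar>f x y + c * (indicator A x * p y)\<bar> \<le> b + \<bar>c\<bar> * d" for x y
  proof -
    have "\<bar>indicator A x * p y\<bar> \<le> d" using d[of y] by (auto simp: indicator_def)
    then have "\<bar>c * (indicator A x * p y)\<bar> \<le> \<bar>c\<bar> * d" unfolding abs_mult[of c] by (intro mult_left_mono) auto
    then show ?thesis using b[of x y] abs_triangle_ineq[of "f x y" "c * (indicator A x * p y)"] by linarith
  qed
  then show ?case by blast
qed

lemma open_tests_support:
  assumes "f \<in> open_tests \<Omega>" "x \<notin> \<Omega>"
  shows "f x y = 0"
  using assms(1) unfolding open_tests_def
  by induction (use assms(2) in \<open>auto simp: indicator_def\<close>)

lemma open_tests_periodic:
  assumes "f \<in> open_tests \<Omega>"
  shows "f x (frac_part y) = f x y"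
  using assms unfolding open_tests_def
  by induction (auto simp: periodic_frac_part)

lemma integrable_product_cell:
  fixes \<Omega> :: "(real^3) set" and F :: "(real^3) \<times> (real^'m) \<Rightarrow> real"
  assumes [measurable]: "\<Omega> \<in> sets borel" and fin: "emeasure lborel \<Omega> < \<infinity>"
    and [measurable]: "F \<in> borel_measurable borel" and b: "\<And>z. \<bar>F z\<bar> \<le> b"
    and 0: "\<And>x y. x \<notin> \<Omega> \<Longrightarrow> F (x, y) = 0"
  shows "integrable lborel (\<lambda>z. indicator half_open_cell (snd z) * F z)"
proof -
  have "integrable lborel (\<lambda>z. indicator (\<Omega> \<times> half_open_cell) z * F z)"
  proof (rule integrable_indicator_bounded(1)[OF _ _ _ b])
    show "emeasure lborel (\<Omega> \<times> (half_open_cell :: (real^'m) set)) < \<infinity>"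
      using fin by (subst emeasure_lborel_Times) auto
  qed (auto intro: borel_Times)
  moreover have "indicator (\<Omega> \<times> half_open_cell) z * F z = indicator half_open_cell (snd z) * F z" for z
    using 0[of "fst z" "snd z"] by (cases z) (auto simp: indicator_def)
  ultimately show ?thesis by simp
qed

lemma product_cell_integral:
  fixes A :: "(real^3) set" and p :: "real^'m \<Rightarrow> real"
  assumes A: "open A" "emeasure lborel A < \<infinity>" and p: "periodic p" "continuous_on UNIV p"
  shows "(LINT z|lborel. indicator half_open_cell (snd z) * (indicator A (fst z) * p (snd z)))
    = measure lborel A * cell_mean p"
    and "integrable lborel (\<lambda>z. indicator half_open_cell (snd z) * (indicator A (fst z) * p (snd z)))"
proof -
  have Am: "A \<in> sets borel" using A by simp
  have "(\<lambda>x y. 0 + 1 * (indicator A x * p y)) \<in> open_tests A"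
    unfolding open_tests_def using A p by (intro step_tests.intros) auto
  then have t: "(\<lambda>x y. indicator A x * p y) \<in> open_tests A" by simp
  obtain b where b: "\<And>x y. \<bar>indicator A x * p y\<bar> \<le> b" using open_tests_bounded[OF t] by blast
  show int: "integrable lborel (\<lambda>z. indicator half_open_cell (snd z) * (indicator A (fst z) * p (snd z)))"
    by (rule integrable_product_cell[OF Am A(2) open_tests_measurable[OF t] b]) simp
  have "(LINT z|lborel. indicator half_open_cell (snd z) * (indicator A (fst z) * p (snd z)))
      = (LINT x|lborel. LINT y|lborel. indicator half_open_cell y * (indicator A x * p y))"
    using lborel_pair.integral_fst'[of "\<lambda>z. indicator half_open_cell (snd z) * (indicator A (fst z) * p (snd z))"] int
    by (simp add: lborel_prod)
  also have "\<dots> = (LINT x|lborel. indicator A x * cell_mean p)"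
  proof (rule Bochner_Integration.integral_cong[OF refl])
    fix x :: "real^3"
    have "(LINT y|lborel. indicator half_open_cell y * (indicator A x * p y)) = (LINT y|lborel. indicator A x * (indicator half_open_cell y * p y))"
      by (simp add: mult_ac)
    then show "(LINT y|lborel. indicator half_open_cell y * (indicator A x * p y)) = indicator A x * cell_mean p"
      by (simp add: cell_mean_def)
  qed
  also have "\<dots> = measure lborel A * cell_mean p" by simp
  finally show "(LINT z|lborel. indicator half_open_cell (snd z) * (indicator A (fst z) * p (snd z)))
    = measure lborel A * cell_mean p" .
qed

text \<open>
  The fast variable, a point of the plane that \<open>R\<close> spans in the torus.
\<close>
definition fast :: "real^3^'m \<Rightarrow> real \<Rightarrow> real^3 \<Rightarrow> real^'m" where
  "fast R \<eta> x = (1 / \<eta>) *\<^sub>R (R *v x)"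

lemma continuous_fast: "continuous_on S (fast R \<eta>)"
  unfolding fast_def by (intro continuous_intros matrix_vector_mult_linear_continuous_on)

lemma open_tests_fast_measurable:
  assumes "f \<in> open_tests \<Omega>"
  shows "(\<lambda>x. f x (fast R \<eta> x)) \<in> borel_measurable borel"
proof -
  have "(\<lambda>x. (x, fast R \<eta> x)) \<in> borel_measurable borel"
    by (intro borel_measurable_continuous_onI continuous_intros continuous_fast)
  from measurable_compose[OF this open_tests_measurable[OF assms]] show ?thesis by simp
qed

lemma open_tests_fast_integrable:
  assumes \<Omega>: "open \<Omega>" "emeasure lborel \<Omega> < \<infinity>" and f: "f \<in> open_tests \<Omega>"
  shows "integrable lborel (\<lambda>x. f x (fast R \<eta> x))"
proof -
  obtain b where "\<And>x y. \<bar>f x y\<bar> \<le> b" using open_tests_bounded[OF f] by blast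
  then have "integrable lborel (\<lambda>x. indicator \<Omega> x * f x (fast R \<eta> x))"
    using \<Omega> open_tests_fast_measurable[OF f] by (intro integrable_indicator_bounded(1)[of _ _ b]) auto
  moreover have "indicator \<Omega> x * f x (fast R \<eta> x) = f x (fast R \<eta> x)" for x
    using open_tests_support[OF f, of x] by (auto simp: indicator_def)
  ultimately show ?thesis by simp
qed

lemma open_tests_cell_integrable:
  assumes \<Omega>: "open \<Omega>" "emeasure lborel \<Omega> < \<infinity>" and f: "f \<in> open_tests \<Omega>"
  shows "integrable lborel (\<lambda>z. indicator half_open_cell (snd z) * f (fst z) (snd z))"
proof -
  obtain b where b: "\<And>x y. \<bar>f x y\<bar> \<le> b" using open_tests_bounded[OF f] by blast
  show ?thesis
    by (rule integrable_product_cell[OF _ \<Omega>(2) open_tests_measurable[OF f] b])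
      (use \<Omega> open_tests_support[OF f] in auto)
qed

text \<open>
  Equidistribution with a slow variable. Applied to squares, it turns the \<open>L\<^sup>2\<close> norms along the fast
  variable into the norm on the product.
\<close>
lemma open_tests_mean_value:
  fixes R :: "real^3^'m"
  assumes \<Omega>: "open \<Omega>" "emeasure lborel \<Omega> < \<infinity>" and R: "nonresonant R"
    and \<eta>: "\<And>n. \<eta> n > 0" "\<eta> \<longlonglongrightarrow> 0" and f: "f \<in> open_tests \<Omega>"
  shows "(\<lambda>n. LINT x|lborel. f x (fast R (\<eta> n) x))
    \<longlonglongrightarrow> (LINT z|lborel. indicator half_open_cell (snd z) * f (fst z) (snd z))"
  using f[unfolded open_tests_def]
proof induction
  case zero then show ?case by simp
next
  case (step f A p c)
  have A: "open A" "A \<subseteq> \<Omega>" and p: "periodic p" "continuous_on UNIV p" using step by auto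
  have Af: "emeasure lborel A < \<infinity>"
    using emeasure_mono[of A \<Omega> lborel] A \<Omega> by (auto intro: le_less_trans)
  have fo: "f \<in> open_tests \<Omega>" using step by (simp add: open_tests_def)
  have "(\<lambda>x y. 0 + 1 * (indicator A x * p y)) \<in> open_tests \<Omega>"
    unfolding open_tests_def using A p by (intro step_tests.intros) auto
  then have t: "(\<lambda>x y. indicator A x * p y) \<in> open_tests \<Omega>" by simp
  have "(\<lambda>n. (LINT x|lborel. f x (fast R (\<eta> n) x)) + c * (LINT x|lborel. indicator A x * p (fast R (\<eta> n) x)))
      \<longlonglongrightarrow> (LINT z|lborel. indicator half_open_cell (snd z) * f (fst z) (snd z)) + c * (measure lborel A * cell_mean p)"
    unfolding fast_def by (intro tendsto_intros step.IH[unfolded fast_def] equidistribution R \<eta> A Af p)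
  moreover have "(LINT x|lborel. f x (fast R (\<eta> n) x) + c * (indicator A x * p (fast R (\<eta> n) x)))
      = (LINT x|lborel. f x (fast R (\<eta> n) x)) + c * (LINT x|lborel. indicator A x * p (fast R (\<eta> n) x))" for n
    using open_tests_fast_integrable[OF \<Omega> fo] open_tests_fast_integrable[OF \<Omega> t] by simp
  moreover have "(LINT z|lborel. indicator half_open_cell (snd z) * (f (fst z) (snd z) + c * (indicator A (fst z) * p (snd z))))
      = (LINT z|lborel. indicator half_open_cell (snd z) * f (fst z) (snd z)) + c * (measure lborel A * cell_mean p)"
  proof -
    have "(LINT z|lborel. indicator half_open_cell (snd z) * (f (fst z) (snd z) + c * (indicator A (fst z) * p (snd z))))
      = (LINT z|lborel. indicator half_open_cell (snd z) * f (fst z) (snd z)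
          + c * (indicator half_open_cell (snd z) * (indicator A (fst z) * p (snd z))))"
      by (simp add: algebra_simps)
    then show ?thesis
      using open_tests_cell_integrable[OF \<Omega> fo] product_cell_integral[OF A(1) Af p] by simp
  qed
  ultimately show ?case by simp
qed

section \<open>Density of the step functions\<close>

text \<open>
  Distance at most \<open>e\<close>, as a squared norm, in \<open>L\<^sup>2(\<Omega>, C(Y))\<close>. The supremum over \<open>y\<close> is
  replaced by a measurable majorant \<open>g\<close>, since a difference of two Borel functions with values in
  the nonseparable space of bounded continuous functions need not be Borel.
\<close>
definition L2_close :: "(real^3) set \<Rightarrow> (real^3 \<Rightarrow> real^'m \<Rightarrow> real) \<Rightarrow> (real^3 \<Rightarrow> real^'m \<Rightarrow> real) \<Rightarrow> real \<Rightarrow> bool" where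
  "L2_close \<Omega> \<phi> \<psi> e \<longleftrightarrow> (\<exists>g. g \<in> borel_measurable (lebesgue_on \<Omega>) \<and> integrable (lebesgue_on \<Omega>) (\<lambda>x. (g x)\<^sup>2) \<and>
      (LINT x|lebesgue_on \<Omega>. (g x)\<^sup>2) \<le> e \<and> (\<forall>x\<in>\<Omega>. \<forall>y. \<bar>\<phi> x y - \<psi> x y\<bar> \<le> g x))"

lemma L2_close_combine:
  assumes "L2_close \<Omega> \<phi> \<psi> a" "L2_close \<Omega> \<phi>' \<psi>' b"
    and le: "\<And>x y. x \<in> \<Omega> \<Longrightarrow> \<bar>\<Phi> x y - \<Psi> x y\<bar> \<le> \<bar>\<phi> x y - \<psi> x y\<bar> + \<bar>\<phi>' x y - \<psi>' x y\<bar>"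
    and "2 * a + 2 * b \<le> e"
  shows "L2_close \<Omega> \<Phi> \<Psi> e"
proof -
  obtain g where g: "g \<in> borel_measurable (lebesgue_on \<Omega>)" "integrable (lebesgue_on \<Omega>) (\<lambda>x. (g x)\<^sup>2)"
    "(LINT x|lebesgue_on \<Omega>. (g x)\<^sup>2) \<le> a" "\<And>x y. x \<in> \<Omega> \<Longrightarrow> \<bar>\<phi> x y - \<psi> x y\<bar> \<le> g x"
    using assms(1) unfolding L2_close_def by blast
  obtain h where h: "h \<in> borel_measurable (lebesgue_on \<Omega>)" "integrable (lebesgue_on \<Omega>) (\<lambda>x. (h x)\<^sup>2)"
    "(LINT x|lebesgue_on \<Omega>. (h x)\<^sup>2) \<le> b" "\<And>x y. x \<in> \<Omega> \<Longrightarrow> \<bar>\<phi>' x y - \<psi>' x y\<bar> \<le> h x"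
    using assms(2) unfolding L2_close_def by blast
  have i: "integrable (lebesgue_on \<Omega>) (\<lambda>x. (g x + h x)\<^sup>2)"
    by (rule integrable_add_L2) (use g h in auto)
  have "(LINT x|lebesgue_on \<Omega>. (g x + h x)\<^sup>2) \<le> (LINT x|lebesgue_on \<Omega>. 2 * (g x)\<^sup>2 + 2 * (h x)\<^sup>2)"
  proof (rule Bochner_Integration.integral_mono[OF i])
    show "(g x + h x)\<^sup>2 \<le> 2 * (g x)\<^sup>2 + 2 * (h x)\<^sup>2" for x
      using sum_squares_bound[of "g x" "h x"] by (simp add: power2_sum)
  qed (use g h in auto)
  also have "\<dots> \<le> e" using g h assms(4) by simp
  finally have "(LINT x|lebesgue_on \<Omega>. (g x + h x)\<^sup>2) \<le> e" .
  moreover have "\<bar>\<Phi> x y - \<Psi> x y\<bar> \<le> g x + h x" if "x \<in> \<Omega>" for x y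
    using le[OF that, of y] g(4)[OF that, of y] h(4)[OF that, of y] by linarith
  ultimately show ?thesis
    unfolding L2_close_def using i g(1) h(1) by (intro exI[of _ "\<lambda>x. g x + h x"]) auto
qed

lemma indicator_close:
  fixes d :: "(real^'m) \<Rightarrow>\<^sub>C real"
  assumes E: "E \<in> sets lebesgue" and A: "A \<in> sets lebesgue" and \<Omega>: "\<Omega> \<in> sets lebesgue" and sub: "E \<subseteq> \<Omega>" "A \<subseteq> \<Omega>"
    and fin: "emeasure lebesgue \<Omega> < \<infinity>" and e: "(norm d)\<^sup>2 * measure lebesgue (sym_diff E A) \<le> e"
  shows "L2_close \<Omega> (\<lambda>x y. indicator E x * apply_bcontfun d y) (\<lambda>x y. indicator A x * apply_bcontfun d y) e"
proof -
  have D: "sym_diff E A \<in> sets lebesgue" using E A by (intro sets.Un sets.Diff)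
  then have D': "sym_diff E A \<in> sets (lebesgue_on \<Omega>)"
    using sub \<Omega> by (subst sets_restrict_space_iff) auto
  have "emeasure (lebesgue_on \<Omega>) (sym_diff E A) \<le> emeasure (lebesgue_on \<Omega>) \<Omega>"
    using sub \<Omega> by (intro emeasure_mono) (auto simp: sets_restrict_space_iff)
  also have "\<dots> < \<infinity>" using fin \<Omega> by (subst emeasure_restrict_space) auto
  finally have Df: "emeasure (lebesgue_on \<Omega>) (sym_diff E A) < \<infinity>" .
  have sq: "(norm d * indicator (sym_diff E A) x)\<^sup>2 = (norm d)\<^sup>2 * indicator (sym_diff E A) x" for x
    by (auto simp: indicator_def)
  have "measure (lebesgue_on \<Omega>) (sym_diff E A) = measure lebesgue (sym_diff E A)"
    using sub \<Omega> by (intro measure_restrict_space) auto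
  then show ?thesis unfolding L2_close_def
  proof (intro exI[of _ "\<lambda>x. norm d * indicator (sym_diff E A) x"] conjI ballI allI)
    show "(\<lambda>x. norm d * indicator (sym_diff E A) x) \<in> borel_measurable (lebesgue_on \<Omega>)"
      using D' by (intro borel_measurable_times borel_measurable_indicator) auto
    show "integrable (lebesgue_on \<Omega>) (\<lambda>x. (norm d * indicator (sym_diff E A) x)\<^sup>2)"
      unfolding sq using D' Df by (intro integrable_mult_right integrable_real_indicator)
    assume m: "measure (lebesgue_on \<Omega>) (sym_diff E A) = measure lebesgue (sym_diff E A)"
    have "(LINT x|lebesgue_on \<Omega>. (norm d * indicator (sym_diff E A) x)\<^sup>2) = (norm d)\<^sup>2 * measure (lebesgue_on \<Omega>) (sym_diff E A \<inter> \<Omega>)"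
      unfolding sq by simp
    also have "sym_diff E A \<inter> \<Omega> = sym_diff E A" using sub by blast
    finally show "(LINT x|lebesgue_on \<Omega>. (norm d * indicator (sym_diff E A) x)\<^sup>2) \<le> e" using e m by simp
    fix x y
    show "\<bar>indicator E x * apply_bcontfun d y - indicator A x * apply_bcontfun d y\<bar> \<le> norm d * indicator (sym_diff E A) x"
      using norm_bounded[of d y] by (auto simp: indicator_def)
  qed
qed

lemma step_approximable_sum:
  fixes E :: "nat \<Rightarrow> (real^3) set"
  assumes "open \<Omega>" and \<Omega>: "emeasure lborel \<Omega> < \<infinity>"
    and E: "\<And>j. j < N \<Longrightarrow> E j \<in> sets lebesgue" "\<And>j. j < N \<Longrightarrow> E j \<subseteq> \<Omega>" and "e > 0"
  shows "\<exists>f\<in>trig_tests \<Omega>. L2_close \<Omega> (\<lambda>x (y::real^'m). \<Sum>j<N. indicator (E j) x * apply_bcontfun (trig_seq j) y) f e"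
  using E \<open>e > 0\<close>
proof (induction N arbitrary: e)
  case 0
  then show ?case
    by (intro bexI[of _ "\<lambda>x y. 0"])
      (auto simp: L2_close_def trig_tests_def step_tests.zero intro!: exI[of _ "\<lambda>x. 0"])
next
  case (Suc N)
  have "\<exists>f\<in>trig_tests \<Omega>. L2_close \<Omega> (\<lambda>x (y::real^'m). \<Sum>j<N. indicator (E j) x * apply_bcontfun (trig_seq j) y) f (e / 4)"
    by (rule Suc.IH) (use Suc.prems in auto)
  then obtain f where f: "f \<in> trig_tests \<Omega>" "L2_close \<Omega> (\<lambda>x (y::real^'m). \<Sum>j<N. indicator (E j) x * apply_bcontfun (trig_seq j) y) f (e / 4)"
    by blast
  define d where "d = (trig_seq N :: (real^'m) \<Rightarrow>\<^sub>C real)"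
  define \<epsilon> where "\<epsilon> = e / 4 / ((norm d)\<^sup>2 + 1)"
  have p: "(norm d)\<^sup>2 + 1 > 0" by (simp add: add_nonneg_pos)
  then have "\<epsilon> > 0" using Suc.prems by (simp add: \<epsilon>_def)
  obtain A where A: "A \<in> basic_opens \<Omega>" "measure lebesgue (sym_diff (E N) A) < \<epsilon>"
    using basic_opens_approx[OF \<open>open \<Omega>\<close> \<Omega> _ _ \<open>\<epsilon> > 0\<close>, of "E N"] Suc.prems by blast
  have Ao: "open A" "A \<subseteq> \<Omega>" using basic_opensD[OF \<open>open \<Omega>\<close> A(1)] by auto
  have "(norm d)\<^sup>2 * measure lebesgue (sym_diff (E N) A) \<le> ((norm d)\<^sup>2 + 1) * \<epsilon>"
    using A(2) p by (intro mult_mono) auto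
  also have "\<dots> = e / 4" using p nonzero_eq_divide_eq[of "(norm d)\<^sup>2 + 1" \<epsilon> "e / 4"] by (simp add: \<epsilon>_def mult.commute)
  finally have "L2_close \<Omega> (\<lambda>x y. indicator (E N) x * apply_bcontfun d y) (\<lambda>x y. indicator A x * apply_bcontfun d y) (e / 4)"
    by (intro indicator_close) (use Suc.prems Ao \<open>open \<Omega>\<close> \<Omega> in auto)
  then have "L2_close \<Omega> (\<lambda>x (y::real^'m). \<Sum>j<Suc N. indicator (E j) x * apply_bcontfun (trig_seq j) y)
      (\<lambda>x y. f x y + 1 * (indicator A x * apply_bcontfun d y)) e"
    by (rule L2_close_combine[OF f(2)]) (simp_all add: d_def)
  moreover have "(\<lambda>x y. f x y + 1 * (indicator A x * apply_bcontfun d y)) \<in> trig_tests \<Omega>"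
    using f(1) A(1) unfolding trig_tests_def d_def by (intro step_tests.step) auto
  ultimately show ?case by blast
qed

text \<open>
  Where \<open>\<phi>\<close> is within \<open>\<delta>\<close> of one of the first \<open>N\<close> trigonometric polynomials it is replaced by the
  first of them, elsewhere by zero; the rest is small because \<open>\<phi>\<close> is square integrable.
\<close>
lemma trig_tests_dense:
  fixes \<phi> :: "real^3 \<Rightarrow> (real^'m) \<Rightarrow>\<^sub>C real"
  assumes "open \<Omega>" and \<Omega>: "emeasure lborel \<Omega> < \<infinity>" and \<phi>: "\<phi> \<in> L2_C_periodic \<Omega>" and "e > 0"
  obtains f where "f \<in> trig_tests \<Omega>" "L2_close \<Omega> (\<lambda>x. apply_bcontfun (\<phi> x)) f e"
proof -
  let ?M = "lebesgue_on \<Omega>"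
  note \<phi>' = L2_C_periodicD[OF \<phi>]
  have \<Omega>l: "\<Omega> \<in> sets lebesgue" using \<open>open \<Omega>\<close> by simp
  have finM: "finite_measure ?M"
  proof (rule finite_measure_lebesgue_on)
    have "emeasure lebesgue \<Omega> < \<infinity>" using \<Omega> \<open>open \<Omega>\<close> by simp
    then show "\<Omega> \<in> lmeasurable" using \<Omega>l unfolding fmeasurable_def by blast
  qed
  define m where "m = measure ?M \<Omega>"
  define \<delta> where "\<delta> = sqrt (e / 8 / (m + 1))"
  have m0: "0 \<le> m" by (simp add: m_def)
  have \<delta>0: "\<delta> > 0" using \<open>e > 0\<close> m0 by (simp add: \<delta>_def)
  have "\<delta>\<^sup>2 * m \<le> \<delta>\<^sup>2 * (m + 1)" by (intro mult_left_mono) auto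
  also have "\<delta>\<^sup>2 * (m + 1) = e / 8"
  proof -
    have "\<delta>\<^sup>2 = e / 8 / (m + 1)" using \<open>e > 0\<close> m0 by (simp add: \<delta>_def)
    then show ?thesis using m0 nonzero_eq_divide_eq[of "m + 1" "\<delta>\<^sup>2" "e / 8"] by linarith
  qed
  finally have \<delta>m: "\<delta>\<^sup>2 * m \<le> e / 8" .
  define j where "j x = trig_index \<delta> (\<phi> x)" for x
  have jm[measurable]: "j \<in> ?M \<rightarrow>\<^sub>M count_space UNIV"
    unfolding j_def by (rule trig_index_measurable[OF \<phi>'(2)])
  have jx: "norm (\<phi> x - trig_seq (j x)) < \<delta>" if "x \<in> \<Omega>" for x
    unfolding j_def by (intro norm_trig_index \<phi>'(1) that \<delta>0)
  have nm[measurable]: "(\<lambda>x. norm (\<phi> x)) \<in> borel_measurable ?M"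
    by (rule measurable_compose[OF \<phi>'(2)]) (intro borel_measurable_continuous_onI continuous_intros)
  define tail where "tail N x = (if j x < N then 0 else (norm (\<phi> x))\<^sup>2)" for N x
  have tm[measurable]: "tail N \<in> borel_measurable ?M" for N unfolding tail_def by measurable
  have "(\<lambda>N. LINT x|?M. tail N x) \<longlonglongrightarrow> (LINT x|?M. 0)"
  proof (rule integral_dominated_convergence[where w = "\<lambda>x. (norm (\<phi> x))\<^sup>2"])
    show "AE x in ?M. (\<lambda>N. tail N x) \<longlonglongrightarrow> 0"
    proof (rule AE_I2)
      fix x
      have "eventually (\<lambda>N. tail N x = 0) sequentially"
        by (intro eventually_sequentiallyI[of "Suc (j x)"]) (simp add: tail_def)
      then show "(\<lambda>N. tail N x) \<longlonglongrightarrow> 0" by (rule tendsto_eventually)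
    qed
  qed (use \<phi>'(3) in \<open>auto simp: tail_def\<close>)
  then obtain N where "norm ((LINT x|?M. tail N x) - (LINT x|?M. 0)) < e / 8"
    using LIMSEQ_D[of _ _ "e / 8"] \<open>e > 0\<close> by (metis divide_pos_pos order_refl zero_less_numeral)
  then have N: "(LINT x|?M. tail N x) \<le> e / 8" by simp
  define E where "E i = {x \<in> space ?M. j x = i}" for i
  have E: "E i \<in> sets lebesgue" "E i \<subseteq> \<Omega>" for i
  proof -
    have "E i \<in> sets ?M" unfolding E_def by measurable
    then show "E i \<in> sets lebesgue" "E i \<subseteq> \<Omega>" using \<Omega>l by (auto simp: sets_restrict_space_iff)
  qed
  have sumE: "(\<Sum>i<N. indicator (E i) x * apply_bcontfun (trig_seq i) y) = (if j x < N then apply_bcontfun (trig_seq (j x)) y else 0)"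
    if "x \<in> \<Omega>" for x and y :: "real^'m"
  proof -
    have "(\<Sum>i<N. indicator (E i) x * apply_bcontfun (trig_seq i) y) = (\<Sum>i<N. if j x = i then apply_bcontfun (trig_seq i) y else 0)"
      using that by (intro sum.cong) (auto simp: E_def indicator_def)
    then show ?thesis by simp
  qed
  define g where "g x = (if j x < N then \<delta> else norm (\<phi> x))" for x
  have gm[measurable]: "g \<in> borel_measurable ?M" unfolding g_def by measurable
  have g_le: "(g x)\<^sup>2 \<le> \<delta>\<^sup>2 + tail N x" for x by (simp add: g_def tail_def)
  have ti: "integrable ?M (tail N)"
    by (rule Bochner_Integration.integrable_bound[OF \<phi>'(3)]) (auto simp: tail_def)
  have ci: "integrable ?M (\<lambda>x. \<delta>\<^sup>2)" using finM by (simp add: finite_measure.integrable_const)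
  have gi: "integrable ?M (\<lambda>x. (g x)\<^sup>2)"
    by (rule Bochner_Integration.integrable_bound[OF Bochner_Integration.integrable_add[OF ci ti]])
      (use g_le in \<open>auto intro: order_trans[OF _ abs_ge_self]\<close>)
  have "(LINT x|?M. (g x)\<^sup>2) \<le> (LINT x|?M. \<delta>\<^sup>2 + tail N x)"
    by (intro Bochner_Integration.integral_mono gi Bochner_Integration.integrable_add ci ti g_le)
  also have "\<dots> = \<delta>\<^sup>2 * m + (LINT x|?M. tail N x)"
    using ci ti by (simp add: m_def mult.commute)
  also have "\<dots> \<le> e / 4" using \<delta>m N by simp
  finally have gi4: "(LINT x|?M. (g x)\<^sup>2) \<le> e / 4" .
  have close1: "L2_close \<Omega> (\<lambda>x. apply_bcontfun (\<phi> x)) (\<lambda>x y. \<Sum>i<N. indicator (E i) x * apply_bcontfun (trig_seq i) y) (e / 4)"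
    unfolding L2_close_def
  proof (intro exI[of _ g] conjI ballI allI gm gi gi4)
    fix x and y :: "real^'m" assume x: "x \<in> \<Omega>"
    show "\<bar>apply_bcontfun (\<phi> x) y - (\<Sum>i<N. indicator (E i) x * apply_bcontfun (trig_seq i) y)\<bar> \<le> g x"
      using norm_bounded[of "\<phi> x - trig_seq (j x)" y] norm_bounded[of "\<phi> x" y] jx[OF x]
      by (auto simp: sumE[OF x] g_def)
  qed
  have "\<exists>f\<in>trig_tests \<Omega>. L2_close \<Omega> (\<lambda>x (y::real^'m). \<Sum>i<N. indicator (E i) x * apply_bcontfun (trig_seq i) y) f (e / 4)"
    by (rule step_approximable_sum[OF \<open>open \<Omega>\<close> \<Omega> E]) (use \<open>e > 0\<close> in auto)
  then obtain f where f: "f \<in> trig_tests \<Omega>" "L2_close \<Omega> (\<lambda>x (y::real^'m). \<Sum>i<N. indicator (E i) x * apply_bcontfun (trig_seq i) y) f (e / 4)"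
    by blast
  have "L2_close \<Omega> (\<lambda>x. apply_bcontfun (\<phi> x)) f e"
    by (rule L2_close_combine[OF close1 f(2)]) (auto intro: abs_triangle_ineq4 simp: abs_diff_triangle_ineq)
  then show thesis using that f(1) by blast
qed

section \<open>Weak two-scale compactness\<close>

lemma finite_measure_lebesgue_on_open:
  assumes "open \<Omega>" "emeasure lborel \<Omega> < \<infinity>"
  shows "finite_measure (lebesgue_on \<Omega>)"
proof (rule finite_measure_lebesgue_on)
  have "emeasure lebesgue \<Omega> < \<infinity>" "\<Omega> \<in> sets lebesgue" using assms by auto
  then show "\<Omega> \<in> lmeasurable" unfolding fmeasurable_def by blast
qed

lemma L2_on_realD:
  fixes u :: "'a::euclidean_space \<Rightarrow> real"
  assumes "u \<in> L2_on \<Omega>"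
  shows "u \<in> borel_measurable (lebesgue_on \<Omega>)" "integrable (lebesgue_on \<Omega>) (\<lambda>x. (u x)\<^sup>2)"
  using assms by (auto simp: L2_on_def)

lemma open_tests_fast_L2:
  assumes \<Omega>: "open \<Omega>" "emeasure lborel \<Omega> < \<infinity>" and f: "f \<in> open_tests \<Omega>"
  shows "(\<lambda>x. f x (fast R \<eta> x)) \<in> borel_measurable (lebesgue_on \<Omega>)"
    and "integrable (lebesgue_on \<Omega>) (\<lambda>x. (f x (fast R \<eta> x))\<^sup>2)"
    and "(LINT x|lebesgue_on \<Omega>. (f x (fast R \<eta> x))\<^sup>2) = (LINT x|lborel. (f x (fast R \<eta> x))\<^sup>2)"
proof -
  have \<Omega>b: "\<Omega> \<in> sets borel" using \<Omega> by simp
  have m: "(\<lambda>x. f x (fast R \<eta> x)) \<in> borel_measurable borel" by (rule open_tests_fast_measurable[OF f])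
  then have m2: "(\<lambda>x. (f x (fast R \<eta> x))\<^sup>2) \<in> borel_measurable borel" by measurable
  have i: "integrable lborel (\<lambda>x. (f x (fast R \<eta> x))\<^sup>2)"
    using open_tests_fast_integrable[OF \<Omega> open_tests_mult[OF f f]] by (simp add: power2_eq_square)
  have s: "indicator \<Omega> x *\<^sub>R (f x (fast R \<eta> x))\<^sup>2 = (f x (fast R \<eta> x))\<^sup>2" for x
    using open_tests_support[OF f, of x] by (auto simp: indicator_def)
  show "(\<lambda>x. f x (fast R \<eta> x)) \<in> borel_measurable (lebesgue_on \<Omega>)"
    by (rule lebesgue_on_borel(1)[OF m \<Omega>b])
  show "integrable (lebesgue_on \<Omega>) (\<lambda>x. (f x (fast R \<eta> x))\<^sup>2)"
    unfolding lebesgue_on_borel(2)[OF m2 \<Omega>b] s by (rule i)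
  show "(LINT x|lebesgue_on \<Omega>. (f x (fast R \<eta> x))\<^sup>2) = (LINT x|lborel. (f x (fast R \<eta> x))\<^sup>2)"
    unfolding lebesgue_on_borel(3)[OF m2 \<Omega>b] s ..
qed

lemma step_tests_convergent:
  fixes u :: "nat \<Rightarrow> real^3 \<Rightarrow> real" and R :: "real^3^'m"
  assumes \<Omega>: "open \<Omega>" "emeasure lborel \<Omega> < \<infinity>" and u: "\<And>n. u n \<in> L2_on \<Omega>"
    and conv: "\<And>A j. A \<in> basic_opens \<Omega> \<Longrightarrow>
      convergent (\<lambda>n. LINT x|lebesgue_on \<Omega>. u n x * (indicator A x * apply_bcontfun (trig_seq j) (fast R (\<eta> n) x)))"
    and f: "f \<in> trig_tests \<Omega>"
  shows "convergent (\<lambda>n. LINT x|lebesgue_on \<Omega>. u n x * f x (fast R (\<eta> n) x))"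
  using f[unfolded trig_tests_def]
proof induction
  case zero then show ?case by (simp add: convergent_const)
next
  case (step f A p c)
  obtain j where p: "p = apply_bcontfun (trig_seq j)" using step by blast
  have f: "f \<in> open_tests \<Omega>" using step trig_tests_open_tests[OF \<Omega>(1)] by (auto simp: trig_tests_def)
  have "(\<lambda>x y. 0 + 1 * (indicator A x * p y)) \<in> trig_tests \<Omega>"
    unfolding trig_tests_def using step by (intro step_tests.intros) auto
  then have t: "(\<lambda>x y. indicator A x * p y) \<in> open_tests \<Omega>" using trig_tests_open_tests[OF \<Omega>(1)] by auto
  have i: "integrable (lebesgue_on \<Omega>) (\<lambda>x. u n x * f x (fast R (\<eta> n) x))" if "f \<in> open_tests \<Omega>" for f n
    by (intro integrable_mult_L2 L2_on_realD[OF u] open_tests_fast_L2 \<Omega> that)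
  have "(LINT x|lebesgue_on \<Omega>. u n x * (f x (fast R (\<eta> n) x) + c * (indicator A x * p (fast R (\<eta> n) x))))
      = (LINT x|lebesgue_on \<Omega>. u n x * f x (fast R (\<eta> n) x))
      + c * (LINT x|lebesgue_on \<Omega>. u n x * (indicator A x * p (fast R (\<eta> n) x)))" for n
  proof -
    have "(LINT x|lebesgue_on \<Omega>. u n x * (f x (fast R (\<eta> n) x) + c * (indicator A x * p (fast R (\<eta> n) x))))
      = (LINT x|lebesgue_on \<Omega>. u n x * f x (fast R (\<eta> n) x) + c * (u n x * (indicator A x * p (fast R (\<eta> n) x))))"
      by (simp add: algebra_simps)
    then show ?thesis using i[OF f, of n] i[OF t, of n] by simp
  qed
  moreover have "convergent (\<lambda>n. (LINT x|lebesgue_on \<Omega>. u n x * f x (fast R (\<eta> n) x))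
      + c * (LINT x|lebesgue_on \<Omega>. u n x * (indicator A x * p (fast R (\<eta> n) x))))"
    unfolding p by (intro convergent_add step.IH tendsto_mult_left[THEN convergentI] convergent_mult convergent_const conv step)
  ultimately show ?case by simp
qed

lemma AE_product_cell_iff:
  "AE z in (lborel :: ((real^3) \<times> (real^'m)) measure). snd z \<in> half_open_cell \<longleftrightarrow> snd z \<in> unit_cell"
proof -
  let ?N = "half_open_cell - unit_cell :: (real^'m) set"
  have "AE y in lborel. y \<notin> ?N" using AE_cell_iff by eventually_elim auto
  then have "emeasure lborel ?N = 0" by (simp add: AE_iff_measurable[OF _ refl] set_diff_eq)
  then have "emeasure lborel ((UNIV :: (real^3) set) \<times> ?N) = 0" by (subst emeasure_lborel_Times) auto
  then have "(UNIV :: (real^3) set) \<times> ?N \<in> null_sets lborel"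
    by (intro null_setsI) (auto intro!: borel_Times)
  from AE_not_in[OF this] show ?thesis by eventually_elim (use cell_sandwich in \<open>auto simp: mem_Times_iff\<close>)
qed

lemma test_L2_on_product:
  fixes \<phi> :: "real^3 \<Rightarrow> (real^'m) \<Rightarrow>\<^sub>C real"
  assumes "open \<Omega>" and g: "g \<in> borel_measurable (lebesgue_on \<Omega>)" "integrable (lebesgue_on \<Omega>) (\<lambda>x. (g x)\<^sup>2)"
  shows "(\<lambda>z. g (fst z)) \<in> borel_measurable (lebesgue_on (\<Omega> \<times> (unit_cell :: (real^'m) set)))"
    and "integrable (lebesgue_on (\<Omega> \<times> (unit_cell :: (real^'m) set))) (\<lambda>z. (g (fst z))\<^sup>2)"
    and "(LINT z|lebesgue_on (\<Omega> \<times> (unit_cell :: (real^'m) set)). (g (fst z) :: real)\<^sup>2) = (LINT x|lebesgue_on \<Omega>. (g x)\<^sup>2)"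
proof -
  have \<Omega>l: "\<Omega> \<in> sets lebesgue" using \<open>open \<Omega>\<close> by simp
  note F = fst_measure_preserving[OF \<Omega>l, where 'm = 'm]
  show "(\<lambda>z. g (fst z)) \<in> borel_measurable (lebesgue_on (\<Omega> \<times> (unit_cell :: (real^'m) set)))"
    by (rule measurable_compose[OF F(1) g(1)])
  have g2: "(\<lambda>x. (g x)\<^sup>2) \<in> borel_measurable (lebesgue_on \<Omega>)" using g(1) by measurable
  show "integrable (lebesgue_on (\<Omega> \<times> (unit_cell :: (real^'m) set))) (\<lambda>z. (g (fst z))\<^sup>2)"
    using integrable_distr_eq[OF F(1) g2] g(2) by (simp add: F(2))
  show "(LINT z|lebesgue_on (\<Omega> \<times> (unit_cell :: (real^'m) set)). (g (fst z))\<^sup>2) = (LINT x|lebesgue_on \<Omega>. (g x)\<^sup>2)"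
    using integral_distr[OF F(1) g2] by (simp add: F(2))
qed

lemma abs_apply_bcontfun_le: "\<bar>apply_bcontfun f x\<bar> \<le> norm f" for f :: "'a::topological_space \<Rightarrow>\<^sub>C real"
  using norm_bounded[of f x] by simp

lemma mult_L2_bound:
  fixes u g \<phi> :: "'a \<Rightarrow> real"
  assumes "u \<in> borel_measurable M" "g \<in> borel_measurable M" "\<phi> \<in> borel_measurable M"
    and "integrable M (\<lambda>x. (u x)\<^sup>2)" "integrable M (\<lambda>x. (g x)\<^sup>2)" "\<And>x. x \<in> space M \<Longrightarrow> \<bar>\<phi> x\<bar> \<le> g x"
  shows "integrable M (\<lambda>x. u x * \<phi> x)"
    and "\<bar>LINT x|M. u x * \<phi> x\<bar> \<le> sqrt (LINT x|M. (u x)\<^sup>2) * sqrt (LINT x|M. (g x)\<^sup>2)"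
proof -
  have sq: "(\<phi> x)\<^sup>2 \<le> (g x)\<^sup>2" if "x \<in> space M" for x
    using assms(6)[OF that] by (metis abs_ge_zero power2_abs power_mono)
  have p2: "integrable M (\<lambda>x. (\<phi> x)\<^sup>2)"
    by (rule Bochner_Integration.integrable_bound[OF assms(5)]) (use assms(3) sq in auto)
  show "integrable M (\<lambda>x. u x * \<phi> x)" by (rule integrable_mult_L2) (use assms p2 in auto)
  have "\<bar>LINT x|M. u x * \<phi> x\<bar> \<le> sqrt (LINT x|M. (u x)\<^sup>2) * sqrt (LINT x|M. (\<phi> x)\<^sup>2)"
    by (rule Cauchy_Schwarz_integral) (use assms p2 in auto)
  also have "\<dots> \<le> sqrt (LINT x|M. (u x)\<^sup>2) * sqrt (LINT x|M. (g x)\<^sup>2)"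
    by (intro mult_left_mono real_sqrt_le_mono integral_mono_AE p2 assms(5)) (auto intro: AE_I2 sq)
  finally show "\<bar>LINT x|M. u x * \<phi> x\<bar> \<le> sqrt (LINT x|M. (u x)\<^sup>2) * sqrt (LINT x|M. (g x)\<^sup>2)" .
qed

text \<open>
  The weak two-scale limit of a scalar sequence. Restricted to the cell in \<open>y\<close>, the step tests form
  a subspace of \<open>L\<^sup>2\<close> of the product; the limit functional is well defined on it because a periodic
  function is determined by its values on the cell.
\<close>
lemma two_scale_limit_exists:
  fixes u :: "nat \<Rightarrow> real^3 \<Rightarrow> real" and R :: "real^3^'m"
  assumes \<Omega>: "open \<Omega>" "emeasure lborel \<Omega> < \<infinity>" and R: "nonresonant R"
    and \<eta>: "\<And>n. \<eta> n > 0" "\<eta> \<longlonglongrightarrow> 0"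
    and u: "\<And>n. u n \<in> L2_on \<Omega>" and C: "\<And>n. L2_norm_on \<Omega> (u n) \<le> C"
    and conv: "\<And>A j. A \<in> basic_opens \<Omega> \<Longrightarrow>
      convergent (\<lambda>n. LINT x|lebesgue_on \<Omega>. u n x * (indicator A x * apply_bcontfun (trig_seq j) (fast R (\<eta> n) x)))"
  obtains U :: "(real^3) \<times> (real^'m) \<Rightarrow> real" where
    "U \<in> borel_measurable borel" "integrable lborel (\<lambda>z. (U z)\<^sup>2)" "\<And>z. z \<notin> \<Omega> \<times> half_open_cell \<Longrightarrow> U z = 0"
    "\<And>\<phi>. \<phi> \<in> L2_C_periodic \<Omega> \<Longrightarrow>
      (\<lambda>n. LINT x|lebesgue_on \<Omega>. u n x * apply_bcontfun (\<phi> x) (fast R (\<eta> n) x))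
      \<longlonglongrightarrow> (LINT z|lebesgue_on (\<Omega> \<times> unit_cell). U z * apply_bcontfun (\<phi> (fst z)) (snd z))"
proof -
  let ?Q = "half_open_cell :: (real^'m) set"
  define I where "I n f = (LINT x|lebesgue_on \<Omega>. u n x * f x (fast R (\<eta> n) x))" for n and f :: "real^3 \<Rightarrow> real^'m \<Rightarrow> real"
  define fold where "fold f = (\<lambda>z. indicator ?Q (snd z) * f (fst z) (snd z) :: real)" for f :: "real^3 \<Rightarrow> real^'m \<Rightarrow> real"
  \<comment> \<open>\<open>unfold'\<close> recovers a step test from its restriction \<open>fold f\<close> to the cell; \<open>L\<close> has to be
    defined in terms of the restriction alone.\<close>
  define unfold' where "unfold' g = (\<lambda>x y. g (x, frac_part y) :: real)" for g :: "(real^3) \<times> (real^'m) \<Rightarrow> real"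
  define V where "V = fold ` trig_tests \<Omega>"
  define L where "L g = lim (\<lambda>n. I n (unfold' g))" for g
  note tto = subsetD[OF trig_tests_open_tests[OF \<Omega>(1)]]
  have uf: "unfold' (fold f) = f" if "f \<in> trig_tests \<Omega>" for f
    using open_tests_periodic[OF tto[OF that]]
    by (simp add: unfold'_def fold_def fun_eq_iff frac_part_in_cell)
  have Llim: "(\<lambda>n. I n f) \<longlonglongrightarrow> L (fold f)" if "f \<in> trig_tests \<Omega>" for f
    using step_tests_convergent[OF \<Omega> u conv that]
    by (simp add: L_def uf[OF that] I_def convergent_LIMSEQ_iff)
  have C0: "0 \<le> C" using C[of 0] by (rule order_trans[rotated]) (simp add: L2_norm_on_def)
  have Cu: "sqrt (LINT x|lebesgue_on \<Omega>. (u n x)\<^sup>2) \<le> C" for n using C[of n] by (simp add: L2_norm_on_def)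
  have fold_sq: "(fold f z)\<^sup>2 = indicator ?Q (snd z) * (f (fst z) (snd z) * f (fst z) (snd z))" for f z
    by (simp add: fold_def power2_eq_square indicator_def)
  have Ibound: "\<bar>I n f\<bar> \<le> C * sqrt (LINT x|lborel. f x (fast R (\<eta> n) x) * f x (fast R (\<eta> n) x))"
    if f: "f \<in> trig_tests \<Omega>" for n f
  proof -
    have "\<bar>I n f\<bar> \<le> sqrt (LINT x|lebesgue_on \<Omega>. (u n x)\<^sup>2) * sqrt (LINT x|lebesgue_on \<Omega>. (f x (fast R (\<eta> n) x))\<^sup>2)"
      unfolding I_def by (intro Cauchy_Schwarz_integral L2_on_realD[OF u] open_tests_fast_L2 \<Omega> tto f)
    also have "\<dots> \<le> C * sqrt (LINT x|lebesgue_on \<Omega>. (f x (fast R (\<eta> n) x))\<^sup>2)"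
      by (intro mult_right_mono Cu) simp
    finally show ?thesis
      unfolding open_tests_fast_L2(3)[OF \<Omega> tto[OF f]] by (simp add: power2_eq_square)
  qed
  have foldlin: "fold (\<lambda>x y. f x y + c * g x y) = (\<lambda>z. fold f z + c * fold g z)" for f g c
    by (simp add: fold_def fun_eq_iff algebra_simps)
  have Ilin: "I n (\<lambda>x y. f x y + c * g x y) = I n f + c * I n g" if "f \<in> trig_tests \<Omega>" "g \<in> trig_tests \<Omega>" for n f g c
  proof -
    have i: "integrable (lebesgue_on \<Omega>) (\<lambda>x. u n x * f x (fast R (\<eta> n) x))" if "f \<in> trig_tests \<Omega>" for f
      by (intro integrable_mult_L2 L2_on_realD[OF u] open_tests_fast_L2 \<Omega> tto that)
    have "I n (\<lambda>x y. f x y + c * g x y) = (LINT x|lebesgue_on \<Omega>. u n x * f x (fast R (\<eta> n) x) + c * (u n x * g x (fast R (\<eta> n) x)))"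
      by (simp add: I_def algebra_simps)
    then show ?thesis using i[OF that(1)] i[OF that(2)] by (simp add: I_def)
  qed
  have lin: "(\<lambda>x y. f x y + c * g x y) \<in> trig_tests \<Omega>" if "f \<in> trig_tests \<Omega>" "g \<in> trig_tests \<Omega>" for f g c
    using that unfolding trig_tests_def by (rule step_tests_lin)
  obtain h where h: "h \<in> borel_measurable lborel" "integrable lborel (\<lambda>z. (h z)\<^sup>2)"
    and hL: "\<And>g. g \<in> V \<Longrightarrow> (LINT z|lborel. h z * g z) = L g"
  proof (rule Riesz_representation_L2[of V lborel L C])
    fix g assume "g \<in> V"
    then obtain f where f: "f \<in> trig_tests \<Omega>" "g = fold f" by (auto simp: V_def)
    note fm = open_tests_measurable[OF tto[OF f(1)]]
    have "snd \<in> borel_measurable (borel :: ((real^3) \<times> (real^'m)) measure)"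
      by (intro borel_measurable_continuous_onI continuous_intros)
    then show "g \<in> borel_measurable lborel"
      unfolding f(2) fold_def using fm by (intro borel_measurable_times) (auto intro: measurable_compose)
    show "integrable lborel (\<lambda>z. (g z)\<^sup>2)"
      unfolding f(2) fold_sq by (rule open_tests_cell_integrable[OF \<Omega> open_tests_mult[OF tto[OF f(1)] tto[OF f(1)]]])
    have "(\<lambda>n. \<bar>I n f\<bar>) \<longlonglongrightarrow> \<bar>L g\<bar>" unfolding f(2) by (intro tendsto_rabs Llim f)
    moreover have "(\<lambda>n. C * sqrt (LINT x|lborel. f x (fast R (\<eta> n) x) * f x (fast R (\<eta> n) x)))
        \<longlonglongrightarrow> C * sqrt (LINT z|lborel. (g z)\<^sup>2)"
      unfolding f(2) fold_sq
      by (intro tendsto_intros open_tests_mean_value[OF \<Omega> R \<eta>, of "\<lambda>x y. f x y * f x y"] open_tests_mult tto f)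
    ultimately show "\<bar>L g\<bar> \<le> C * sqrt (LINT z|lborel. (g z)\<^sup>2)"
      by (rule LIMSEQ_le) (use Ibound[OF f(1)] in blast)
  next
    have "(\<lambda>x y. 0) \<in> trig_tests \<Omega>" unfolding trig_tests_def by (rule step_tests.zero)
    then have "fold (\<lambda>x y. 0) \<in> V" unfolding V_def by blast
    then show "(\<lambda>z. 0) \<in> V" by (simp add: fold_def)
  next
    fix g1 g2 c assume "g1 \<in> V" "g2 \<in> V"
    then obtain f1 f2 where f: "f1 \<in> trig_tests \<Omega>" "g1 = fold f1" "f2 \<in> trig_tests \<Omega>" "g2 = fold f2" by (auto simp: V_def)
    show "(\<lambda>z. g1 z + c * g2 z) \<in> V"
      unfolding V_def f foldlin[symmetric] using lin[OF f(1,3)] by blast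
    have "(\<lambda>n. I n f1 + c * I n f2) \<longlonglongrightarrow> L g1 + c * L g2"
      unfolding f by (intro tendsto_intros Llim f)
    moreover have "(\<lambda>n. I n f1 + c * I n f2) \<longlonglongrightarrow> L (\<lambda>z. g1 z + c * g2 z)"
      using Llim[OF lin[OF f(1,3), of c]] unfolding f foldlin Ilin[OF f(1,3)] .
    ultimately show "L (\<lambda>z. g1 z + c * g2 z) = L g1 + c * L g2" using LIMSEQ_unique by blast
  next
    fix h assume "h \<in> borel_measurable lborel" "integrable lborel (\<lambda>z. (h z)\<^sup>2)"
      "\<And>g. g \<in> V \<Longrightarrow> (LINT z|lborel. h z * g z) = L g"
    then show thesis by (rule that)
  qed
  have \<Omega>b: "\<Omega> \<in> sets borel" using \<Omega> by simp
  have \<Omega>Q: "\<Omega> \<times> ?Q \<in> sets borel" by (intro borel_Times \<Omega>b) simp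
  define U where "U z = indicator (\<Omega> \<times> ?Q) z * h z" for z
  have Um: "U \<in> borel_measurable borel" unfolding U_def using h(1) \<Omega>Q by (intro borel_measurable_times) auto
  have U2: "integrable lborel (\<lambda>z. (U z)\<^sup>2)"
  proof (rule Bochner_Integration.integrable_bound[OF h(2)])
    show "(\<lambda>z. (U z)\<^sup>2) \<in> borel_measurable lborel" using Um by simp
    show "AE z in lborel. norm ((U z)\<^sup>2) \<le> norm ((h z)\<^sup>2)"
      by (rule AE_I2) (simp add: U_def indicator_def)
  qed
  let ?P = "lebesgue_on (\<Omega> \<times> (unit_cell :: (real^'m) set))"
  have \<Omega>Y: "\<Omega> \<times> (unit_cell :: (real^'m) set) \<in> sets borel" by (intro borel_Times \<Omega>b) simp
  have ULP: "U \<in> borel_measurable ?P" by (rule lebesgue_on_borel(1)[OF Um \<Omega>Y])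
  have U2P: "integrable ?P (\<lambda>z. (U z)\<^sup>2)"
  proof -
    have m: "(\<lambda>z. (U z)\<^sup>2) \<in> borel_measurable borel" using Um by measurable
    show ?thesis
      unfolding lebesgue_on_borel(2)[OF m \<Omega>Y]
      using \<Omega>Y by (intro integrable_mult_indicator U2) auto
  qed
  have J: "(LINT z|?P. U z * f (fst z) (snd z)) = L (fold f)" if f: "f \<in> trig_tests \<Omega>" for f
  proof -
    have m: "(\<lambda>z. U z * f (fst z) (snd z)) \<in> borel_measurable borel"
      using Um open_tests_measurable[OF tto[OF f]] by measurable
    have "(LINT z|?P. U z * f (fst z) (snd z)) = (LINT z|lborel. indicator (\<Omega> \<times> unit_cell) z *\<^sub>R (U z * f (fst z) (snd z)))"
      by (rule lebesgue_on_borel(3)[OF m \<Omega>Y])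
    also have "\<dots> = (LINT z|lborel. h z * fold f z)"
    proof (rule integral_cong_AE)
      show "AE z in lborel. indicator (\<Omega> \<times> unit_cell) z *\<^sub>R (U z * f (fst z) (snd z)) = h z * fold f z"
        using AE_product_cell_iff
      proof eventually_elim
        case (elim z)
        then show ?case using open_tests_support[OF tto[OF f], of "fst z" "snd z"]
          by (cases z) (auto simp: U_def fold_def indicator_def)
      qed
      show "(\<lambda>z. indicator (\<Omega> \<times> unit_cell) z *\<^sub>R (U z * f (fst z) (snd z))) \<in> borel_measurable lborel"
        using m \<Omega>Y by (intro borel_measurable_scaleR) auto
      show "(\<lambda>z. h z * fold f z) \<in> borel_measurable lborel"
      proof (rule borel_measurable_times[OF h(1)])
        have "snd \<in> borel_measurable (borel :: ((real^3) \<times> (real^'m)) measure)"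
          by (intro borel_measurable_continuous_onI continuous_intros)
        then show "fold f \<in> borel_measurable lborel"
          unfolding fold_def using open_tests_measurable[OF tto[OF f]]
          by (intro borel_measurable_times) (auto intro: measurable_compose)
      qed
    qed
    also have "\<dots> = L (fold f)" using f by (intro hL) (simp add: V_def)
    finally show ?thesis .
  qed
  have "(\<lambda>n. LINT x|lebesgue_on \<Omega>. u n x * apply_bcontfun (\<phi> x) (fast R (\<eta> n) x))
      \<longlonglongrightarrow> (LINT z|?P. U z * apply_bcontfun (\<phi> (fst z)) (snd z))" if \<phi>: "\<phi> \<in> L2_C_periodic \<Omega>" for \<phi>
  proof (rule LIMSEQ_I)
    fix e :: real assume "e > 0"
    note \<phi>' = L2_C_periodicD[OF \<phi>]
    define D where "D = C + sqrt (LINT z|?P. (U z)\<^sup>2) + 1"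
    have D: "D > 0" "C \<le> D" "sqrt (LINT z|?P. (U z)\<^sup>2) \<le> D" using C0 by (auto simp: D_def intro: add_nonneg_pos)
    define \<epsilon> where "\<epsilon> = e / (4 * D)"
    have \<epsilon>: "\<epsilon> > 0" "D * \<epsilon> = e / 4" using D \<open>e > 0\<close> by (auto simp: \<epsilon>_def)
    obtain f where f: "f \<in> trig_tests \<Omega>" "L2_close \<Omega> (\<lambda>x. apply_bcontfun (\<phi> x)) f (\<epsilon>\<^sup>2)"
      using trig_tests_dense[OF \<Omega> \<phi>, of "\<epsilon>\<^sup>2"] \<epsilon> by auto
    obtain g where g: "g \<in> borel_measurable (lebesgue_on \<Omega>)" "integrable (lebesgue_on \<Omega>) (\<lambda>x. (g x)\<^sup>2)"
      "(LINT x|lebesgue_on \<Omega>. (g x)\<^sup>2) \<le> \<epsilon>\<^sup>2" "\<And>x y. x \<in> \<Omega> \<Longrightarrow> \<bar>apply_bcontfun (\<phi> x) y - f x y\<bar> \<le> g x"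
      using f(2) unfolding L2_close_def by blast
    have g\<epsilon>: "sqrt (LINT x|lebesgue_on \<Omega>. (g x)\<^sup>2) \<le> \<epsilon>"
      using real_sqrt_le_mono[OF g(3)] \<epsilon> by simp
    have \<phi>n: "(\<lambda>x. norm (\<phi> x)) \<in> borel_measurable (lebesgue_on \<Omega>)"
      by (rule measurable_compose[OF \<phi>'(2)]) (intro borel_measurable_continuous_onI continuous_intros)
    have 1: "\<bar>(LINT x|lebesgue_on \<Omega>. u n x * apply_bcontfun (\<phi> x) (fast R (\<eta> n) x)) - I n f\<bar> \<le> e / 4" for n
    proof -
      let ?q = "fast R (\<eta> n)"
      have q: "?q \<in> borel_measurable (lebesgue_on \<Omega>)"
        by (rule lebesgue_on_borel(1)[OF borel_measurable_continuous_onI[OF continuous_fast] \<Omega>b])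
      have \<phi>m: "(\<lambda>x. apply_bcontfun (\<phi> x) (?q x)) \<in> borel_measurable (lebesgue_on \<Omega>)"
        by (rule measurable_eval_periodic[OF \<phi>'(2) _ q]) (use \<phi>'(1) in auto)
      have i\<phi>: "integrable (lebesgue_on \<Omega>) (\<lambda>x. u n x * apply_bcontfun (\<phi> x) (?q x))"
        by (rule mult_L2_bound(1)[OF L2_on_realD(1)[OF u] \<phi>n \<phi>m L2_on_realD(2)[OF u] \<phi>'(3)])
          (rule abs_apply_bcontfun_le)
      have f_int: "integrable (lebesgue_on \<Omega>) (\<lambda>x. u n x * f x (?q x))"
        by (intro integrable_mult_L2 L2_on_realD[OF u] open_tests_fast_L2 \<Omega> tto f)
      have "(LINT x|lebesgue_on \<Omega>. u n x * apply_bcontfun (\<phi> x) (?q x)) - I n f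
          = (LINT x|lebesgue_on \<Omega>. u n x * (apply_bcontfun (\<phi> x) (?q x) - f x (?q x)))"
        using i\<phi> f_int by (simp add: I_def right_diff_distrib)
      also have "\<bar>\<dots>\<bar> \<le> sqrt (LINT x|lebesgue_on \<Omega>. (u n x)\<^sup>2) * sqrt (LINT x|lebesgue_on \<Omega>. (g x)\<^sup>2)"
        by (rule mult_L2_bound(2)[OF L2_on_realD(1)[OF u] g(1) _ L2_on_realD(2)[OF u] g(2)])
          (use g(4) \<phi>m open_tests_fast_L2(1)[OF \<Omega> tto[OF f(1)]] in auto)
      also have "\<dots> \<le> D * \<epsilon>"
        using Cu[of n] D g\<epsilon> by (intro mult_mono) auto
      finally show ?thesis using \<epsilon> by simp
    qed
    have 2: "\<bar>L (fold f) - (LINT z|?P. U z * apply_bcontfun (\<phi> (fst z)) (snd z))\<bar> \<le> e / 4"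
    proof -
      note F = fst_measure_preserving[where 'm = 'm, of \<Omega>]
      have \<phi>m: "(\<lambda>z. apply_bcontfun (\<phi> (fst z)) (snd z)) \<in> borel_measurable ?P"
        by (rule measurable_eval_periodic[OF measurable_compose[OF F(1) \<phi>'(2)] _ snd_measurable_lebesgue_on])
          (use \<phi>'(1) \<Omega> in auto)
      note N = test_L2_on_product[OF \<Omega>(1) \<phi>n \<phi>'(3), where 'm = 'm]
      note G = test_L2_on_product[OF \<Omega>(1) g(1,2), where 'm = 'm]
      have fm: "(\<lambda>z. f (fst z) (snd z)) \<in> borel_measurable ?P"
        by (rule lebesgue_on_borel(1)[OF open_tests_measurable[OF tto[OF f(1)]] \<Omega>Y])
      have i\<phi>: "integrable ?P (\<lambda>z. U z * apply_bcontfun (\<phi> (fst z)) (snd z))"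
        by (rule mult_L2_bound(1)[OF ULP N(1) \<phi>m U2P N(2)]) (rule abs_apply_bcontfun_le)
      have dm: "(\<lambda>z. f (fst z) (snd z) - apply_bcontfun (\<phi> (fst z)) (snd z)) \<in> borel_measurable ?P"
        using fm \<phi>m by measurable
      have db: "\<bar>f (fst z) (snd z) - apply_bcontfun (\<phi> (fst z)) (snd z)\<bar> \<le> g (fst z)" if "z \<in> space ?P" for z
        using g(4)[of "fst z" "snd z"] that by (auto simp: abs_minus_commute)
      note B = mult_L2_bound[OF ULP G(1) dm U2P G(2) db]
      have "integrable ?P (\<lambda>z. U z * (f (fst z) (snd z) - apply_bcontfun (\<phi> (fst z)) (snd z)) + U z * apply_bcontfun (\<phi> (fst z)) (snd z))"
        by (intro Bochner_Integration.integrable_add B(1) i\<phi>)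
      then have f_int: "integrable ?P (\<lambda>z. U z * f (fst z) (snd z))" by (simp add: algebra_simps)
      have "L (fold f) - (LINT z|?P. U z * apply_bcontfun (\<phi> (fst z)) (snd z))
          = (LINT z|?P. U z * (f (fst z) (snd z) - apply_bcontfun (\<phi> (fst z)) (snd z)))"
        unfolding J[OF f(1), symmetric] using f_int i\<phi> by (simp add: right_diff_distrib)
      also have "\<bar>\<dots>\<bar> \<le> sqrt (LINT z|?P. (U z)\<^sup>2) * sqrt (LINT z|?P. (g (fst z))\<^sup>2)" by (rule B(2))
      also have "\<dots> \<le> D * \<epsilon>" unfolding G(3) using D g\<epsilon> by (intro mult_mono) auto
      finally show ?thesis using \<epsilon> by simp
    qed
    obtain N where N: "\<And>n. n \<ge> N \<Longrightarrow> \<bar>I n f - L (fold f)\<bar> < e / 2"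
      using LIMSEQ_D[OF Llim[OF f(1)], of "e / 2"] \<open>e > 0\<close> by auto
    have "norm ((LINT x|lebesgue_on \<Omega>. u n x * apply_bcontfun (\<phi> x) (fast R (\<eta> n) x))
        - (LINT z|?P. U z * apply_bcontfun (\<phi> (fst z)) (snd z))) < e" if "n \<ge> N" for n
      unfolding real_norm_def using 1[of n] 2 N[OF that] by linarith
    then show "\<exists>N. \<forall>n\<ge>N. norm ((LINT x|lebesgue_on \<Omega>. u n x * apply_bcontfun (\<phi> x) (fast R (\<eta> n) x))
        - (LINT z|?P. U z * apply_bcontfun (\<phi> (fst z)) (snd z))) < e" by blast
  qed
  then show thesis using that[OF Um U2] by (auto simp: U_def)
qed

text \<open>
  The integrals against one generator are bounded by a multiple of the norm of the trigonometric
  polynomial; dividing by \<open>1 + norm\<close> makes this uniform, as the diagonal argument requires.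
\<close>
lemma generator_subsequence:
  fixes u :: "nat \<Rightarrow> real^3 \<Rightarrow> real^3" and R :: "real^3^'m"
  assumes \<Omega>: "open \<Omega>" "emeasure lborel \<Omega> < \<infinity>"
    and u: "\<And>n i. (\<lambda>x. u n x $ i) \<in> L2_on \<Omega>" and C: "\<And>n i. L2_norm_on \<Omega> (\<lambda>x. u n x $ i) \<le> C"
  obtains r :: "nat \<Rightarrow> nat" where "strict_mono r"
    "\<And>A j i. A \<in> basic_opens \<Omega> \<Longrightarrow> convergent (\<lambda>n. LINT x|lebesgue_on \<Omega>.
        u (r n) x $ i * (indicator A x * apply_bcontfun (trig_seq j) (fast R (\<eta> (r n)) x)))"
proof -
  define f where "f n = (\<lambda>(A, j, i). (LINT x|lebesgue_on \<Omega>.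
        u n x $ i * (indicator A x * apply_bcontfun (trig_seq j :: (real^'m) \<Rightarrow>\<^sub>C real) (fast R (\<eta> n) x)))
        / (1 + norm (trig_seq j :: (real^'m) \<Rightarrow>\<^sub>C real)))" for n
  define m where "m = sqrt (measure (lebesgue_on \<Omega>) \<Omega>)"
  let ?S = "basic_opens \<Omega> \<times> (UNIV :: nat set) \<times> (UNIV :: 3 set)"
  have C0: "0 \<le> C" using C[of 0] by (rule order_trans[rotated]) (simp add: L2_norm_on_def)
  have bound: "norm (f n t) \<le> C * m" if "t \<in> ?S" for n t
  proof -
    obtain A j i where t1: "t = (A, j, i)" by (cases t)
    then have t: "t = (A, j, i)" "A \<in> basic_opens \<Omega>" using that by auto
    define d where "d = (trig_seq j :: (real^'m) \<Rightarrow>\<^sub>C real)"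
    have "(\<lambda>x y. 0 + 1 * (indicator A x * apply_bcontfun d y)) \<in> trig_tests \<Omega>"
      unfolding trig_tests_def d_def using t by (intro step_tests.intros) auto
    then have o: "(\<lambda>x y. indicator A x * apply_bcontfun d y) \<in> open_tests \<Omega>"
      using trig_tests_open_tests[OF \<Omega>(1)] by auto
    have "\<bar>LINT x|lebesgue_on \<Omega>. u n x $ i * (indicator A x * apply_bcontfun d (fast R (\<eta> n) x))\<bar>
        \<le> sqrt (LINT x|lebesgue_on \<Omega>. (u n x $ i)\<^sup>2) * sqrt (LINT x|lebesgue_on \<Omega>. (norm d)\<^sup>2)"
    proof (rule mult_L2_bound(2)[OF L2_on_realD(1)[OF u] _ open_tests_fast_L2(1)[OF \<Omega> o] L2_on_realD(2)[OF u]])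
      show "integrable (lebesgue_on \<Omega>) (\<lambda>x. (norm d)\<^sup>2)"
        using finite_measure_lebesgue_on_open[OF \<Omega>] by (simp add: finite_measure.integrable_const)
      show "\<bar>indicator A x * apply_bcontfun d (fast R (\<eta> n) x)\<bar> \<le> norm d" for x
        using norm_bounded[of d "fast R (\<eta> n) x"] by (auto simp: indicator_def)
    qed simp
    also have "\<dots> = sqrt (LINT x|lebesgue_on \<Omega>. (u n x $ i)\<^sup>2) * (m * norm d)"
      by (simp add: m_def real_sqrt_mult)
    also have "\<dots> \<le> C * (m * norm d)"
      using C[of n i] by (intro mult_right_mono) (auto simp: L2_norm_on_def m_def)
    also have "\<dots> \<le> C * (m * (1 + norm d))"
      using C0 by (intro mult_left_mono) (auto simp: m_def)
    finally have "\<bar>LINT x|lebesgue_on \<Omega>. u n x $ i * (indicator A x * apply_bcontfun d (fast R (\<eta> n) x))\<bar> / (1 + norm d) \<le> C * m"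
      by (subst pos_divide_le_eq) (auto simp: add_pos_nonneg mult.assoc)
    then show ?thesis by (simp add: f_def t d_def)
  qed
  have "countable ?S" by (intro countable_SIGMA countable_basic_opens) auto
  from function_convergent_subsequence[OF this, of f "C * m"] bound
  obtain r :: "nat \<Rightarrow> nat" where r: "strict_mono r" "\<And>t. t \<in> ?S \<Longrightarrow> \<exists>l. (\<lambda>n. f (r n) t) \<longlonglongrightarrow> l" by metis
  have "convergent (\<lambda>n. LINT x|lebesgue_on \<Omega>.
        u (r n) x $ i * (indicator A x * apply_bcontfun (trig_seq j) (fast R (\<eta> (r n)) x)))" if "A \<in> basic_opens \<Omega>" for A j i
  proof -
    have "convergent (\<lambda>n. f (r n) (A, j, i))" using r(2)[of "(A, j, i)"] that by (auto simp: convergent_def)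
    then have "convergent (\<lambda>n. (1 + norm (trig_seq j :: (real^'m) \<Rightarrow>\<^sub>C real)) * f (r n) (A, j, i))"
      by (intro convergent_mult convergent_const)
    moreover have "1 + norm (trig_seq j :: (real^'m) \<Rightarrow>\<^sub>C real) \<noteq> 0"
      using norm_ge_zero[of "trig_seq j :: (real^'m) \<Rightarrow>\<^sub>C real"] by linarith
    ultimately show ?thesis by (simp add: f_def)
  qed
  then show thesis using that r(1) by blast
qed

section \<open>Curl as a signed sum\<close>

text \<open>
  Every pairing of a field with a curl is this signed sum over \<open>E l i j\<close>, the product of the
  component \<open>l\<close> of the field with the derivative in direction \<open>j\<close> of the component \<open>i\<close> of the test
  field. Limits and integrals pass through it term by term.
\<close>
definition curl_sum :: "(3 \<Rightarrow> 3 \<Rightarrow> 3 \<Rightarrow> real) \<Rightarrow> real" where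
  "curl_sum E = (E 1 3 2 - E 1 2 3) + (E 2 1 3 - E 2 3 1) + (E 3 2 1 - E 3 1 2)"

lemma inner_curl_op:
  "v \<bullet> curl_op D \<psi> x = curl_sum (\<lambda>l i j. v $ l * D (\<lambda>z. \<psi> z $ i) x $ j)"
  by (simp add: curl_sum_def curl_op_def inner_vec_def sum_3 vector_3 algebra_simps)

lemma curl_op_nth:
  "curl_op D \<psi> x $ l = curl_sum (\<lambda>l' i j. of_bool (l' = l) * D (\<lambda>z. \<psi> z $ i) x $ j)"
proof -
  have "axis l 1 \<bullet> curl_op D \<psi> x = curl_op D \<psi> x $ l" by (simp add: inner_axis')
  moreover have "axis l (1 :: real) $ l' = of_bool (l' = l)" for l' by (simp add: axis_def)
  ultimately show ?thesis using inner_curl_op[of "axis l 1" D \<psi> x] by simp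
qed

lemma tendsto_curl_sum:
  assumes "\<And>l i j. ((\<lambda>n. E n l i j) \<longlongrightarrow> E' l i j) F"
  shows "((\<lambda>n. curl_sum (E n)) \<longlongrightarrow> curl_sum E') F"
  unfolding curl_sum_def by (intro tendsto_intros assms)

lemma integral_curl_sum:
  assumes "\<And>l i j. integrable M (\<lambda>x. E x l i j)"
  shows "integrable M (\<lambda>x. curl_sum (E x))"
    and "(LINT x|M. curl_sum (E x)) = curl_sum (\<lambda>l i j. LINT x|M. E x l i j)"
  unfolding curl_sum_def using assms by auto

lemma abs_curl_sum_le:
  assumes "\<And>l i j. \<bar>E l i j - E' l i j\<bar> \<le> c"
  shows "\<bar>curl_sum E - curl_sum E'\<bar> \<le> 6 * c"
  using assms[of 1 3 2] assms[of 1 2 3] assms[of 2 1 3] assms[of 2 3 1] assms[of 3 2 1] assms[of 3 1 2]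
  unfolding curl_sum_def by linarith

lemma curl_sum_mult: "c * curl_sum E = curl_sum (\<lambda>l i j. c * E l i j)"
  by (simp add: curl_sum_def algebra_simps)

section \<open>Compactly supported fields\<close>

lemma test_fields_smooth: "\<psi> \<in> test_fields S \<Longrightarrow> smooth (\<lambda>x. \<psi> x $ i)"
  by (simp add: test_fields_def smooth_def)

lemma partial_deriv_support:
  assumes "x \<notin> closure {x. \<psi> x \<noteq> 0}"
  shows "partial_deriv j (\<lambda>x. \<psi> x $ i) x = 0"
proof -
  let ?X = "- closure {x. \<psi> x \<noteq> 0}"
  have "((\<lambda>x. \<psi> x $ i) has_derivative (\<lambda>h. 0)) (at x)"
  proof (rule has_derivative_transform_within_open[OF has_derivative_const[of 0], of ?X])
    fix y assume "y \<in> ?X"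
    then have "\<psi> y = 0" using closure_subset[of "{x. \<psi> x \<noteq> 0}"] by blast
    then show "0 = \<psi> y $ i" by simp
  qed (use assms in auto)
  then show ?thesis by (rule partial_deriv_eq)
qed

lemma partial_deriv_support_scalar:
  fixes f :: "real^'n::finite \<Rightarrow> real"
  assumes "closed K" "\<And>x. x \<notin> K \<Longrightarrow> f x = 0" "x \<notin> K"
  shows "partial_deriv j f x = 0"
proof -
  have "(f has_derivative (\<lambda>h. 0)) (at x)"
    by (rule has_derivative_transform_within_open[OF has_derivative_const[of 0], of "- K"])
      (use assms in auto)
  then show ?thesis by (rule partial_deriv_eq)
qed

lemma bounded_continuous_compact_support:
  fixes s :: "'a::metric_space \<Rightarrow> real"
  assumes "continuous_on UNIV s" "compact K" "\<And>x. x \<notin> K \<Longrightarrow> s x = 0"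
  shows "\<exists>b. \<forall>x. \<bar>s x\<bar> \<le> b"
proof -
  have "compact (s ` K)" by (intro compact_continuous_image continuous_on_subset[OF assms(1)] assms(2)) simp
  then obtain b where "\<And>x. x \<in> K \<Longrightarrow> \<bar>s x\<bar> \<le> b"
    using compact_imp_bounded by (metis bounded_iff imageI real_norm_def)
  then have "\<bar>s x\<bar> \<le> \<bar>b\<bar>" for x using assms(3)[of x] by (cases "x \<in> K") (auto intro: order_trans[OF _ abs_ge_self])
  then show ?thesis by blast
qed

lemma grad_R_nth: "grad_R R f y $ j = (\<Sum>i\<in>UNIV. R $ i $ j * partial_deriv i f y)"
  by (simp add: grad_R_def grad_def matrix_vector_mult_def transpose_def)

lemma grad_nth: "grad f x $ j = partial_deriv j f x"
  by (simp add: grad_def)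

lemma grad_R_continuous: "smooth f \<Longrightarrow> continuous_on UNIV (\<lambda>y. grad_R R f y $ j)"
  unfolding grad_R_nth by (intro continuous_intros smooth_continuous smooth_partial_deriv)

lemma grad_R_support:
  "y \<notin> closure {x. \<psi> x \<noteq> 0} \<Longrightarrow> grad_R R (\<lambda>z. \<psi> z $ i) y $ j = 0"
  unfolding grad_R_nth by (simp add: partial_deriv_support)

text \<open>
  The periodized derivatives from which the curl along \<open>R\<close> of a periodized test field is formed.
\<close>
definition periodic_grad :: "real^3^'m \<Rightarrow> (real^'m \<Rightarrow> real^3) \<Rightarrow> 3 \<Rightarrow> 3 \<Rightarrow> real^'m \<Rightarrow> real" where
  "periodic_grad R \<psi> i j = periodize (\<lambda>y. grad_R R (\<lambda>z. \<psi> z $ i) y $ j)"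

lemma test_fields_bounded:
  assumes "\<psi> \<in> test_fields S"
  shows "bounded (closure {x. \<psi> x \<noteq> 0})"
  using assms by (auto simp: test_fields_def compact_imp_bounded)

lemma periodic_grad_periodic_continuous:
  assumes "\<psi> \<in> test_fields UNIV"
  shows "periodic (periodic_grad R \<psi> i j)" "continuous_on UNIV (periodic_grad R \<psi> i j)"
  unfolding periodic_grad_def using periodize_periodic
    continuous_periodize[OF grad_R_continuous[OF test_fields_smooth[OF assms]] test_fields_bounded[OF assms]]
    grad_R_support by blast+

section \<open>The setting of the limit passage\<close>

text \<open>
  A curl-free sequence together with the two-scale limits \<open>U i\<close> of its components, given on the
  half-open cell and extended by zero.
\<close>
locale two_scale_setting =
  fixes \<Omega> :: "(real^3) set" and R :: "real^3^'m" and \<eta> :: "nat \<Rightarrow> real"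
    and u :: "nat \<Rightarrow> real^3 \<Rightarrow> real^3" and U :: "3 \<Rightarrow> (real^3) \<times> (real^'m) \<Rightarrow> real"
  assumes \<Omega>: "open \<Omega>" "emeasure lborel \<Omega> < \<infinity>"
    and \<eta>: "\<And>n. \<eta> n > 0" "\<eta> \<longlonglongrightarrow> 0"
    and u: "\<And>n i. (\<lambda>x. u n x $ i) \<in> L2_on \<Omega>"
    and curl_free: "\<And>n. has_weak_curl_on grad \<Omega> (u n) (\<lambda>_. 0)"
    and Um: "\<And>i. U i \<in> borel_measurable borel"
    and U2: "\<And>i. integrable lborel (\<lambda>z. (U i z)\<^sup>2)"
    and U0: "\<And>i z. z \<notin> \<Omega> \<times> half_open_cell \<Longrightarrow> U i z = 0"
    and limit: "\<And>i \<phi>. \<phi> \<in> L2_C_periodic \<Omega> \<Longrightarrow>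
      (\<lambda>n. LINT x|lebesgue_on \<Omega>. u n x $ i * apply_bcontfun (\<phi> x) (fast R (\<eta> n) x))
      \<longlonglongrightarrow> (LINT z|lebesgue_on (\<Omega> \<times> unit_cell). U i z * apply_bcontfun (\<phi> (fst z)) (snd z))"
begin

lemma U1: "integrable lborel (U i)"
proof -
  have \<Omega>Q: "\<Omega> \<times> (half_open_cell :: (real^'m) set) \<in> sets borel" using \<Omega> by (intro borel_Times) auto
  have fin: "emeasure lborel (\<Omega> \<times> (half_open_cell :: (real^'m) set)) < \<infinity>"
    using \<Omega> by (subst emeasure_lborel_Times) auto
  have sq: "(indicator (\<Omega> \<times> (half_open_cell :: (real^'m) set)) z)\<^sup>2 = (indicator (\<Omega> \<times> half_open_cell) z :: real)" for z
    by (auto simp: indicator_def)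
  have "integrable lborel (\<lambda>z. U i z * indicator (\<Omega> \<times> half_open_cell) z)"
    by (rule integrable_mult_L2) (use Um U2 \<Omega>Q fin in \<open>auto simp: sq intro!: integrable_real_indicator\<close>)
  moreover have "U i z * indicator (\<Omega> \<times> half_open_cell) z = U i z" for z
    using U0[of z i] by (auto simp: indicator_def)
  ultimately show ?thesis by simp
qed

text \<open>
  Extension by zero makes this an integral over the cell, against the periodic function \<open>P\<close>.
\<close>
definition fibre :: "3 \<Rightarrow> (real^'m \<Rightarrow> real) \<Rightarrow> real^3 \<Rightarrow> real" where
  "fibre i P x = (LINT y|lborel. U i (x, y) * P y)"

text \<open>
  Tests \<open>s x * P y\<close> are the only ones that the curl equations need; Fubini's theorem turns the
  limit into an integral over \<open>x\<close> of \<open>s\<close> times a fibre.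
\<close>
lemma product_test:
  fixes s :: "real^3 \<Rightarrow> real"
  assumes s: "continuous_on UNIV s" "\<And>x. \<bar>s x\<bar> \<le> b" and P: "periodic P" "continuous_on UNIV P"
  shows "integrable (lebesgue_on \<Omega>) (\<lambda>x. u n x $ i * (s x * P (fast R (\<eta> n) x)))"
    and "integrable lborel (\<lambda>x. s x * fibre i P x)"
    and "(\<lambda>n. LINT x|lebesgue_on \<Omega>. u n x $ i * (s x * P (fast R (\<eta> n) x))) \<longlonglongrightarrow> (LINT x|lborel. s x * fibre i P x)"
proof -
  have \<Omega>b: "\<Omega> \<in> sets borel" using \<Omega> by simp
  interpret fm: finite_measure "lebesgue_on \<Omega>" by (rule finite_measure_lebesgue_on_open[OF \<Omega>])
  have Pb: "P \<in> bcontfun" by (rule periodic_continuous_bcontfun[OF P])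
  define p where "p = Bcontfun P"
  have p: "apply_bcontfun p = P" unfolding p_def by (rule Bcontfun_inverse[OF Pb])
  have sm: "s \<in> borel_measurable borel" by (rule borel_measurable_continuous_onI[OF s(1)])
  have Pm: "P \<in> borel_measurable borel" by (rule borel_measurable_continuous_onI[OF P(2)])
  define B where "B = b * norm p"
  have bd: "\<bar>s x * P y\<bar> \<le> B" for x y
    unfolding B_def abs_mult using s(2)[of x] abs_apply_bcontfun_le[of p y]
    by (intro mult_mono) (auto simp: p intro: order_trans)
  have fm: "fast R (\<eta> n) \<in> borel_measurable borel" for n
    by (rule borel_measurable_continuous_onI[OF continuous_fast])
  have "(\<lambda>x. s x * P (fast R (\<eta> n) x)) \<in> borel_measurable borel"
    using sm measurable_compose[OF fm Pm] by (rule borel_measurable_times)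
  from lebesgue_on_borel(1)[OF this \<Omega>b]
  show "integrable (lebesgue_on \<Omega>) (\<lambda>x. u n x $ i * (s x * P (fast R (\<eta> n) x)))"
    by (intro mult_L2_bound(1)[where g = "\<lambda>x. B"] L2_on_realD[OF u] bd fm.integrable_const) auto
  have L2: "(\<lambda>x. s x *\<^sub>R p) \<in> L2_C_periodic \<Omega>"
    unfolding L2_C_periodic_def
  proof (intro CollectI conjI ballI)
    show "periodic (apply_bcontfun (s x *\<^sub>R p))" for x using P(1) by (simp add: periodic_def p)
    have "(\<lambda>t. t *\<^sub>R p) \<in> borel_measurable borel"
      by (intro borel_measurable_continuous_onI continuous_intros)
    from measurable_compose[OF lebesgue_on_borel(1)[OF sm \<Omega>b] this]
    show "(\<lambda>x. s x *\<^sub>R p) \<in> borel_measurable (lebesgue_on \<Omega>)" .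
    have "(\<lambda>x. (s x)\<^sup>2 * (norm p)\<^sup>2) \<in> borel_measurable borel" using sm by measurable
    then show "integrable (lebesgue_on \<Omega>) (\<lambda>x. (norm (s x *\<^sub>R p))\<^sup>2)"
    proof (intro fm.integrable_const_bound[where B = "b\<^sup>2 * (norm p)\<^sup>2"] AE_I2)
      fix x
      have "(s x)\<^sup>2 \<le> b\<^sup>2" using s(2)[of x] by (metis abs_ge_zero power2_abs power_mono)
      then show "norm ((norm (s x *\<^sub>R p))\<^sup>2) \<le> b\<^sup>2 * (norm p)\<^sup>2"
        by (simp add: power_mult_distrib mult_right_mono)
    qed (simp add: power_mult_distrib lebesgue_on_borel(1)[OF _ \<Omega>b])
  qed
  define G where "G z = U i z * (s (fst z) * P (snd z))" for z
  have fs: "fst \<in> (borel :: ((real^3) \<times> (real^'m)) measure) \<rightarrow>\<^sub>M borel" "snd \<in> (borel :: ((real^3) \<times> (real^'m)) measure) \<rightarrow>\<^sub>M borel"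
    by (auto intro!: borel_measurable_continuous_onI continuous_intros)
  have Gm: "G \<in> borel_measurable borel"
    unfolding G_def by (intro borel_measurable_times Um measurable_compose[OF fs(1) sm] measurable_compose[OF fs(2) Pm])
  have Gi: "integrable lborel G"
  proof (rule Bochner_Integration.integrable_bound[OF integrable_mult_right[OF U1, of B]])
    show "AE z in lborel. norm (G z) \<le> norm (B * U i z)"
    proof (rule AE_I2)
      fix z
      have "norm (G z) = \<bar>s (fst z) * P (snd z)\<bar> * \<bar>U i z\<bar>" by (simp add: G_def abs_mult)
      also have "\<dots> \<le> B * \<bar>U i z\<bar>" by (intro mult_right_mono bd) simp
      also have "\<dots> \<le> norm (B * U i z)" by (simp add: abs_mult mult_right_mono)
      finally show "norm (G z) \<le> norm (B * U i z)" .
    qed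
  qed (use Gm in simp)
  have inner: "(LINT y|lborel. G (x, y)) = s x * fibre i P x" for x
  proof -
    have "G (x, y) = s x * (U i (x, y) * P y)" for y by (simp add: G_def)
    then show ?thesis by (simp add: fibre_def)
  qed
  show "integrable lborel (\<lambda>x. s x * fibre i P x)"
    using lborel_pair.integrable_fst'[of G] Gi by (simp add: lborel_prod inner)
  have \<Omega>Y: "\<Omega> \<times> (unit_cell :: (real^'m) set) \<in> sets borel" using \<Omega>b by (intro borel_Times) auto
  have "(LINT z|lebesgue_on (\<Omega> \<times> unit_cell). G z) = (LINT z|lborel. indicator (\<Omega> \<times> unit_cell) z *\<^sub>R G z)"
    by (rule lebesgue_on_borel(3)[OF Gm \<Omega>Y])
  also have "\<dots> = (LINT z|lborel. G z)"
  proof (rule integral_cong_AE)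
    show "AE z in lborel. indicator (\<Omega> \<times> unit_cell) z *\<^sub>R G z = G z"
      using AE_product_cell_iff
    proof eventually_elim
      case (elim z)
      then show ?case using U0[of z i] by (cases z) (auto simp: G_def indicator_def)
    qed
  qed (use Gm \<Omega>Y in auto)
  also have "\<dots> = (LINT x|lborel. s x * fibre i P x)"
    using lborel_pair.integral_fst'[of G] Gi by (simp add: lborel_prod inner)
  finally have "(LINT z|lebesgue_on (\<Omega> \<times> unit_cell). G z) = (LINT x|lborel. s x * fibre i P x)" .
  then show "(\<lambda>n. LINT x|lebesgue_on \<Omega>. u n x $ i * (s x * P (fast R (\<eta> n) x))) \<longlonglongrightarrow> (LINT x|lborel. s x * fibre i P x)"
    using limit[OF L2, of i] by (simp add: G_def p)
qed

lemma fibre_integrable: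
  assumes "periodic P" "continuous_on UNIV P"
  shows "integrable lborel (fibre i P)"
  using product_test(2)[of "\<lambda>x. 1" 1, OF _ _ assms] by simp

text \<open>
  The oscillating test field is \<open>\<Phi> n\<close>, with \<open>\<eta> n\<close> in front of a bump times the sum of the translates of \<open>\<psi>\<close> at the fast
  variable. A finite sum of translates agrees with the periodization on the support
  of the bump and is smooth for trivial reasons.
\<close>
lemma fibre_curl_zero:
  assumes \<psi>: "\<psi> \<in> test_fields (UNIV :: (real^'m) set)"
  shows "AE x in lborel. x \<in> \<Omega> \<longrightarrow> curl_sum (\<lambda>l i j. fibre l (periodic_grad R \<psi> i j) x) = 0"
proof (rule fundamental_lemma[OF \<Omega>(1)])
  let ?W = "periodic_grad R \<psi>"
  let ?h = "\<lambda>x. curl_sum (\<lambda>l i j. fibre l (?W i j) x)"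
  note W = periodic_grad_periodic_continuous[OF \<psi>]
  have hi: "integrable lborel ?h" by (intro integral_curl_sum(1) fibre_integrable W)
  show "?h \<in> borel_measurable borel" using hi by auto
  show "integrable lborel (\<lambda>x. indicator \<Omega> x * ?h x)"
    using integrable_mult_indicator[OF _ hi, of \<Omega>] \<Omega> by simp
  fix a b :: "real^3" and N assume ab: "cbox a b \<subseteq> \<Omega>"
  define \<theta> where "\<theta> = bump a b N"
  have \<theta>s: "smooth \<theta>" unfolding \<theta>_def by (rule smooth_bump)
  have \<theta>0: "\<theta> x = 0" if "x \<notin> cbox a b" for x
    using that bump_nonzero_iff[of a b N x] box_subset_cbox[of a b] unfolding \<theta>_def by blast
  have d\<theta>0: "partial_deriv j \<theta> x = 0" if "x \<notin> cbox a b" for x j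
    by (rule partial_deriv_support_scalar[OF closed_cbox \<theta>0 that])
  obtain b\<theta> where b\<theta>: "\<And>x. \<bar>\<theta> x\<bar> \<le> b\<theta>"
    using bounded_continuous_compact_support[OF smooth_continuous[OF \<theta>s] compact_cbox \<theta>0] by blast
  have "\<exists>c. \<forall>x. \<bar>partial_deriv j \<theta> x\<bar> \<le> c" for j
    by (rule bounded_continuous_compact_support[OF smooth_continuous[OF smooth_partial_deriv[OF \<theta>s]] compact_cbox d\<theta>0])
  then obtain bd where bd: "\<And>j x. \<bar>partial_deriv j \<theta> x\<bar> \<le> bd j" by metis
  define B where "B = closure {y. \<psi> y \<noteq> 0}"
  have Bb: "bounded B" unfolding B_def by (rule test_fields_bounded[OF \<psi>])
  have \<psi>B: "y \<in> B" if "\<psi> y $ i \<noteq> 0" for y i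
    using that closure_subset[of "{y. \<psi> y \<noteq> 0}"] unfolding B_def by force
  have D\<psi>B: "y \<in> B" if "grad_R R (\<lambda>z. \<psi> z $ i) y $ j \<noteq> 0" for y i j
    using that grad_R_support unfolding B_def by blast
  have \<psi>s: "smooth (\<lambda>y. \<psi> y $ i)" for i by (rule test_fields_smooth[OF \<psi>])
  define p where "p i = periodize (\<lambda>y. \<psi> y $ i)" for i
  have p: "periodic (p i)" "continuous_on UNIV (p i)" for i
    unfolding p_def using periodize_periodic continuous_periodize[OF smooth_continuous[OF \<psi>s] Bb] \<psi>B by blast+
  define K where "K n = {k :: int^'m. \<exists>y\<in>fast R (\<eta> n) ` cbox a b. y + int_vec k \<in> B}" for n
  have K: "finite (K n)" for n
    unfolding K_def
    by (intro finite_int_shifts Bb compact_imp_bounded compact_continuous_image continuous_fast compact_cbox)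
  have sumK: "(\<Sum>k\<in>K n. f (fast R (\<eta> n) x + int_vec k)) = periodize f (fast R (\<eta> n) x)"
    if "x \<in> cbox a b" "\<And>y. f y \<noteq> 0 \<Longrightarrow> y \<in> B" for n x f
    by (rule periodize_eq_sum[OF K, symmetric]) (use that in \<open>unfold K_def, blast\<close>)
  define q where "q n i x = (\<Sum>k\<in>K n. \<psi> (fast R (\<eta> n) x + int_vec k) $ i)" for n i x
  have aff: "fast R (\<eta> n) x + c = ((1 / \<eta> n) *\<^sub>R R) *v x + c" for n x c
    by (simp add: fast_def scaleR_matrix_vector_assoc)
  have qs: "smooth (q n i)" for n i
    unfolding q_def[abs_def] aff by (intro smooth_sum K smooth_affine[OF \<psi>s])
  have qd: "partial_deriv j (q n i) x = (1 / \<eta> n) * (\<Sum>k\<in>K n. grad_R R (\<lambda>z. \<psi> z $ i) (fast R (\<eta> n) x + int_vec k) $ j)" for n i j x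
  proof -
    let ?A = "(1 / \<eta> n) *\<^sub>R R"
    have d: "((\<lambda>x. \<psi> (?A *v x + int_vec k) $ i) has_derivative
        frechet_derivative (\<lambda>x. \<psi> (?A *v x + int_vec k) $ i) (at x)) (at x)" for k
      by (rule has_derivative_frechet[OF partial_deriv_affine(2)[OF smooth_differentiable[OF \<psi>s]]])
    have ds: "((\<lambda>x. \<Sum>k\<in>K n. \<psi> (?A *v x + int_vec k) $ i) has_derivative
        (\<lambda>h. \<Sum>k\<in>K n. frechet_derivative (\<lambda>x. \<psi> (?A *v x + int_vec k) $ i) (at x) h)) (at x)"
      by (intro has_derivative_sum d)
    have "partial_deriv j (q n i) x = (\<Sum>k\<in>K n. partial_deriv j (\<lambda>x. \<psi> (?A *v x + int_vec k) $ i) x)"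
      unfolding q_def[abs_def] aff
      using partial_deriv_eq[OF ds, of j] by (simp add: partial_deriv_def)
    also have "\<dots> = (\<Sum>k\<in>K n. (1 / \<eta> n) * grad_R R (\<lambda>z. \<psi> z $ i) (?A *v x + int_vec k) $ j)"
    proof (rule sum.cong[OF refl])
      fix k
      show "partial_deriv j (\<lambda>x. \<psi> (?A *v x + int_vec k) $ i) x = (1 / \<eta> n) * grad_R R (\<lambda>z. \<psi> z $ i) (?A *v x + int_vec k) $ j"
        unfolding partial_deriv_affine(1)[OF smooth_differentiable[OF \<psi>s]] grad_R_nth
        by (simp add: sum_divide_distrib)
    qed
    finally show ?thesis by (simp add: aff sum_divide_distrib)
  qed
  define \<Phi> where "\<Phi> n x = (\<chi> i. \<eta> n * (\<theta> x * q n i x))" for n x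
  have \<Phi>d: "partial_deriv j (\<lambda>x. \<Phi> n x $ i) x
      = \<eta> n * (partial_deriv j \<theta> x * p i (fast R (\<eta> n) x)) + \<theta> x * ?W i j (fast R (\<eta> n) x)" for n i j x
  proof -
    have "partial_deriv j (\<lambda>x. \<Phi> n x $ i) x = \<eta> n * (\<theta> x * partial_deriv j (q n i) x + partial_deriv j \<theta> x * q n i x)"
      unfolding \<Phi>_def
      by (simp add: partial_deriv_mult partial_deriv_const smooth_differentiable \<theta>s qs smooth_mult)
    also have "\<dots> = \<eta> n * (partial_deriv j \<theta> x * q n i x) + \<theta> x * (\<Sum>k\<in>K n. grad_R R (\<lambda>z. \<psi> z $ i) (fast R (\<eta> n) x + int_vec k) $ j)"
      using \<eta>(1)[of n] by (simp add: qd algebra_simps)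
    also have "\<dots> = \<eta> n * (partial_deriv j \<theta> x * p i (fast R (\<eta> n) x)) + \<theta> x * ?W i j (fast R (\<eta> n) x)"
    proof (cases "x \<in> cbox a b")
      case True
      have "q n i x = p i (fast R (\<eta> n) x)"
        unfolding q_def p_def by (rule sumK[OF True \<psi>B])
      moreover have "(\<Sum>k\<in>K n. grad_R R (\<lambda>z. \<psi> z $ i) (fast R (\<eta> n) x + int_vec k) $ j) = ?W i j (fast R (\<eta> n) x)"
        unfolding periodic_grad_def by (rule sumK[OF True D\<psi>B])
      ultimately show ?thesis by simp
    next
      case False
      then show ?thesis by (simp add: \<theta>0 d\<theta>0)
    qed
    finally show ?thesis .
  qed
  have \<Phi>t: "\<Phi> n \<in> test_fields \<Omega>" for n
  proof -
    have "smooth (\<lambda>x. \<Phi> n x $ i)" for i unfolding \<Phi>_def by (simp add: smooth_mult smooth_const \<theta>s qs)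
    moreover have sub: "{x. \<Phi> n x \<noteq> 0} \<subseteq> cbox a b" using \<theta>0 by (force simp: \<Phi>_def vec_eq_iff)
    have cl: "closure {x. \<Phi> n x \<noteq> 0} \<subseteq> cbox a b" by (rule closure_minimal[OF sub closed_cbox])
    moreover have "compact (closure {x. \<Phi> n x \<noteq> 0})"
      by (simp add: compact_closure bounded_subset[OF bounded_cbox sub])
    ultimately show ?thesis using ab by (auto simp: test_fields_def smooth_def)
  qed
  define \<alpha> where "\<alpha> n l i j = (LINT x|lebesgue_on \<Omega>. u n x $ l * (partial_deriv j \<theta> x * p i (fast R (\<eta> n) x)))" for n l i j
  define \<beta> where "\<beta> n l i j = (LINT x|lebesgue_on \<Omega>. u n x $ l * (\<theta> x * ?W i j (fast R (\<eta> n) x)))" for n l i j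
  note PA = product_test[OF smooth_continuous[OF smooth_partial_deriv[OF \<theta>s]] bd p]
  note PB = product_test[OF smooth_continuous[OF \<theta>s] b\<theta> W]
  \<comment> \<open>The products in \<open>\<alpha>\<close> come from derivatives of the bump and keep the factor \<open>\<eta> n\<close>; those in
    \<open>\<beta>\<close> come from derivatives in the fast variable and have lost it.\<close>
  have zero: "curl_sum (\<lambda>l i j. \<eta> n * \<alpha> n l i j + \<beta> n l i j) = 0" for n
  proof -
    have "0 = (LINT x|lebesgue_on \<Omega>. u n x \<bullet> curl_op grad (\<Phi> n) x)"
      using curl_free[of n] \<Phi>t[of n] by (simp add: has_weak_curl_on_def)
    also have "\<dots> = (LINT x|lebesgue_on \<Omega>. curl_sum (\<lambda>l i j.
        \<eta> n * (u n x $ l * (partial_deriv j \<theta> x * p i (fast R (\<eta> n) x))) + u n x $ l * (\<theta> x * ?W i j (fast R (\<eta> n) x))))"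
      by (simp add: inner_curl_op grad_nth \<Phi>d algebra_simps)
    also have "\<dots> = curl_sum (\<lambda>l i j. LINT x|lebesgue_on \<Omega>.
        \<eta> n * (u n x $ l * (partial_deriv j \<theta> x * p i (fast R (\<eta> n) x))) + u n x $ l * (\<theta> x * ?W i j (fast R (\<eta> n) x)))"
      by (intro integral_curl_sum(2) Bochner_Integration.integrable_add integrable_mult_right PA(1) PB(1))
    also have "\<dots> = curl_sum (\<lambda>l i j. \<eta> n * \<alpha> n l i j + \<beta> n l i j)"
      using PA(1) PB(1) by (simp add: \<alpha>_def \<beta>_def)
    finally show ?thesis by simp
  qed
  have "(\<lambda>n. curl_sum (\<lambda>l i j. \<eta> n * \<alpha> n l i j + \<beta> n l i j))
      \<longlonglongrightarrow> curl_sum (\<lambda>l i j. 0 * (LINT x|lborel. partial_deriv j \<theta> x * fibre l (p i) x) + (LINT x|lborel. \<theta> x * fibre l (?W i j) x))"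
    unfolding \<alpha>_def \<beta>_def by (intro tendsto_curl_sum tendsto_intros \<eta>(2) PA(3) PB(3))
  then have "curl_sum (\<lambda>l i j. LINT x|lborel. \<theta> x * fibre l (?W i j) x) = 0"
    by (simp add: zero LIMSEQ_const_iff)
  moreover have "(LINT x|lborel. \<theta> x * ?h x) = curl_sum (\<lambda>l i j. LINT x|lborel. \<theta> x * fibre l (?W i j) x)"
    unfolding curl_sum_mult by (intro integral_curl_sum(2) PB(2))
  ultimately show "(LINT x|lborel. bump a b N x * ?h x) = 0" by (simp add: \<theta>_def)
qed

end

section \<open>The two-scale limit of a curl-free sequence\<close>

lemma borel_measurable_vec3:
  fixes f :: "'a \<Rightarrow> real^3"
  assumes "\<And>i. (\<lambda>x. f x $ i) \<in> borel_measurable M"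
  shows "f \<in> borel_measurable M"
  by (subst borel_measurable_euclidean_space) (auto simp: Basis_vec_def inner_axis assms)

lemma integrable_vec3:
  fixes f :: "'a \<Rightarrow> real^3"
  assumes "\<And>i. integrable M (\<lambda>x. f x $ i)"
  shows "integrable M f"
proof -
  have eq: "f = (\<lambda>x. \<Sum>i\<in>UNIV. f x $ i *\<^sub>R axis i 1)"
    by (simp add: fun_eq_iff basis_expansion scalar_mult_eq_scaleR[symmetric])
  show ?thesis
    by (subst eq) (intro Bochner_Integration.integrable_sum integrable_scaleR_left assms)
qed

lemma norm_vec3_square: "(norm (x :: real^3))\<^sup>2 = (\<Sum>i\<in>UNIV. (x $ i)\<^sup>2)"
  by (simp add: norm_vec_def L2_set_def sum_nonneg)

context two_scale_setting
begin

lemma AE_fibres_integrable: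
  "AE x in lborel. (\<forall>i. integrable lborel (\<lambda>y. U i (x, y))) \<and> (\<forall>i. integrable lborel (\<lambda>y. (U i (x, y))\<^sup>2))"
proof -
  have "AE x in lborel. integrable lborel (\<lambda>y. U i (x, y))" for i
    using lborel_pair.AE_integrable_fst'[of "U i"] U1 by (simp add: lborel_prod)
  moreover have "AE x in lborel. integrable lborel (\<lambda>y. (U i (x, y))\<^sup>2)" for i
    using lborel_pair.AE_integrable_fst'[of "\<lambda>z. (U i z)\<^sup>2"] U2 by (simp add: lborel_prod)
  ultimately show ?thesis by (simp add: AE_all_countable)
qed

lemma fibre_diff_le:
  assumes x: "integrable lborel (\<lambda>y. U i (x, y))"
    and P: "periodic P" "continuous_on UNIV P" and Q: "periodic Q" "continuous_on UNIV Q"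
    and c: "\<And>y. \<bar>P y - Q y\<bar> \<le> c"
  shows "\<bar>fibre i P x - fibre i Q x\<bar> \<le> c * (LINT y|lborel. \<bar>U i (x, y)\<bar>)"
proof -
  have int: "integrable lborel (\<lambda>y. U i (x, y) * P y)" if p: "periodic P" "continuous_on UNIV P" for P
  proof -
    obtain b where b: "\<And>y. \<bar>P y\<bar> \<le> b"
      using periodic_continuous_bcontfun[OF p] by (auto simp: bcontfun_def bounded_iff)
    show ?thesis
    proof (rule Bochner_Integration.integrable_bound[OF integrable_mult_left[OF x, of b]])
      show "(\<lambda>y. U i (x, y) * P y) \<in> borel_measurable lborel"
        using x borel_measurable_continuous_onI[OF p(2)] by (intro borel_measurable_times) auto
      show "AE y in lborel. norm (U i (x, y) * P y) \<le> norm (U i (x, y) * b)"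
        unfolding real_norm_def abs_mult
        by (intro AE_I2 mult_left_mono order_trans[OF b abs_ge_self]) simp
    qed
  qed
  have "fibre i P x - fibre i Q x = (LINT y|lborel. U i (x, y) * P y - U i (x, y) * Q y)"
    unfolding fibre_def using int[OF P] int[OF Q] by simp
  also have "norm \<dots> \<le> (LINT y|lborel. c * \<bar>U i (x, y)\<bar>)"
  proof (rule integral_norm_le_integral)
    fix y
    have "norm (U i (x, y) * P y - U i (x, y) * Q y) = \<bar>P y - Q y\<bar> * \<bar>U i (x, y)\<bar>"
      unfolding right_diff_distrib[symmetric] real_norm_def abs_mult by (rule mult.commute)
    also have "\<dots> \<le> c * \<bar>U i (x, y)\<bar>" by (intro mult_right_mono c) simp
    finally show "norm (U i (x, y) * P y - U i (x, y) * Q y) \<le> c * \<bar>U i (x, y)\<bar>" .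
  qed (use int[OF P] int[OF Q] x in auto)
  finally show ?thesis by simp
qed

text \<open>
  The exceptional null set of \<open>fibre_curl_zero\<close> is made independent of \<open>\<psi>\<close>. The periodized derivatives
  of test fields lie in a separable metric space, so their set has a countable dense subset, and for almost every \<open>x\<close> the
  equation is continuous in these derivatives for uniform convergence.
\<close>
lemma fibre_curl_zero_all:
  "AE x in lborel. x \<in> \<Omega> \<longrightarrow>
    (\<forall>\<psi>\<in>test_fields (UNIV :: (real^'m) set). curl_sum (\<lambda>l i j. fibre l (periodic_grad R \<psi> i j) x) = 0)"
proof -
  let ?T = "\<lambda>\<psi> x. curl_sum (\<lambda>l i j. fibre l (periodic_grad R \<psi> i j) x)"
  \<comment> \<open>One representative \<open>pick d N\<close> is chosen near each tuple \<open>d\<close> of trigonometric polynomials that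
    has a test field within \<open>1 / (N + 1)\<close>; these representatives are dense.\<close>
  define near where "near d N \<psi> \<longleftrightarrow> \<psi> \<in> test_fields UNIV \<and>
      (\<forall>i j y. \<bar>periodic_grad R \<psi> i j y - apply_bcontfun (trig_seq (d $ i $ j)) y\<bar> \<le> inverse (real (Suc N)))"
    for d :: "(nat^3)^3" and N :: nat and \<psi> :: "real^'m \<Rightarrow> real^3"
  define pick where "pick d N = (SOME \<psi>. near d N \<psi>)" for d N
  have pick: "near d N (pick d N)" if "near d N \<psi>" for d N \<psi>
    unfolding pick_def using someI_ex[of "near d N"] that by blast
  have "AE x in lborel. near d N (pick d N) \<longrightarrow> x \<in> \<Omega> \<longrightarrow> ?T (pick d N) x = 0" for d N
  proof (cases "near d N (pick d N)")
    case True
    then have "pick d N \<in> test_fields UNIV" by (simp add: near_def)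
    from fibre_curl_zero[OF this] show ?thesis by eventually_elim auto
  qed simp
  then have "AE x in lborel. \<forall>d N. near d N (pick d N) \<longrightarrow> x \<in> \<Omega> \<longrightarrow> ?T (pick d N) x = 0"
    by (simp add: AE_all_countable)
  then show ?thesis using AE_fibres_integrable
  proof eventually_elim
    case (elim x)
    show ?case
    proof (intro impI ballI)
      fix \<psi> :: "real^'m \<Rightarrow> real^3" assume x: "x \<in> \<Omega>" and \<psi>: "\<psi> \<in> test_fields UNIV"
      note W = periodic_grad_periodic_continuous[where R = R]
      define m where "m = (\<Sum>l\<in>UNIV. LINT y|lborel. \<bar>U l (x, y)\<bar>)"
      have m: "(LINT y|lborel. \<bar>U l (x, y)\<bar>) \<le> m" for l
        unfolding m_def by (rule member_le_sum) auto
      have bound: "\<bar>?T \<psi> x\<bar> \<le> 6 * (2 * inverse (real (Suc N)) * m)" for N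
      proof -
        have "\<exists>n. norm (Bcontfun (periodic_grad R \<psi> i j) - trig_seq n) < inverse (real (Suc N))" for i j
        proof -
          have b: "apply_bcontfun (Bcontfun (periodic_grad R \<psi> i j)) = periodic_grad R \<psi> i j"
            by (intro Bcontfun_inverse periodic_continuous_bcontfun W \<psi>)
          have "periodic (apply_bcontfun (Bcontfun (periodic_grad R \<psi> i j)))" unfolding b by (rule W[OF \<psi>])
          then obtain n where "norm (Bcontfun (periodic_grad R \<psi> i j) - trig_seq n) < inverse (real (Suc N))"
            by (rule trig_seq_dense) auto
          then show ?thesis by blast
        qed
        then obtain d where d: "\<And>i j. norm (Bcontfun (periodic_grad R \<psi> i j) - trig_seq (d i j)) < inverse (real (Suc N))" by metis
        define D where "D = (\<chi> i j. d i j)"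
        have near: "near D N \<psi>"
          unfolding near_def
        proof (intro conjI allI \<psi>)
          fix i j y
          have b: "apply_bcontfun (Bcontfun (periodic_grad R \<psi> i j)) = periodic_grad R \<psi> i j"
            by (intro Bcontfun_inverse periodic_continuous_bcontfun W \<psi>)
          show "\<bar>periodic_grad R \<psi> i j y - apply_bcontfun (trig_seq (D $ i $ j)) y\<bar> \<le> inverse (real (Suc N))"
            using abs_apply_bcontfun_le[of "Bcontfun (periodic_grad R \<psi> i j) - trig_seq (d i j)" y] d[of i j]
            by (simp add: b D_def)
        qed
        let ?\<psi>' = "pick D N"
        have near': "near D N ?\<psi>'" by (rule pick[OF near])
        then have \<psi>': "?\<psi>' \<in> test_fields UNIV" by (simp add: near_def)
        have "\<bar>periodic_grad R \<psi> i j y - periodic_grad R ?\<psi>' i j y\<bar> \<le> 2 * inverse (real (Suc N))" for i j y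
        proof -
          have "\<bar>periodic_grad R \<psi> i j y - apply_bcontfun (trig_seq (D $ i $ j)) y\<bar> \<le> inverse (real (Suc N))"
            "\<bar>periodic_grad R ?\<psi>' i j y - apply_bcontfun (trig_seq (D $ i $ j)) y\<bar> \<le> inverse (real (Suc N))"
            using near near' unfolding near_def by blast+
          then show ?thesis by linarith
        qed
        then have "\<bar>fibre l (periodic_grad R \<psi> i j) x - fibre l (periodic_grad R ?\<psi>' i j) x\<bar>
            \<le> 2 * inverse (real (Suc N)) * (LINT y|lborel. \<bar>U l (x, y)\<bar>)" for l i j
          using elim by (intro fibre_diff_le W \<psi> \<psi>') auto
        also have "2 * inverse (real (Suc N)) * (LINT y|lborel. \<bar>U l (x, y)\<bar>) \<le> 2 * inverse (real (Suc N)) * m" for l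
          by (intro mult_left_mono m) simp
        finally have "\<bar>?T \<psi> x - ?T ?\<psi>' x\<bar> \<le> 6 * (2 * inverse (real (Suc N)) * m)"
          by (intro abs_curl_sum_le)
        then show ?thesis using elim(1) near' x by auto
      qed
      have lim: "(\<lambda>N. 6 * (2 * inverse (real (Suc N)) * m)) \<longlonglongrightarrow> 6 * (2 * 0 * m)"
        by (intro tendsto_intros LIMSEQ_inverse_real_of_nat)
      have "\<bar>?T \<psi> x\<bar> \<le> 6 * (2 * 0 * m)"
        by (rule LIMSEQ_le_const[OF lim]) (use bound in blast)
      then show "?T \<psi> x = 0" by simp
    qed
  qed
qed

text \<open>
  The two-scale limit, extended periodically from the half-open cell.
\<close>
definition limit_field :: "real^3 \<Rightarrow> real^'m \<Rightarrow> real^3" where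
  "limit_field x y = (\<chi> i. U i (x, frac_part y))"

lemma limit_field_nth [simp]: "limit_field x y $ i = U i (x, frac_part y)"
  by (simp add: limit_field_def)

lemma limit_field_periodic: "periodic (limit_field x)"
  by (simp add: periodic_def limit_field_def)

lemma limit_field_on_cell: "y \<in> unit_cell \<Longrightarrow> limit_field x y $ i = U i (x, y)"
  using frac_part_eq[of y] cell_sandwich(1) by auto

lemma indicator_limit_field: "indicator half_open_cell y * limit_field x y $ i = U i (x, y)"
  using U0[of "(x, y)" i] by (auto simp: indicator_def frac_part_eq)

lemma limit_field_measurable:
  "(\<lambda>z. limit_field (fst z) (snd z)) \<in> borel_measurable borel" "limit_field x \<in> borel_measurable borel"
proof -
  have fs: "fst \<in> (borel :: ((real^3) \<times> (real^'m)) measure) \<rightarrow>\<^sub>M borel" "snd \<in> (borel :: ((real^3) \<times> (real^'m)) measure) \<rightarrow>\<^sub>M borel"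
    by (auto intro!: borel_measurable_continuous_onI continuous_intros)
  have "(\<lambda>z. (fst z, frac_part (snd z))) \<in> (borel :: ((real^3) \<times> (real^'m)) measure) \<rightarrow>\<^sub>M borel"
    by (intro borel_measurable_Pair fs measurable_compose[OF fs(2) frac_part_measurable])
  from measurable_compose[OF this Um]
  show 1: "(\<lambda>z. limit_field (fst z) (snd z)) \<in> borel_measurable borel"
    by (intro borel_measurable_vec3) simp
  have "(\<lambda>y. (x, y)) \<in> (borel :: (real^'m) measure) \<rightarrow>\<^sub>M borel"
    by (intro borel_measurable_continuous_onI continuous_intros)
  from measurable_compose[OF this 1] show "limit_field x \<in> borel_measurable borel" by simp
qed

lemma limit_field_L2_cell:
  assumes "\<And>i. integrable lborel (\<lambda>y. (U i (x, y))\<^sup>2)"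
  shows "limit_field x \<in> L2_on unit_cell"
proof -
  have m: "(\<lambda>y. (norm (limit_field x y))\<^sup>2) \<in> borel_measurable borel"
    using limit_field_measurable(2) by measurable
  have "integrable lborel (\<lambda>y. indicator unit_cell y *\<^sub>R (\<Sum>i\<in>UNIV. (U i (x, y))\<^sup>2))"
    by (intro integrable_mult_indicator Bochner_Integration.integrable_sum assms) simp
  moreover have "(\<lambda>y. indicator unit_cell y *\<^sub>R (\<Sum>i\<in>UNIV. (U i (x, y))\<^sup>2))
      = (\<lambda>y. indicator unit_cell y *\<^sub>R (norm (limit_field x y))\<^sup>2)"
    using limit_field_on_cell[of _ x] by (auto simp: norm_vec3_square indicator_def fun_eq_iff simp del: limit_field_nth)
  ultimately have "integrable (lebesgue_on unit_cell) (\<lambda>y. (norm (limit_field x y))\<^sup>2)"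
    by (simp only: lebesgue_on_borel(2)[OF m unit_cell_borel])
  then show ?thesis
    using lebesgue_on_borel(1)[OF limit_field_measurable(2) unit_cell_borel] by (simp add: L2_on_def)
qed

lemma limit_field_L2:
  "(\<lambda>(x, y). limit_field x y) \<in> L2_on (\<Omega> \<times> unit_cell)"
  "(\<lambda>(x, y). limit_field x y $ i) \<in> L2_on (\<Omega> \<times> unit_cell)"
proof -
  have \<Omega>Y: "\<Omega> \<times> (unit_cell :: (real^'m) set) \<in> sets borel" using \<Omega> by (intro borel_Times) auto
  let ?f = "\<lambda>z. limit_field (fst z) (snd z)"
  have m: "(\<lambda>z. (norm (?f z))\<^sup>2) \<in> borel_measurable borel"
    using limit_field_measurable(1) by measurable
  have "integrable lborel (\<lambda>z. indicator (\<Omega> \<times> unit_cell) z *\<^sub>R (\<Sum>i\<in>UNIV. (U i z)\<^sup>2))"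
    using \<Omega>Y by (intro integrable_mult_indicator Bochner_Integration.integrable_sum U2) simp
  moreover have "(\<lambda>z. indicator (\<Omega> \<times> unit_cell) z *\<^sub>R (\<Sum>i\<in>UNIV. (U i z)\<^sup>2))
      = (\<lambda>z. indicator (\<Omega> \<times> unit_cell) z *\<^sub>R (norm (?f z))\<^sup>2)"
    using limit_field_on_cell by (auto simp: norm_vec3_square indicator_def fun_eq_iff simp del: limit_field_nth)
  ultimately have i: "integrable (lebesgue_on (\<Omega> \<times> unit_cell)) (\<lambda>z. (norm (?f z))\<^sup>2)"
    by (simp only: lebesgue_on_borel(2)[OF m \<Omega>Y])
  have fm: "?f \<in> borel_measurable (lebesgue_on (\<Omega> \<times> unit_cell))"
    by (rule lebesgue_on_borel(1)[OF limit_field_measurable(1) \<Omega>Y])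
  show "(\<lambda>(x, y). limit_field x y) \<in> L2_on (\<Omega> \<times> unit_cell)"
    using i fm by (simp add: L2_on_def split_def)
  have gm: "(\<lambda>z. ?f z $ j) \<in> borel_measurable (lebesgue_on (\<Omega> \<times> unit_cell))" for j
    by (rule measurable_compose[OF fm]) (intro borel_measurable_continuous_onI continuous_intros)
  have "integrable (lebesgue_on (\<Omega> \<times> unit_cell)) (\<lambda>z. (norm (?f z $ i))\<^sup>2)"
  proof (rule Bochner_Integration.integrable_bound[OF i])
    show "AE z in lebesgue_on (\<Omega> \<times> unit_cell). norm ((norm (?f z $ i))\<^sup>2) \<le> norm ((norm (?f z))\<^sup>2)"
    proof (rule AE_I2)
      fix z
      have "(norm (?f z $ i))\<^sup>2 \<le> (norm (?f z))\<^sup>2"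
        by (intro power_mono) (simp_all only: real_norm_def component_le_norm_cart norm_ge_zero)
      then show "norm ((norm (?f z $ i))\<^sup>2) \<le> norm ((norm (?f z))\<^sup>2)" by (simp only: real_norm_def abs_power2)
    qed
  qed (use gm[of i] in measurable)
  then show "(\<lambda>(x, y). limit_field x y $ i) \<in> L2_on (\<Omega> \<times> unit_cell)"
    using gm[of i] by (simp add: L2_on_def split_def)
qed

text \<open>
  On the whole \<open>y\<close>-space the pairing with the curl of \<open>\<psi>\<close> unfolds to the pairing over one cell with
  the periodized derivatives.
\<close>
lemma limit_field_weak_curl:
  assumes x: "\<And>i. integrable lborel (\<lambda>y. U i (x, y))"
    and T: "\<And>\<psi>. \<psi> \<in> test_fields (UNIV :: (real^'m) set) \<Longrightarrow> curl_sum (\<lambda>l i j. fibre l (periodic_grad R \<psi> i j) x) = 0"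
  shows "has_weak_curl_on (grad_R R) UNIV (limit_field x) (\<lambda>_. 0)"
  unfolding has_weak_curl_on_def
proof (intro conjI ballI)
  have cell: "integrable lborel (\<lambda>y. indicator half_open_cell y *\<^sub>R limit_field x y)"
    by (rule integrable_vec3) (use x indicator_limit_field[of _ x] in simp)
  show "locally_integrable_on UNIV (limit_field x)"
    unfolding locally_integrable_on_def
  proof (intro allI impI, elim conjE)
    fix K :: "(real^'m) set" assume K: "compact K"
    then have Kb: "K \<in> sets borel" by (simp add: compact_imp_closed)
    have "integrable lborel (\<lambda>y. indicator K y *\<^sub>R limit_field x y)"
      by (rule unfold_periodic(1)[OF limit_field_periodic limit_field_measurable(2) _ cell, of "indicator K" 1 K
            "{k. \<exists>y\<in>half_open_cell. y + int_vec k \<in> K}"])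
        (use Kb K in \<open>auto simp: indicator_def intro: finite_int_shifts bounded_half_open_cell compact_imp_bounded\<close>)
    then show "integrable (lebesgue_on K) (limit_field x)"
      by (simp add: lebesgue_on_borel(2)[OF limit_field_measurable(2) Kb])
  qed
  show "locally_integrable_on UNIV (\<lambda>_ :: real^'m. 0 :: real^3)" by (simp add: locally_integrable_on_def)
  fix \<psi> assume \<psi>: "\<psi> \<in> test_fields (UNIV :: (real^'m) set)"
  let ?g = "\<lambda>i j y. grad_R R (\<lambda>z. \<psi> z $ i) y $ j"
  have gc: "continuous_on UNIV (?g i j)" for i j by (rule grad_R_continuous[OF test_fields_smooth[OF \<psi>]])
  have per: "periodic (\<lambda>y. limit_field x y $ l)" for l
    using limit_field_periodic[of x] by (simp add: periodic_def)
  have lm: "(\<lambda>y. limit_field x y $ l) \<in> borel_measurable borel" for l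
    by (rule measurable_compose[OF limit_field_measurable(2)]) (intro borel_measurable_continuous_onI continuous_intros)
  have ci: "integrable lborel (\<lambda>y. indicator half_open_cell y * limit_field x y $ l)" for l
    unfolding indicator_limit_field by (rule x)
  note P = integral_periodize[OF per lm ci gc test_fields_bounded[OF \<psi>]]
  have P1: "integrable lborel (\<lambda>y. limit_field x y $ l * ?g i j y)" for l i j
    by (rule P(1)) (use grad_R_support[of _ \<psi> R i j] in blast)
  have P2: "(LINT y|lborel. limit_field x y $ l * ?g i j y) = fibre l (periodic_grad R \<psi> i j) x" for l i j
  proof -
    have "(LINT y|lborel. limit_field x y $ l * ?g i j y)
        = (LINT y|lborel. indicator half_open_cell y * (limit_field x y $ l * periodize (?g i j) y))"
      by (rule P(2)) (use grad_R_support[of _ \<psi> R i j] in blast)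
    then show ?thesis
      unfolding mult.assoc[symmetric] indicator_limit_field by (simp add: fibre_def periodic_grad_def)
  qed
  have "(LINT y|lebesgue_on UNIV. limit_field x y \<bullet> curl_op (grad_R R) \<psi> y)
      = (LINT y|lebesgue_on UNIV. curl_sum (\<lambda>l i j. limit_field x y $ l * ?g i j y))"
    by (simp only: inner_curl_op)
  also have "\<dots> = (LINT y|lborel. curl_sum (\<lambda>l i j. limit_field x y $ l * ?g i j y))"
    using lebesgue_on_borel(3)[of "\<lambda>y. curl_sum (\<lambda>l i j. limit_field x y $ l * ?g i j y)" UNIV]
      integral_curl_sum(1)[OF P1] by simp
  also have "\<dots> = curl_sum (\<lambda>l i j. fibre l (periodic_grad R \<psi> i j) x)"
    by (simp only: integral_curl_sum(2)[OF P1] P2)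
  also have "\<dots> = 0" by (rule T[OF \<psi>])
  finally show "(LINT y|lebesgue_on UNIV. limit_field x y \<bullet> curl_op (grad_R R) \<psi> y) = (LINT y|lebesgue_on UNIV. 0 \<bullet> \<psi> y)"
    by simp
qed

lemma AE_limit_field:
  "AE x in lebesgue_on \<Omega>. limit_field x \<in> H_curl_R0 R"
proof -
  have "AE x in lborel. x \<in> \<Omega> \<longrightarrow> limit_field x \<in> H_curl_R0 R"
    using fibre_curl_zero_all AE_fibres_integrable
  proof eventually_elim
    case (elim x)
    then show ?case
      using limit_field_weak_curl[of x] limit_field_L2_cell[of x] limit_field_periodic[of x]
      by (auto simp: H_curl_R0_def L2_periodic_def)
  qed
  then have "AE x in lebesgue. x \<in> \<Omega> \<longrightarrow> limit_field x \<in> H_curl_R0 R" by (rule AE_completion)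
  then show ?thesis using \<Omega> by (subst AE_restrict_space_iff) auto
qed

lemma limit_field_two_scale: "two_scale_weak_vec R \<Omega> \<eta> u limit_field"
  unfolding two_scale_weak_vec_def two_scale_weak_def
proof (intro allI conjI ballI)
  show "(\<lambda>x. u n x $ i) \<in> L2_on \<Omega>" for n i by (rule u)
  show "(\<lambda>(x, y). limit_field x y $ i) \<in> L2_on (\<Omega> \<times> unit_cell)" for i by (rule limit_field_L2(2))
  fix i and \<phi> :: "real^3 \<Rightarrow> (real^'m) \<Rightarrow>\<^sub>C real" assume \<phi>: "\<phi> \<in> L2_C_periodic \<Omega>"
  have "(LINT z|lebesgue_on (\<Omega> \<times> unit_cell). U i z * apply_bcontfun (\<phi> (fst z)) (snd z))
      = (LINT (x, y)|lebesgue_on (\<Omega> \<times> unit_cell). limit_field x y $ i * apply_bcontfun (\<phi> x) y)"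
  proof (rule Bochner_Integration.integral_cong[OF refl])
    fix z :: "(real^3) \<times> (real^'m)" assume "z \<in> space (lebesgue_on (\<Omega> \<times> unit_cell))"
    then show "U i z * apply_bcontfun (\<phi> (fst z)) (snd z) = (case z of (x, y) \<Rightarrow> limit_field x y $ i * apply_bcontfun (\<phi> x) y)"
      using limit_field_on_cell[of "snd z" "fst z" i] by (cases z) auto
  qed
  then show "(\<lambda>n. LINT x|lebesgue_on \<Omega>. u n x $ i * apply_bcontfun (\<phi> x) ((1 / \<eta> n) *\<^sub>R (R *v x)))
      \<longlonglongrightarrow> (LINT (x, y)|lebesgue_on (\<Omega> \<times> unit_cell). limit_field x y $ i * apply_bcontfun (\<phi> x) y)"
    using limit[OF \<phi>, of i] by (simp add: fast_def)
qed

text \<open>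
  The components of the mean are the fibres against the constant \<open>1\<close>. This holds only for almost
  every \<open>x\<close>: where some component is not integrable over the cell, the vector integral is zero by
  convention.
\<close>
lemma limit_field_mean:
  "integrable lborel (\<lambda>x. LINT y|lebesgue_on unit_cell. limit_field x y)"
  "AE x in lborel. \<forall>i. (LINT y|lebesgue_on unit_cell. limit_field x y) $ i = fibre i (\<lambda>_. 1) x"
proof -
  define g where "g z = indicator unit_cell (snd z) *\<^sub>R limit_field (fst z) (snd z)" for z
  have fs: "snd \<in> (borel :: ((real^3) \<times> (real^'m)) measure) \<rightarrow>\<^sub>M borel"
    by (auto intro!: borel_measurable_continuous_onI continuous_intros)
  have gm: "g \<in> borel_measurable borel"
    unfolding g_def
    by (intro borel_measurable_scaleR limit_field_measurable(1) measurable_compose[OF fs]) auto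
  have g_nth: "g z $ i = indicator unit_cell (snd z) * U i z" for z i
    using limit_field_on_cell[of "snd z" "fst z" i] by (auto simp: g_def indicator_def)
  have gi: "integrable lborel g"
  proof (rule integrable_vec3)
    fix i
    show "integrable lborel (\<lambda>z. g z $ i)"
    proof (rule Bochner_Integration.integrable_bound[OF U1[of i]])
      show "(\<lambda>z. g z $ i) \<in> borel_measurable lborel"
        using measurable_compose[OF gm, of "\<lambda>v. v $ i" borel] by (auto intro!: borel_measurable_continuous_onI continuous_intros)
    qed (auto simp: g_nth indicator_def)
  qed
  have mean: "(LINT y|lebesgue_on unit_cell. limit_field x y) = (LINT y|lborel. g (x, y))" for x
    using lebesgue_on_borel(3)[OF limit_field_measurable(2)[of x] unit_cell_borel] by (simp add: g_def)
  show "integrable lborel (\<lambda>x. LINT y|lebesgue_on unit_cell. limit_field x y)"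
    unfolding mean using lborel_pair.integrable_fst'[of g] gi by (simp add: lborel_prod)
  have "AE x in lborel. integrable lborel (\<lambda>y. g (x, y))"
    using lborel_pair.AE_integrable_fst'[of g] gi by (simp add: lborel_prod)
  then show "AE x in lborel. \<forall>i. (LINT y|lebesgue_on unit_cell. limit_field x y) $ i = fibre i (\<lambda>_. 1) x"
    using AE_fibres_integrable
  proof eventually_elim
    case (elim x)
    show ?case
    proof
      fix i
      have "(LINT y|lborel. g (x, y)) $ i = (LINT y|lborel. g (x, y) $ i)"
        by (rule integral_bounded_linear[OF bounded_linear_vec_nth elim(1), symmetric])
      also have "\<dots> = (LINT y|lborel. U i (x, y))"
      proof (rule integral_cong_AE)
        show "AE y in lborel. g (x, y) $ i = U i (x, y)"
          using AE_cell_iff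
          by eventually_elim (use U0 in \<open>auto simp: g_nth indicator_def\<close>)
        show "(\<lambda>y. U i (x, y)) \<in> borel_measurable lborel"
          using elim(2) borel_measurable_integrable by blast
        have "integrable lborel (\<lambda>y. g (x, y) $ i)"
          by (rule integrable_bounded_linear[OF bounded_linear_vec_nth elim(1)])
        then show "(\<lambda>y. g (x, y) $ i) \<in> borel_measurable lborel" by auto
      qed
      finally show "(LINT y|lebesgue_on unit_cell. limit_field x y) $ i = fibre i (\<lambda>_. 1) x"
        by (simp add: mean fibre_def)
    qed
  qed
qed

lemma limit_field_mean_curl:
  "has_weak_curl_on grad \<Omega> (\<lambda>x. LINT y|lebesgue_on unit_cell. limit_field x y) (\<lambda>_. 0)"
  unfolding has_weak_curl_on_def
proof (intro conjI ballI)
  let ?m = "\<lambda>x. LINT y|lebesgue_on unit_cell. limit_field x y"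
  note mi = limit_field_mean(1)
  have mm: "?m \<in> borel_measurable borel" using mi by auto
  show "locally_integrable_on \<Omega> ?m"
    unfolding locally_integrable_on_def
  proof (intro allI impI, elim conjE)
    fix K :: "(real^3) set" assume "compact K"
    then have Kb: "K \<in> sets borel" by (simp add: compact_imp_closed)
    show "integrable (lebesgue_on K) ?m"
      unfolding lebesgue_on_borel(2)[OF mm Kb] using Kb by (intro integrable_mult_indicator mi) simp
  qed
  show "locally_integrable_on \<Omega> (\<lambda>_. 0 :: real^3)" by (simp add: locally_integrable_on_def)
  fix \<psi> assume \<psi>: "\<psi> \<in> test_fields \<Omega>"
  have \<psi>s: "smooth (\<lambda>x. \<psi> x $ i)" for i by (rule test_fields_smooth[OF \<psi>])
  define s where "s l x = curl_op grad \<psi> x $ l" for l x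
  have s_eq: "s l x = curl_sum (\<lambda>l' i j. of_bool (l' = l) * partial_deriv j (\<lambda>z. \<psi> z $ i) x)" for l x
    by (simp add: s_def curl_op_nth grad_nth)
  have sc: "continuous_on UNIV (s l)" for l
    unfolding s_eq curl_sum_def by (intro continuous_intros smooth_continuous smooth_partial_deriv \<psi>s)
  let ?K = "closure {x. \<psi> x \<noteq> 0}"
  have K: "compact ?K" "?K \<subseteq> \<Omega>" using \<psi> by (auto simp: test_fields_def)
  have s0: "s l x = 0" if "x \<notin> ?K" for l x
    unfolding s_eq by (simp add: partial_deriv_support[OF that] curl_sum_def)
  have "\<exists>b. \<forall>x. \<bar>s l x\<bar> \<le> b" for l
    by (rule bounded_continuous_compact_support[OF sc K(1) s0])
  then obtain b where b: "\<And>l x. \<bar>s l x\<bar> \<le> b l" by metis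
  have one: "periodic (\<lambda>_ :: real^'m. 1 :: real)" "continuous_on UNIV (\<lambda>_ :: real^'m. 1 :: real)"
    by (auto simp: periodic_def)
  note PT = product_test[OF sc b one, simplified]
  have "(\<lambda>n. \<Sum>l\<in>UNIV. LINT x|lebesgue_on \<Omega>. u n x $ l * s l x) \<longlonglongrightarrow> (\<Sum>l\<in>UNIV. LINT x|lborel. s l x * fibre l (\<lambda>_. 1) x)"
    by (intro tendsto_sum PT(3))
  moreover have "(\<Sum>l\<in>UNIV. LINT x|lebesgue_on \<Omega>. u n x $ l * s l x) = 0" for n
  proof -
    have "(\<Sum>l\<in>UNIV. LINT x|lebesgue_on \<Omega>. u n x $ l * s l x) = (LINT x|lebesgue_on \<Omega>. (\<Sum>l\<in>UNIV. u n x $ l * s l x))"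
      by (intro Bochner_Integration.integral_sum[symmetric] PT(1))
    also have "\<dots> = (LINT x|lebesgue_on \<Omega>. u n x \<bullet> curl_op grad \<psi> x)"
      by (simp add: s_def inner_vec_def)
    also have "\<dots> = 0" using curl_free[of n] \<psi> by (simp add: has_weak_curl_on_def)
    finally show ?thesis .
  qed
  ultimately have zero: "(\<Sum>l\<in>UNIV. LINT x|lborel. s l x * fibre l (\<lambda>_. 1) x) = 0"
    by (simp add: LIMSEQ_const_iff)
  have cm: "curl_op grad \<psi> \<in> borel_measurable borel"
    by (rule borel_measurable_vec3) (simp add: s_def[symmetric] borel_measurable_continuous_onI[OF sc])
  have im: "(\<lambda>x. ?m x \<bullet> curl_op grad \<psi> x) \<in> borel_measurable borel"
    using mm cm by (rule borel_measurable_inner)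
  have \<Omega>b: "\<Omega> \<in> sets borel" using \<Omega> by simp
  have "(LINT x|lebesgue_on \<Omega>. ?m x \<bullet> curl_op grad \<psi> x) = (LINT x|lborel. indicator \<Omega> x *\<^sub>R (?m x \<bullet> curl_op grad \<psi> x))"
    by (rule lebesgue_on_borel(3)[OF im \<Omega>b])
  also have "\<dots> = (LINT x|lborel. (\<Sum>l\<in>UNIV. s l x * fibre l (\<lambda>_. 1) x))"
  proof (rule integral_cong_AE)
    show "AE x in lborel. indicator \<Omega> x *\<^sub>R (?m x \<bullet> curl_op grad \<psi> x) = (\<Sum>l\<in>UNIV. s l x * fibre l (\<lambda>_. 1) x)"
      using limit_field_mean(2)
    proof eventually_elim
      case (elim x)
      have "?m x \<bullet> curl_op grad \<psi> x = (\<Sum>l\<in>UNIV. s l x * fibre l (\<lambda>_. 1) x)"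
        by (simp add: inner_vec_def s_def elim mult.commute)
      moreover have "(\<Sum>l\<in>UNIV. s l x * fibre l (\<lambda>_. 1) x) = 0" if "x \<notin> \<Omega>"
      proof -
        have "x \<notin> ?K" using K(2) that by blast
        from s0[OF this] show ?thesis by simp
      qed
      ultimately show ?case by (auto simp: indicator_def)
    qed
    show "(\<lambda>x. indicator \<Omega> x *\<^sub>R (?m x \<bullet> curl_op grad \<psi> x)) \<in> borel_measurable lborel"
      using im \<Omega>b by (intro borel_measurable_scaleR) auto
    show "(\<lambda>x. \<Sum>l\<in>UNIV. s l x * fibre l (\<lambda>_. 1) x) \<in> borel_measurable lborel"
      using PT(2) by (intro borel_measurable_sum) auto
  qed
  also have "\<dots> = (\<Sum>l\<in>UNIV. LINT x|lborel. s l x * fibre l (\<lambda>_. 1) x)"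
    by (intro Bochner_Integration.integral_sum PT(2))
  finally show "(LINT x|lebesgue_on \<Omega>. ?m x \<bullet> curl_op grad \<psi> x) = (LINT x|lebesgue_on \<Omega>. 0 \<bullet> \<psi> x)"
    using zero by simp
qed

end

lemma L2_on_component:
  fixes u :: "'a::euclidean_space \<Rightarrow> real^3"
  assumes "u \<in> L2_on \<Omega>"
  shows "(\<lambda>x. u x $ i) \<in> L2_on \<Omega>" "L2_norm_on \<Omega> (\<lambda>x. u x $ i) \<le> L2_norm_on \<Omega> u"
proof -
  have um: "u \<in> borel_measurable (lebesgue_on \<Omega>)" and ui: "integrable (lebesgue_on \<Omega>) (\<lambda>x. (norm (u x))\<^sup>2)"
    using assms by (auto simp: L2_on_def)
  have m: "(\<lambda>x. u x $ i) \<in> borel_measurable (lebesgue_on \<Omega>)"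
    by (rule measurable_compose[OF um]) (intro borel_measurable_continuous_onI continuous_intros)
  have le: "(norm (u x $ i))\<^sup>2 \<le> (norm (u x))\<^sup>2" for x
    by (intro power_mono) (simp_all only: real_norm_def component_le_norm_cart norm_ge_zero)
  have int: "integrable (lebesgue_on \<Omega>) (\<lambda>x. (norm (u x $ i))\<^sup>2)"
  proof (rule Bochner_Integration.integrable_bound[OF ui])
    have nn: "norm (t\<^sup>2) = t\<^sup>2" for t :: real by simp
    show "AE x in lebesgue_on \<Omega>. norm ((norm (u x $ i))\<^sup>2) \<le> norm ((norm (u x))\<^sup>2)"
      unfolding nn by (rule AE_I2) (rule le)
  qed (use m in measurable)
  then show "(\<lambda>x. u x $ i) \<in> L2_on \<Omega>" using m by (simp add: L2_on_def)
  show "L2_norm_on \<Omega> (\<lambda>x. u x $ i) \<le> L2_norm_on \<Omega> u"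
    unfolding L2_norm_on_def by (intro real_sqrt_le_mono Bochner_Integration.integral_mono int ui le)
qed

theorem proposition11:
  fixes \<Omega> :: "(real^3) set"
    and R :: "real^3^'m"
    and \<eta> :: "nat \<Rightarrow> real"
    and u :: "nat \<Rightarrow> real^3 \<Rightarrow> real^3"
  assumes "open \<Omega>" and "bounded \<Omega>" and "lipschitz_boundary \<Omega>"
    and "CARD('m) > 3" and "nonresonant R"
    and "\<And>n. \<eta> n > 0" and "\<eta> \<longlonglongrightarrow> 0"
    and "\<And>n. u n \<in> L2_on \<Omega>"
    and "\<exists>C. \<forall>n. L2_norm_on \<Omega> (u n) \<le> C"
    and "\<And>n. has_weak_curl_on grad \<Omega> (u n) (\<lambda>_. 0)"
  shows "\<exists>(r :: nat \<Rightarrow> nat) (u\<^sub>0 :: real^3 \<Rightarrow> real^'m \<Rightarrow> real^3).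
           strict_mono r \<and>
           u\<^sub>0 \<in> L2_H_curl_R0 \<Omega> R \<and>
           two_scale_weak_vec R \<Omega> (\<eta> \<circ> r) (u \<circ> r) u\<^sub>0 \<and>
           (\<exists>w. (AE x in lebesgue_on \<Omega>. has_weak_curl_on (grad_R R) UNIV (u\<^sub>0 x) (w x)) \<and>
                (AE (x, y) in lebesgue_on (\<Omega> \<times> unit_cell). w x y = 0)) \<and>
           (\<exists>w. has_weak_curl_on grad \<Omega> (\<lambda>x. LINT y|lebesgue_on unit_cell. u\<^sub>0 x y) w \<and>
                (AE x in lebesgue_on \<Omega>. w x = 0))"
proof -
  have fin: "emeasure lborel \<Omega> < \<infinity>" using \<open>bounded \<Omega>\<close> by (rule emeasure_bounded_finite)
  obtain C where C: "\<And>n. L2_norm_on \<Omega> (u n) \<le> C" using assms(9) by blast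
  have ui: "(\<lambda>x. u n x $ i) \<in> L2_on \<Omega>" "L2_norm_on \<Omega> (\<lambda>x. u n x $ i) \<le> C" for n i
    using L2_on_component(1)[OF assms(8)] order_trans[OF L2_on_component(2)[OF assms(8)] C] by blast+
  obtain r :: "nat \<Rightarrow> nat" where r: "strict_mono r"
    "\<And>A j i. A \<in> basic_opens \<Omega> \<Longrightarrow> convergent (\<lambda>n. LINT x|lebesgue_on \<Omega>.
        u (r n) x $ i * (indicator A x * apply_bcontfun (trig_seq j) (fast R (\<eta> (r n)) x)))"
    by (rule generator_subsequence[OF \<open>open \<Omega>\<close> fin ui, where \<eta> = \<eta> and R = R]) (rule that)
  have \<eta>r: "(\<lambda>n. \<eta> (r n)) \<longlonglongrightarrow> 0" using LIMSEQ_subseq_LIMSEQ[OF assms(7) r(1)] by (simp add: o_def)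
  define is_limit where "is_limit i U \<longleftrightarrow> U \<in> borel_measurable borel \<and> integrable lborel (\<lambda>z. (U z)\<^sup>2) \<and>
      (\<forall>z. z \<notin> \<Omega> \<times> half_open_cell \<longrightarrow> U z = 0) \<and>
      (\<forall>\<phi>\<in>L2_C_periodic \<Omega>. (\<lambda>n. LINT x|lebesgue_on \<Omega>. u (r n) x $ i * apply_bcontfun (\<phi> x) (fast R (\<eta> (r n)) x))
      \<longlonglongrightarrow> (LINT z|lebesgue_on (\<Omega> \<times> unit_cell). U z * apply_bcontfun (\<phi> (fst z)) (snd z)))"
    for i and U :: "(real^3) \<times> (real^'m) \<Rightarrow> real"
  have "\<exists>U. is_limit i U" for i
    by (rule two_scale_limit_exists[OF \<open>open \<Omega>\<close> fin \<open>nonresonant R\<close> assms(6) \<eta>r ui r(2)])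
      (auto simp: is_limit_def)
  then obtain U where U: "\<And>i. is_limit i (U i)" by metis
  note U' = U[unfolded is_limit_def]
  interpret two_scale_setting \<Omega> R "\<lambda>n. \<eta> (r n)" "\<lambda>n. u (r n)" U
    by (rule two_scale_setting.intro[OF \<open>open \<Omega>\<close> fin assms(6) \<eta>r ui(1) assms(10)])
      (use U' in blast)+
  have "limit_field \<in> L2_H_curl_R0 \<Omega> R"
    using limit_field_L2(1) AE_limit_field by (simp add: L2_H_curl_R0_def)
  moreover have "AE x in lebesgue_on \<Omega>. has_weak_curl_on (grad_R R) UNIV (limit_field x) (\<lambda>_. 0)"
    using AE_limit_field by eventually_elim (simp add: H_curl_R0_def)
  ultimately show ?thesis
    using r(1) limit_field_two_scale limit_field_mean_curl
    by (intro exI[of _ r] exI[of _ limit_field] conjI exI[of _ "\<lambda>_ _. 0"] exI[of _ "\<lambda>_. 0"]) (auto simp: o_def)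
qed

end
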